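(* Let $(M,\xi,T)$ be a compact connected contact toric manifold which corresponds to a weakly convex cone, i.e. whose moment cone $C(\Psi)$ is a weakly convex good cone. Then for any $T$-invariant contact form $\alpha$ for $\xi$, any $T$-invariant metric $g$ and any $T$-invariant almost CR structure $\Phi$ such that $(\alpha,\Phi,g)$ is a contact metric structure on $M$, the toric contact metric manifold $(M,\alpha,T,\Phi,g)$ is not a toric K-contact manifold.
   Context: A contact toric manifold $(M,\xi,T)$ is a co-oriented contact manifold $(M,\xi)$ with a torus $T$ (Lie algebra $\mathfrak{t}$) embedded in the group of contactomorphisms, with $\dim T=\frac12(\dim M+1)$. Let $\xi^\circ\subset T^*M$ be the annihilator of $\xi$ and $\xi^\circ_+$ the chosen positive component of $\xi^\circ\setminus\{\text{zero section}\}$. The universal moment map is $\Psi:\xi^\circ_+\to\mathfrak{t}^*$, $\langle\Psi(x,\alpha_x),X\rangle=\alpha_x(X)$ ($X\in\mathfrak{t}$ viewed as induced vector field), and the moment cone is $C(\Psi)=\mathrm{Im}\,\Psi\cup\{0\}$. A polyhedral cone $C=\{x\in\mathfrak{t}^*\mid\langle x,\eta_i\rangle\ge0,\ i=1,\dots,N\}$ (with $\eta_i\in\mathfrak{t}\cong\mathbb{R}^n$ the conormals of its facets, up to sign) is good if $C\setminus\{0\}$ is a unimodular set: each vertex of $C\setminus\{0\}$ (if any) is simple, each conormal $\eta_i$ lies in the integral lattice $\mathbb{Z}^n$ and is primitive, and for every $I\subset\{1,\dots,N\}$ such that $\{x\in C\setminus\{0\}\mid\langle x,\eta_i\rangle=0,\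 i\in I\}\ne\emptyset$, the set $\{\eta_i\}_{i\in I}$ is a basis of the integral lattice of a subtorus of $T$. The cone is strongly convex if $\eta_1,\dots,\eta_N$ span $\mathfrak{t}$ over $\mathbb{R}$, and weakly convex if it is not strongly convex. Contact metric structure $(\alpha,\Phi,g)$: $\alpha$ is a contact form with Reeb vector field $R_\alpha$ ($\alpha(R_\alpha)=1$, $\iota_{R_\alpha}d\alpha=0$), $\Phi$ is an endomorphism of $TM$ with $\Phi^2=-\mathrm{Id}+R_\alpha\otimes\alpha$, and $g$ is a Riemannian metric with $g(X,Y)=d\alpha(\Phi X,Y)+\alpha(X)\alpha(Y)$ (up to the usual sign/normalization convention). It is K-contact if $R_\alpha$ is a Killing field of $g$. A toric K-contact manifold $(M,\alpha,T,\Phi,g)$ is a contact toric manifold with a K-contact structure $(\alpha,\Phi,g)$ consisting of $T$-invariant $\alpha$, $\Phi$ and $g$. *)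

theory Defs
  imports "HOL-Analysis.Analysis"
begin

section \<open>Smooth manifolds\<close>

text \<open>Intended for open \<open>S\<close> in a finite-dimensional space, where the directional derivatives of all
  orders being continuous is the usual notion of a \<open>C\<^sup>k\<close> map.\<close>

fun Ck_on :: "nat \<Rightarrow> 'a::real_normed_vector set \<Rightarrow> ('a \<Rightarrow> 'b::real_normed_vector) \<Rightarrow> bool" where
  "Ck_on 0 S f \<longleftrightarrow> continuous_on S f"
| "Ck_on (Suc k) S f \<longleftrightarrow> (\<forall>x\<in>S. f differentiable (at x)) \<and>
     (\<forall>v. Ck_on k S (\<lambda>x. frechet_derivative f (at x) v))"

definition smooth_on :: "'a::real_normed_vector set \<Rightarrow> ('a \<Rightarrow> 'b::real_normed_vector) \<Rightarrow> bool" where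
  "smooth_on S f \<longleftrightarrow> (\<forall>k. Ck_on k S f)"

text \<open>The manifold is the whole type \<open>'m\<close>; a chart is a pair \<open>(U, \<phi>)\<close>, of which only the restriction
  of \<open>\<phi>\<close> to \<open>U\<close> matters. The dimension is \<open>DIM('e)\<close>.\<close>

type_synonym ('m, 'e) atlas = "('m set \<times> ('m \<Rightarrow> 'e)) set"

definition smooth_atlas :: "('m::topological_space, 'e::euclidean_space) atlas \<Rightarrow> bool" where
  "smooth_atlas A \<longleftrightarrow>
     (\<Union>(U, \<phi>)\<in>A. U) = UNIV \<and>
     (\<forall>(U, \<phi>)\<in>A. open U \<and> open (\<phi> ` U) \<and> homeomorphism U (\<phi> ` U) \<phi> (inv_into U \<phi>)) \<and>
     (\<forall>(U, \<phi>)\<in>A. \<forall>(V, \<psi>)\<in>A. smooth_on (\<phi> ` (U \<inter> V)) (\<psi> \<circ> inv_into U \<phi>))"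

definition euclidean_atlas :: "('a::euclidean_space, 'a) atlas" where
  "euclidean_atlas = {(UNIV, id)}"

definition product_atlas :: "('a, 'd) atlas \<Rightarrow> ('b, 'e) atlas \<Rightarrow> ('a \<times> 'b, 'd \<times> 'e) atlas" where
  "product_atlas A B = {(U \<times> V, map_prod \<phi> \<psi>) | U V \<phi> \<psi>. (U, \<phi>) \<in> A \<and> (V, \<psi>) \<in> B}"

definition smooth_map ::
  "('a::topological_space, 'd::euclidean_space) atlas \<Rightarrow>
   ('b::topological_space, 'e::euclidean_space) atlas \<Rightarrow> ('a \<Rightarrow> 'b) \<Rightarrow> bool" where
  "smooth_map A B F \<longleftrightarrow> continuous_on UNIV F \<and>
     (\<forall>(U, \<phi>)\<in>A. \<forall>(V, \<psi>)\<in>B. smooth_on (\<phi> ` (U \<inter> F -` V)) (\<psi> \<circ> F \<circ> inv_into U \<phi>))"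

definition smooth_fun :: "('m::topological_space, 'e::euclidean_space) atlas \<Rightarrow> ('m \<Rightarrow> real) \<Rightarrow> bool" where
  "smooth_fun A f \<longleftrightarrow> smooth_map A euclidean_atlas f"


section \<open>Tangent vectors and tensor fields\<close>

text \<open>Tangent vectors at \<open>p\<close> are derivations at \<open>p\<close> of the algebra of smooth functions. To represent
  each of them by a unique total function they are made to vanish on non-smooth functions.
  Covectors likewise vanish off the tangent space. The remaining tensors are only meaningful on
  tangent vectors.\<close>

type_synonym 'm tangent = "('m \<Rightarrow> real) \<Rightarrow> real"
type_synonym 'm vfield = "'m \<Rightarrow> 'm tangent"
type_synonym 'm covector = "'m tangent \<Rightarrow> real"
type_synonym 'm form = "'m \<Rightarrow> 'm covector"

definition tangent_space ::
  "('m::topological_space, 'e::euclidean_space) atlas \<Rightarrow> 'm \<Rightarrow> 'm tangent set" where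
  "tangent_space A p = {v.
     (\<forall>f. \<not> smooth_fun A f \<longrightarrow> v f = 0) \<and>
     (\<forall>f g. smooth_fun A f \<longrightarrow> smooth_fun A g \<longrightarrow> v (\<lambda>x. f x + g x) = v f + v g) \<and>
     (\<forall>c f. smooth_fun A f \<longrightarrow> v (\<lambda>x. c * f x) = c * v f) \<and>
     (\<forall>f g. smooth_fun A f \<longrightarrow> smooth_fun A g \<longrightarrow> v (\<lambda>x. f x * g x) = f p * v g + g p * v f)}"

definition lincomb :: "real \<Rightarrow> 'm tangent \<Rightarrow> real \<Rightarrow> 'm tangent \<Rightarrow> 'm tangent" where
  "lincomb a v b w = (\<lambda>f. a * v f + b * w f)"

definition zero_tangent :: "'m tangent" where
  "zero_tangent = (\<lambda>f. 0)"

definition cotangent_space ::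
  "('m::topological_space, 'e::euclidean_space) atlas \<Rightarrow> 'm \<Rightarrow> 'm covector set" where
  "cotangent_space A p = {\<beta>.
     (\<forall>a b. \<forall>v\<in>tangent_space A p. \<forall>w\<in>tangent_space A p.
        \<beta> (lincomb a v b w) = a * \<beta> v + b * \<beta> w) \<and>
     (\<forall>v. v \<notin> tangent_space A p \<longrightarrow> \<beta> v = 0)}"

definition pushforward ::
  "('m::topological_space, 'e::euclidean_space) atlas \<Rightarrow> ('m \<Rightarrow> 'm) \<Rightarrow> 'm tangent \<Rightarrow> 'm tangent" where
  "pushforward A F v = (\<lambda>f. if smooth_fun A f then v (f \<circ> F) else 0)"

definition vector_field :: "('m::topological_space, 'e::euclidean_space) atlas \<Rightarrow> 'm vfield \<Rightarrow> bool" where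
  "vector_field A X \<longleftrightarrow> (\<forall>p. X p \<in> tangent_space A p) \<and>
     (\<forall>f. smooth_fun A f \<longrightarrow> smooth_fun A (\<lambda>p. X p f))"

definition lie_bracket :: "'m vfield \<Rightarrow> 'm vfield \<Rightarrow> 'm vfield" where
  "lie_bracket X Y = (\<lambda>p f. X p (\<lambda>q. Y q f) - Y p (\<lambda>q. X q f))"

definition one_form :: "('m::topological_space, 'e::euclidean_space) atlas \<Rightarrow> 'm form \<Rightarrow> bool" where
  "one_form A \<alpha> \<longleftrightarrow> (\<forall>p. \<alpha> p \<in> cotangent_space A p) \<and>
     (\<forall>X. vector_field A X \<longrightarrow> smooth_fun A (\<lambda>p. \<alpha> p (X p)))"

text \<open>\<open>d\<alpha>(X, Y) = X(\<alpha>(Y)) - Y(\<alpha>(X)) - \<alpha>([X, Y])\<close>, without a factor \<open>1/2\<close>. The value at \<open>p\<close> depends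
  only on \<open>X p\<close> and \<open>Y p\<close>.\<close>

definition ext_deriv ::
  "('m::topological_space, 'e::euclidean_space) atlas \<Rightarrow> 'm form \<Rightarrow> 'm \<Rightarrow>
   'm tangent \<Rightarrow> 'm tangent \<Rightarrow> real" where
  "ext_deriv A \<alpha> p v w = (THE r. \<exists>X Y. vector_field A X \<and> vector_field A Y \<and> X p = v \<and> Y p = w \<and>
     r = X p (\<lambda>q. \<alpha> q (Y q)) - Y p (\<lambda>q. \<alpha> q (X q)) - \<alpha> p (lie_bracket X Y p))"

definition riemannian_metric ::
  "('m::topological_space, 'e::euclidean_space) atlas \<Rightarrow>
   ('m \<Rightarrow> 'm tangent \<Rightarrow> 'm tangent \<Rightarrow> real) \<Rightarrow> bool" where
  "riemannian_metric A g \<longleftrightarrow>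
     (\<forall>p. \<forall>u\<in>tangent_space A p. \<forall>v\<in>tangent_space A p. \<forall>w\<in>tangent_space A p. \<forall>a b.
        g p (lincomb a u b v) w = a * g p u w + b * g p v w) \<and>
     (\<forall>p. \<forall>v\<in>tangent_space A p. \<forall>w\<in>tangent_space A p. g p v w = g p w v) \<and>
     (\<forall>p. \<forall>v\<in>tangent_space A p. v \<noteq> zero_tangent \<longrightarrow> g p v v > 0) \<and>
     (\<forall>X Y. vector_field A X \<longrightarrow> vector_field A Y \<longrightarrow> smooth_fun A (\<lambda>p. g p (X p) (Y p)))"

definition tangent_endomorphism ::
  "('m::topological_space, 'e::euclidean_space) atlas \<Rightarrow>
   ('m \<Rightarrow> 'm tangent \<Rightarrow> 'm tangent) \<Rightarrow> bool" where
  "tangent_endomorphism A \<Phi> \<longleftrightarrow>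
     (\<forall>p. \<forall>v\<in>tangent_space A p. \<Phi> p v \<in> tangent_space A p) \<and>
     (\<forall>p. \<forall>v\<in>tangent_space A p. \<forall>w\<in>tangent_space A p. \<forall>a b.
        \<Phi> p (lincomb a v b w) = lincomb a (\<Phi> p v) b (\<Phi> p w)) \<and>
     (\<forall>X. vector_field A X \<longrightarrow> vector_field A (\<lambda>p. \<Phi> p (X p)))"

text \<open>\<open>(L\<^sub>K g)(X, Y) = K(g(X, Y)) - g([K, X], Y) - g(X, [K, Y]) = 0\<close>.\<close>

definition killing_field ::
  "('m::topological_space, 'e::euclidean_space) atlas \<Rightarrow>
   ('m \<Rightarrow> 'm tangent \<Rightarrow> 'm tangent \<Rightarrow> real) \<Rightarrow> 'm vfield \<Rightarrow> bool" where
  "killing_field A g K \<longleftrightarrow> vector_field A K \<and>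
     (\<forall>X Y p. vector_field A X \<longrightarrow> vector_field A Y \<longrightarrow>
        K p (\<lambda>q. g q (X q) (Y q)) = g p (lie_bracket K X p) (Y p) + g p (X p) (lie_bracket K Y p))"


section \<open>Contact structures\<close>

definition kernel_at ::
  "('m::topological_space, 'e::euclidean_space) atlas \<Rightarrow> 'm form \<Rightarrow> 'm \<Rightarrow> 'm tangent set" where
  "kernel_at A \<alpha> p = {v \<in> tangent_space A p. \<alpha> p v = 0}"

definition contact_form :: "('m::topological_space, 'e::euclidean_space) atlas \<Rightarrow> 'm form \<Rightarrow> bool" where
  "contact_form A \<alpha> \<longleftrightarrow> one_form A \<alpha> \<and>
     (\<forall>p. \<exists>v\<in>tangent_space A p. \<alpha> p v \<noteq> 0) \<and>
     (\<forall>p. \<forall>v\<in>kernel_at A \<alpha> p. v \<noteq> zero_tangent \<longrightarrow> (\<exists>w\<in>kernel_at A \<alpha> p. ext_deriv A \<alpha> p v w \<noteq> 0))"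

definition contact_form_for ::
  "('m::topological_space, 'e::euclidean_space) atlas \<Rightarrow> ('m \<Rightarrow> 'm tangent set) \<Rightarrow> 'm form \<Rightarrow> bool" where
  "contact_form_for A \<xi> \<alpha> \<longleftrightarrow> contact_form A \<alpha> \<and> (\<forall>p. \<xi> p = kernel_at A \<alpha> p)"

definition annihilator ::
  "('m::topological_space, 'e::euclidean_space) atlas \<Rightarrow> ('m \<Rightarrow> 'm tangent set) \<Rightarrow>
   ('m \<times> 'm covector) set" where
  "annihilator A \<xi> = {(p, \<beta>). \<beta> \<in> cotangent_space A p \<and> (\<forall>v\<in>\<xi> p. \<beta> v = 0)}"

text \<open>\<open>P\<close> is the chosen positive component of the annihilator of \<open>\<xi>\<close> minus its zero section. A
  component of it consists of the positive multiples of some global contact form.\<close>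

definition cooriented_contact ::
  "('m::topological_space, 'e::euclidean_space) atlas \<Rightarrow> ('m \<Rightarrow> 'm tangent set) \<Rightarrow>
   ('m \<times> 'm covector) set \<Rightarrow> bool" where
  "cooriented_contact A \<xi> P \<longleftrightarrow> smooth_atlas A \<and>
     (\<exists>\<alpha>. contact_form_for A \<xi> \<alpha> \<and>
        P = {(p, \<beta>) \<in> annihilator A \<xi>. \<exists>c>0. \<forall>v. \<beta> v = c * \<alpha> p v})"

definition contactomorphism ::
  "('m::topological_space, 'e::euclidean_space) atlas \<Rightarrow> ('m \<Rightarrow> 'm tangent set) \<Rightarrow> ('m \<Rightarrow> 'm) \<Rightarrow> bool" where
  "contactomorphism A \<xi> F \<longleftrightarrow> bij F \<and> smooth_map A A F \<and> smooth_map A A (inv F) \<and>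
     (\<forall>p. pushforward A F ` \<xi> p = \<xi> (F p))"

definition reeb_field :: "('m::topological_space, 'e::euclidean_space) atlas \<Rightarrow> 'm form \<Rightarrow> 'm vfield" where
  "reeb_field A \<alpha> = (THE R. vector_field A R \<and> (\<forall>p. \<alpha> p (R p) = 1) \<and>
     (\<forall>p. \<forall>v\<in>tangent_space A p. ext_deriv A \<alpha> p (R p) v = 0))"

definition contact_metric_structure ::
  "('m::topological_space, 'e::euclidean_space) atlas \<Rightarrow> 'm form \<Rightarrow>
   ('m \<Rightarrow> 'm tangent \<Rightarrow> 'm tangent) \<Rightarrow> ('m \<Rightarrow> 'm tangent \<Rightarrow> 'm tangent \<Rightarrow> real) \<Rightarrow> bool" where
  "contact_metric_structure A \<alpha> \<Phi> g \<longleftrightarrow>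
     contact_form A \<alpha> \<and> tangent_endomorphism A \<Phi> \<and> riemannian_metric A g \<and>
     (\<forall>p. \<forall>v\<in>tangent_space A p. \<Phi> p (\<Phi> p v) = lincomb (- 1) v (\<alpha> p v) (reeb_field A \<alpha> p)) \<and>
     (\<forall>p. \<forall>v\<in>tangent_space A p. \<forall>w\<in>tangent_space A p.
        g p v w = ext_deriv A \<alpha> p (\<Phi> p v) w + \<alpha> p v * \<alpha> p w)"

definition K_contact_structure ::
  "('m::topological_space, 'e::euclidean_space) atlas \<Rightarrow> 'm form \<Rightarrow>
   ('m \<Rightarrow> 'm tangent \<Rightarrow> 'm tangent) \<Rightarrow> ('m \<Rightarrow> 'm tangent \<Rightarrow> 'm tangent \<Rightarrow> real) \<Rightarrow> bool" where
  "K_contact_structure A \<alpha> \<Phi> g \<longleftrightarrow>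
     contact_metric_structure A \<alpha> \<Phi> g \<and> killing_field A g (reeb_field A \<alpha>)"


section \<open>The torus and its actions\<close>

text \<open>The torus is the group of \<open>z \<in> \<complex>\<^sup>n\<close> with all \<open>\<bar>z\<^sub>i\<bar> = 1\<close>, under the componentwise product of
  type \<open>vec\<close>. Its Lie algebra is \<open>\<real>\<^sup>n\<close>, normalised so that the integral lattice, the kernel of the
  exponential map, is \<open>\<int>\<^sup>n\<close>. The dual of the Lie algebra is identified with \<open>\<real>\<^sup>n\<close> by the inner product.\<close>

definition torus :: "(complex ^ 'n) set" where
  "torus = {z. \<forall>i. cmod (z $ i) = 1}"

definition torus_exp :: "real ^ 'n \<Rightarrow> complex ^ 'n" where
  "torus_exp X = (\<chi> i. cis (2 * pi * (X $ i)))"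

definition subtorus :: "(complex ^ 'n) set \<Rightarrow> bool" where
  "subtorus S \<longleftrightarrow> S \<subseteq> torus \<and> 1 \<in> S \<and> (\<forall>z\<in>S. \<forall>w\<in>S. z * w \<in> S) \<and>
     (\<forall>z\<in>S. \<exists>w\<in>S. z * w = 1) \<and> closed S \<and> connected S"

definition integral_lattice :: "(complex ^ 'n) set \<Rightarrow> (real ^ 'n) set" where
  "integral_lattice S = {X. (\<forall>t. torus_exp (t *\<^sub>R X) \<in> S) \<and> torus_exp X = 1}"

text \<open>The torus, embedded by \<open>\<rho>\<close> in the group of contactomorphisms, acts smoothly. Smoothness of the
  action map is tested on the universal cover \<open>\<real>\<^sup>n\<close> of the torus.\<close>

definition contact_toric ::
  "('m::{t2_space,second_countable_topology}, 'e::euclidean_space) atlas \<Rightarrow> ('m \<Rightarrow> 'm tangent set) \<Rightarrow>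
   ('m \<times> 'm covector) set \<Rightarrow> (complex ^ 'n \<Rightarrow> 'm \<Rightarrow> 'm) \<Rightarrow> bool" where
  "contact_toric A \<xi> P \<rho> \<longleftrightarrow> cooriented_contact A \<xi> P \<and>
     (\<forall>z\<in>torus. contactomorphism A \<xi> (\<rho> z)) \<and>
     (\<forall>z\<in>torus. \<forall>w\<in>torus. \<rho> (z * w) = \<rho> z \<circ> \<rho> w) \<and>
     inj_on \<rho> torus \<and>
     smooth_map (product_atlas euclidean_atlas A) A (\<lambda>(X, p). \<rho> (torus_exp X) p) \<and>
     2 * CARD('n) = DIM('e) + 1"

definition induced_field ::
  "('m::topological_space, 'e::euclidean_space) atlas \<Rightarrow> (complex ^ 'n \<Rightarrow> 'm \<Rightarrow> 'm) \<Rightarrow>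
   real ^ 'n \<Rightarrow> 'm vfield" where
  "induced_field A \<rho> X p =
     (\<lambda>f. if smooth_fun A f then deriv (\<lambda>t. f (\<rho> (torus_exp (t *\<^sub>R X)) p)) 0 else 0)"

definition universal_moment_map ::
  "('m::topological_space, 'e::euclidean_space) atlas \<Rightarrow> (complex ^ 'n \<Rightarrow> 'm \<Rightarrow> 'm) \<Rightarrow>
   'm \<times> 'm covector \<Rightarrow> real ^ 'n" where
  "universal_moment_map A \<rho> = (\<lambda>(p, \<beta>). THE \<mu>. \<forall>X. \<mu> \<bullet> X = \<beta> (induced_field A \<rho> X p))"

definition moment_cone ::
  "('m::topological_space, 'e::euclidean_space) atlas \<Rightarrow> ('m \<times> 'm covector) set \<Rightarrow>
   (complex ^ 'n \<Rightarrow> 'm \<Rightarrow> 'm) \<Rightarrow> (real ^ 'n) set" where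
  "moment_cone A P \<rho> = universal_moment_map A \<rho> ` P \<union> {0}"

definition invariant_form ::
  "('m::topological_space, 'e::euclidean_space) atlas \<Rightarrow> (complex ^ 'n \<Rightarrow> 'm \<Rightarrow> 'm) \<Rightarrow> 'm form \<Rightarrow> bool" where
  "invariant_form A \<rho> \<alpha> \<longleftrightarrow> (\<forall>z\<in>torus. \<forall>p. \<forall>v\<in>tangent_space A p.
     \<alpha> (\<rho> z p) (pushforward A (\<rho> z) v) = \<alpha> p v)"

definition invariant_endomorphism ::
  "('m::topological_space, 'e::euclidean_space) atlas \<Rightarrow> (complex ^ 'n \<Rightarrow> 'm \<Rightarrow> 'm) \<Rightarrow>
   ('m \<Rightarrow> 'm tangent \<Rightarrow> 'm tangent) \<Rightarrow> bool" where
  "invariant_endomorphism A \<rho> \<Phi> \<longleftrightarrow> (\<forall>z\<in>torus. \<forall>p. \<forall>v\<in>tangent_space A p.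
     \<Phi> (\<rho> z p) (pushforward A (\<rho> z) v) = pushforward A (\<rho> z) (\<Phi> p v))"

definition invariant_metric ::
  "('m::topological_space, 'e::euclidean_space) atlas \<Rightarrow> (complex ^ 'n \<Rightarrow> 'm \<Rightarrow> 'm) \<Rightarrow>
   ('m \<Rightarrow> 'm tangent \<Rightarrow> 'm tangent \<Rightarrow> real) \<Rightarrow> bool" where
  "invariant_metric A \<rho> g \<longleftrightarrow> (\<forall>z\<in>torus. \<forall>p. \<forall>v\<in>tangent_space A p. \<forall>w\<in>tangent_space A p.
     g (\<rho> z p) (pushforward A (\<rho> z) v) (pushforward A (\<rho> z) w) = g p v w)"

definition toric_K_contact ::
  "('m::{t2_space,second_countable_topology}, 'e::euclidean_space) atlas \<Rightarrow> ('m \<Rightarrow> 'm tangent set) \<Rightarrow>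
   ('m \<times> 'm covector) set \<Rightarrow> (complex ^ 'n \<Rightarrow> 'm \<Rightarrow> 'm) \<Rightarrow> 'm form \<Rightarrow>
   ('m \<Rightarrow> 'm tangent \<Rightarrow> 'm tangent) \<Rightarrow> ('m \<Rightarrow> 'm tangent \<Rightarrow> 'm tangent \<Rightarrow> real) \<Rightarrow> bool" where
  "toric_K_contact A \<xi> P \<rho> \<alpha> \<Phi> g \<longleftrightarrow> contact_toric A \<xi> P \<rho> \<and> contact_form_for A \<xi> \<alpha> \<and>
     K_contact_structure A \<alpha> \<Phi> g \<and>
     invariant_form A \<rho> \<alpha> \<and> invariant_endomorphism A \<rho> \<Phi> \<and> invariant_metric A \<rho> g"


section \<open>Good cones\<close>

definition polyhedral_cone :: "(real ^ 'n) set \<Rightarrow> (real ^ 'n) set" where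
  "polyhedral_cone H = {x. \<forall>\<eta>\<in>H. x \<bullet> \<eta> \<ge> 0}"

definition primitive :: "real ^ 'n \<Rightarrow> bool" where
  "primitive \<eta> \<longleftrightarrow> \<eta> \<in> integral_lattice torus \<and>
     (\<forall>k::int. \<forall>\<zeta>\<in>integral_lattice torus. \<eta> = of_int k *\<^sub>R \<zeta> \<longrightarrow> \<bar>k\<bar> = 1)"

definition lattice_basis :: "(real ^ 'n) set \<Rightarrow> (real ^ 'n) set \<Rightarrow> bool" where
  "lattice_basis B L \<longleftrightarrow> finite B \<and> independent B \<and>
     L = {(\<Sum>b\<in>B. of_int (m b) *\<^sub>R b) | m :: real ^ 'n \<Rightarrow> int. True}"

text \<open>\<open>H\<close> is the set of inward conormals of the facets of \<open>C\<close>; it is empty for \<open>C = UNIV\<close>. A vertex is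
  simple if exactly \<open>n\<close> facets meet there.\<close>

definition good_cone :: "(real ^ 'n) set \<Rightarrow> (real ^ 'n) set \<Rightarrow> bool" where
  "good_cone H C \<longleftrightarrow> finite H \<and> C = polyhedral_cone H \<and>
     (\<forall>\<eta>\<in>H. {x \<in> C. x \<bullet> \<eta> = 0} facet_of C) \<and>
     (\<forall>v. v extreme_point_of (C - {0}) \<longrightarrow> card {\<eta> \<in> H. v \<bullet> \<eta> = 0} = CARD('n)) \<and>
     (\<forall>\<eta>\<in>H. primitive \<eta>) \<and>
     (\<forall>I\<subseteq>H. {x \<in> C - {0}. \<forall>\<eta>\<in>I. x \<bullet> \<eta> = 0} \<noteq> {} \<longrightarrow>
        (\<exists>S. subtorus S \<and> lattice_basis I (integral_lattice S)))"

definition weakly_convex_good_cone :: "(real ^ 'n) set \<Rightarrow> bool" where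
  "weakly_convex_good_cone C \<longleftrightarrow> (\<exists>H. good_cone H C \<and> span H \<noteq> UNIV)"

end

theory Submission
  imports Defs
begin

text \<open>On a toric K-contact manifold the Reeb field \<open>R\<close> and the fields induced by the torus are commuting
  Killing fields, parametrised linearly by \<open>\<real>\<^sup>n \<times> \<real>\<close>. Let \<open>p\<close> be a point where they span a space of
  maximal dimension. If a combination \<open>Z\<close> of them vanishes at \<open>p\<close>, its linearisation there kills the
  span because the fields commute, takes values in the span because the rank is maximal, and is
  skew-symmetric because \<open>Z\<close> is Killing; hence it is zero, and a Killing field with vanishing 1-jet at a
  point of a connected manifold is zero. The span is isotropic for \<open>d\<alpha>\<close>, so \<open>n + 1\<close> such fields
  are linearly dependent at \<open>p\<close> in dimension \<open>2 n - 1\<close>, hence everywhere, and \<open>R\<close> is induced by some \<open>\<eta>\<close>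
  in the Lie algebra. Then \<open>\<eta>\<close> has a strict sign on the image of the moment map, whereas a weakly
  convex cone contains a line.\<close>

section \<open>Calculus of smooth maps\<close>

text \<open>The coefficients of a linear relation between n + 1 fields may vary from point to point,
  and the Reeb orbits need not close up, so nothing pointwise puts R into the Lie algebra of T.
  Taking the closure of the Reeb flow in the isometry group is avoided: the argument uses only
  1-jets at one point and needs no flow of R. The count at that point: an isotropic subspace of ker
  \<alpha> is orthogonal to its image under \<Phi>, so it has dimension at most n - 1, and cutting
  the span with ker \<alpha> loses at most one dimension. The n + 1 fields thus span at most n
  dimensions. R occurs in the resulting relation with nonzero coefficient because the action is
  faithful. At the end, the value of the moment map at a positive covector c
  \<open>\<alpha>\<^sub>0\<close> pairs with \<eta> to c \<open>\<alpha>\<^sub>0\<close>(R), where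
  \<open>\<alpha>\<^sub>0\<close> belongs to the chosen coorientation. The form \<alpha> may have
  the opposite sign, so only the constancy of the sign of \<open>\<alpha>\<^sub>0\<close>(R) is
  used. The line in the cone is spanned by a vector orthogonal to all conormals.\<close>

abbreviation fderiv :: "('a::real_normed_vector \<Rightarrow> 'b::real_normed_vector) \<Rightarrow> 'a \<Rightarrow> 'a \<Rightarrow> 'b" where
  "fderiv f x \<equiv> frechet_derivative f (at x)"

lemma frechet_derivativeI:
  "(f has_derivative f') (at x) \<Longrightarrow> fderiv f x = f'"
  by (metis frechet_derivative_at)

lemma frechet_derivative_cong_open:
  assumes "open S" "x \<in> S" "\<And>y. y \<in> S \<Longrightarrow> f y = g y"
  shows "fderiv f x = fderiv g x"
proof -
  have "(f has_derivative D) (at x) \<longleftrightarrow> (g has_derivative D) (at x)" for D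
    using assms has_derivative_transform_within_open[of f D x UNIV S g]
      has_derivative_transform_within_open[of g D x UNIV S f] by auto
  then show ?thesis by (simp add: frechet_derivative_def)
qed

lemma differentiable_cong_open:
  assumes "open S" "x \<in> S" "\<And>y. y \<in> S \<Longrightarrow> f y = g y" "f differentiable (at x)"
  shows "g differentiable (at x)"
  using assms has_derivative_transform_within_open[of f _ x UNIV S g]
  unfolding differentiable_def by blast

lemma Ck_on_cong:
  assumes "open S" "\<And>x. x \<in> S \<Longrightarrow> f x = g x" "Ck_on k S f"
  shows "Ck_on k S g"
  using assms(2,3)
proof (induction k arbitrary: f g)
  case 0
  then show ?case by (simp cong: continuous_on_cong)
next
  case (Suc k)
  have "g differentiable (at x)" if "x \<in> S" for x
    by (rule differentiable_cong_open[OF assms(1) that Suc.prems(1)]) (use Suc.prems(2) that in auto)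
  moreover have "Ck_on k S (\<lambda>x. fderiv g x v)" for v
  proof (rule Suc.IH)
    show "Ck_on k S (\<lambda>x. fderiv f x v)" using Suc.prems by simp
    show "fderiv f x v = fderiv g x v" if "x \<in> S" for x
      by (simp add: frechet_derivative_cong_open[OF assms(1) that Suc.prems(1)])
  qed
  ultimately show ?case by simp
qed

lemma Ck_on_SucI:
  assumes "open S" "\<And>x. x \<in> S \<Longrightarrow> (f has_derivative f' x) (at x)"
    and "\<And>v. Ck_on k S (\<lambda>x. f' x v)"
  shows "Ck_on (Suc k) S f"
proof -
  have "Ck_on k S (\<lambda>x. fderiv f x v)" for v
    by (rule Ck_on_cong[OF assms(1) _ assms(3)[of v]])
       (simp add: frechet_derivativeI[OF assms(2)])
  with assms(2) show ?thesis by (auto simp: differentiable_def)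
qed

lemma Ck_on_subset: "Ck_on k S f \<Longrightarrow> T \<subseteq> S \<Longrightarrow> Ck_on k T f"
  by (induction k arbitrary: f) (auto intro: continuous_on_subset)

lemma Ck_on_SucD: "Ck_on (Suc k) S f \<Longrightarrow> Ck_on k S f"
proof (induction k arbitrary: f)
  case 0
  then show ?case
    by (auto intro!: continuous_at_imp_continuous_on differentiable_imp_continuous_within)
next
  case (Suc k)
  then have "f differentiable (at x)" if "x \<in> S" for x
    using that by simp
  moreover have "Ck_on k S (\<lambda>x. fderiv f x v)" for v
    by (rule Suc.IH) (use Suc.prems in simp)
  ultimately show ?case by simp
qed

text \<open>Derivatives in \<open>Ck_on\<close> are taken at the point in the whole space, never
  within \<open>S\<close>; local data on open sets therefore suffice for an arbitrary
  \<open>S\<close>.\<close>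

lemma Ck_on_local:
  assumes "\<And>x. x \<in> S \<Longrightarrow> \<exists>T. open T \<and> x \<in> T \<and> Ck_on k T f"
  shows "Ck_on k S f"
  using assms
proof (induction k arbitrary: f)
  case 0
  show ?case
    unfolding Ck_on.simps
  proof (intro continuous_at_imp_continuous_on ballI)
    fix x assume "x \<in> S"
    then obtain T where "open T" "x \<in> T" "continuous_on T f" using 0[of x] by auto
    then show "isCont f x" by (simp add: continuous_on_eq_continuous_at)
  qed
next
  case (Suc k)
  have "Ck_on k S (\<lambda>x. fderiv f x v)" for v
    by (rule Suc.IH) (use Suc.prems in fastforce)
  then show ?case using Suc.prems by fastforce
qed

lemma Ck_on_const [simp]: "Ck_on k S (\<lambda>x. c)"
  by (induction k arbitrary: c) auto

lemma Ck_on_bounded_linear: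
  assumes "bounded_linear L" shows "Ck_on k S L"
proof (cases k)
  case 0
  then show ?thesis using assms by (simp add: linear_continuous_on)
next
  case (Suc j)
  have "fderiv L x = L" for x
    by (rule frechet_derivativeI) (rule bounded_linear_imp_has_derivative[OF assms])
  then show ?thesis using Suc assms by (simp add: bounded_linear_imp_differentiable)
qed

lemma Ck_on_linear_compose:
  assumes "open S" "bounded_linear L" "Ck_on k S f"
  shows "Ck_on k S (\<lambda>x. L (f x))"
  using assms(3)
proof (induction k arbitrary: f)
  case 0
  then show ?case
    by (simp add: bounded_linear.continuous_on[OF assms(2)])
next
  case (Suc k)
  show ?case
  proof (rule Ck_on_SucI[OF assms(1), where f'="\<lambda>x v. L (fderiv f x v)"])
    show "((\<lambda>x. L (f x)) has_derivative (\<lambda>v. L (fderiv f x v))) (at x)" if "x \<in> S" for x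
      using Suc.prems that by (intro bounded_linear.has_derivative[OF assms(2)]) (simp flip: frechet_derivative_works)
    show "Ck_on k S (\<lambda>x. L (fderiv f x v))" for v
      using Suc by simp
  qed
qed

lemma Ck_on_add:
  assumes "open S" "Ck_on k S f" "Ck_on k S g"
  shows "Ck_on k S (\<lambda>x. f x + g x)"
  using assms(2,3)
proof (induction k arbitrary: f g)
  case 0
  then show ?case by (simp add: continuous_on_add)
next
  case (Suc k)
  show ?case
    by (rule Ck_on_SucI[OF assms(1), where f'="\<lambda>x v. fderiv f x v + fderiv g x v"])
       (use Suc in \<open>auto intro!: has_derivative_add simp flip: frechet_derivative_works\<close>)
qed

lemma Ck_on_sum:
  assumes "open S" "\<And>i. i \<in> I \<Longrightarrow> Ck_on k S (f i)"
  shows "Ck_on k S (\<lambda>x. \<Sum>i\<in>I. f i x)"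
  using assms(2) by (induction I rule: infinite_finite_induct) (auto intro!: Ck_on_add assms(1))

lemma Ck_on_bilinear:
  assumes "open S" "bounded_bilinear B" "Ck_on k S f" "Ck_on k S g"
  shows "Ck_on k S (\<lambda>x. B (f x) (g x))"
  using assms(3,4)
proof (induction k arbitrary: f g)
  case 0
  then show ?case by (simp add: bounded_bilinear.continuous_on[OF assms(2)])
next
  case (Suc k)
  show ?case
  proof (rule Ck_on_SucI[OF assms(1), where f'="\<lambda>x v. B (f x) (fderiv g x v) + B (fderiv f x v) (g x)"])
    show "((\<lambda>x. B (f x) (g x)) has_derivative (\<lambda>v. B (f x) (fderiv g x v) + B (fderiv f x v) (g x))) (at x)" if "x \<in> S" for x
      using Suc.prems that by (intro bounded_bilinear.FDERIV[OF assms(2)]) (simp_all flip: frechet_derivative_works)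
    show "Ck_on k S (\<lambda>x. B (f x) (fderiv g x v) + B (fderiv f x v) (g x))" for v
      by (intro Ck_on_add[OF assms(1)] Suc.IH Ck_on_SucD[of k S f] Ck_on_SucD[of k S g])
         (use Suc.prems in auto)
  qed
qed

lemma frechet_derivative_basis_expansion:
  fixes g :: "'b::euclidean_space \<Rightarrow> 'c::real_normed_vector"
  assumes "g differentiable (at y)"
  shows "fderiv g y v = (\<Sum>b\<in>Basis. (v \<bullet> b) *\<^sub>R fderiv g y b)"
proof -
  have l: "linear (fderiv g y)"
    using assms by (rule linear_frechet_derivative)
  have "fderiv g y v = fderiv g y (\<Sum>b\<in>Basis. (v \<bullet> b) *\<^sub>R b)"
    by (simp add: euclidean_representation)
  also have "\<dots> = (\<Sum>b\<in>Basis. (v \<bullet> b) *\<^sub>R fderiv g y b)"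
    using l by (simp add: linear_sum linear_cmul)
  finally show ?thesis .
qed

text \<open>\<open>Ck_on (Suc k)\<close> controls derivatives in fixed directions only, while the
  chain rule applies Dg to the moving direction Df v. Expanding Df v in the basis of the
  intermediate space leaves finitely many products of C^k functions, which is why that space is
  Euclidean.\<close>

lemma Ck_on_compose:
  fixes f :: "'a::real_normed_vector \<Rightarrow> 'b::euclidean_space"
    and g :: "'b \<Rightarrow> 'c::real_normed_vector"
  assumes "open S" "Ck_on k S f" "Ck_on k T g" "f ` S \<subseteq> T"
  shows "Ck_on k S (\<lambda>x. g (f x))"
  using assms(2,3)
proof (induction k arbitrary: g)
  case 0
  then show ?case using assms(4) by (auto intro: continuous_on_compose2)
next
  case (Suc k)
  have df: "f differentiable (at x)" if "x \<in> S" for x using Suc.prems that by simp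
  have dg: "g differentiable (at (f x))" if "x \<in> S" for x
    using Suc.prems that assms(4) by auto
  let ?D = "\<lambda>x v. \<Sum>b\<in>Basis. (fderiv f x v \<bullet> b) *\<^sub>R fderiv g (f x) b"
  show ?case
  proof (rule Ck_on_SucI[OF assms(1), where f'="?D"])
    fix x assume x: "x \<in> S"
    have "((\<lambda>x. g (f x)) has_derivative (\<lambda>v. fderiv g (f x) (fderiv f x v))) (at x)"
      using df[OF x] dg[OF x] by (intro has_derivative_compose[where f=f and g=g]) (simp_all flip: frechet_derivative_works)
    then show "((\<lambda>x. g (f x)) has_derivative ?D x) (at x)"
      by (rule has_derivative_eq_rhs) (rule ext, rule frechet_derivative_basis_expansion[OF dg[OF x]])
  next
    fix v
    have "Ck_on k S (\<lambda>x. fderiv g (f x) b)" for b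
      using Suc.IH[of "\<lambda>y. fderiv g y b"] Suc.prems Ck_on_SucD by auto
    then show "Ck_on k S (\<lambda>x. ?D x v)"
      using Suc.prems
      by (auto intro!: Ck_on_sum assms(1) Ck_on_bilinear[OF _ bounded_bilinear_scaleR]
          Ck_on_linear_compose[OF assms(1) bounded_linear_inner_left])
  qed
qed

lemma smooth_onD: "smooth_on S f \<Longrightarrow> Ck_on k S f" by (simp add: smooth_on_def)

lemma smooth_on_differentiable: "smooth_on S f \<Longrightarrow> x \<in> S \<Longrightarrow> f differentiable (at x)"
  using smooth_onD[of S f "Suc 0"] by simp

lemma smooth_on_has_derivative:
  "smooth_on S f \<Longrightarrow> x \<in> S \<Longrightarrow> (f has_derivative fderiv f x) (at x)"
  using smooth_on_differentiable frechet_derivative_works by blast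

lemma smooth_on_frechet: "smooth_on S f \<Longrightarrow> smooth_on S (\<lambda>x. fderiv f x v)"
  unfolding smooth_on_def
proof
  fix k assume "\<forall>k. Ck_on k S f"
  then have "Ck_on (Suc k) S f" ..
  then show "Ck_on k S (\<lambda>x. fderiv f x v)" by simp
qed

lemma smooth_on_continuous: "smooth_on S f \<Longrightarrow> continuous_on S f"
  using smooth_onD[of S f 0] by simp

lemma smooth_on_cong:
  "open S \<Longrightarrow> (\<And>x. x \<in> S \<Longrightarrow> f x = g x) \<Longrightarrow> smooth_on S f \<Longrightarrow> smooth_on S g"
  by (simp add: smooth_on_def Ck_on_cong[of S f g])

lemma smooth_on_subset: "smooth_on S f \<Longrightarrow> T \<subseteq> S \<Longrightarrow> smooth_on T f"
  by (simp add: smooth_on_def Ck_on_subset[of _ S f T])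

lemma smooth_on_local:
  "(\<And>x. x \<in> S \<Longrightarrow> \<exists>T. open T \<and> x \<in> T \<and> smooth_on T f) \<Longrightarrow> smooth_on S f"
  unfolding smooth_on_def by (rule allI, rule Ck_on_local) blast

lemma smooth_on_const [simp]: "smooth_on S (\<lambda>x. c)"
  by (simp add: smooth_on_def)

lemma smooth_on_bounded_linear: "bounded_linear L \<Longrightarrow> smooth_on S L"
  by (simp add: smooth_on_def Ck_on_bounded_linear)

lemma smooth_on_linear_compose:
  "open S \<Longrightarrow> bounded_linear L \<Longrightarrow> smooth_on S f \<Longrightarrow> smooth_on S (\<lambda>x. L (f x))"
  unfolding smooth_on_def by (rule allI, rule Ck_on_linear_compose) auto

lemma smooth_on_add:
  "open S \<Longrightarrow> smooth_on S f \<Longrightarrow> smooth_on S g \<Longrightarrow> smooth_on S (\<lambda>x. f x + g x)"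
  unfolding smooth_on_def by (rule allI, rule Ck_on_add) auto

lemma smooth_on_sum:
  "open S \<Longrightarrow> (\<And>i. i \<in> I \<Longrightarrow> smooth_on S (f i)) \<Longrightarrow> smooth_on S (\<lambda>x. \<Sum>i\<in>I. f i x)"
  unfolding smooth_on_def by (rule allI, rule Ck_on_sum) auto

lemma smooth_on_mult:
  fixes f g :: "'a::real_normed_vector \<Rightarrow> real"
  shows "open S \<Longrightarrow> smooth_on S f \<Longrightarrow> smooth_on S g \<Longrightarrow> smooth_on S (\<lambda>x. f x * g x)"
  unfolding smooth_on_def by (rule allI, rule Ck_on_bilinear[OF _ bounded_bilinear_mult]) auto

lemma smooth_on_scaleR:
  "open S \<Longrightarrow> smooth_on S f \<Longrightarrow> smooth_on S g \<Longrightarrow> smooth_on S (\<lambda>x. f x *\<^sub>R g x)"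
  unfolding smooth_on_def by (rule allI, rule Ck_on_bilinear[OF _ bounded_bilinear_scaleR]) auto

lemma smooth_on_inner:
  "open S \<Longrightarrow> smooth_on S f \<Longrightarrow> smooth_on S g \<Longrightarrow> smooth_on S (\<lambda>x. f x \<bullet> g x)"
  unfolding smooth_on_def by (rule allI, rule Ck_on_bilinear[OF _ bounded_bilinear_inner]) auto

lemma smooth_on_id [simp]: "smooth_on S (\<lambda>x. x)"
  by (rule smooth_on_bounded_linear) (rule bounded_linear_ident)

lemma smooth_on_compose:
  fixes f :: "'a::real_normed_vector \<Rightarrow> 'b::euclidean_space"
  assumes "open S" "smooth_on S f" "smooth_on T g" "f ` S \<subseteq> T"
  shows "smooth_on S (\<lambda>x. g (f x))"
  unfolding smooth_on_def
  by (rule allI, rule Ck_on_compose[OF assms(1) _ _ assms(4)]) (simp_all add: assms smooth_onD)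

text \<open>The family is closed under differentiation: \<open>h\<^sub>k' = h\<^bsub>k+2\<^esub> - k h\<^bsub>k+1\<^esub>\<close>.\<close>

definition flat_fun :: "nat \<Rightarrow> real \<Rightarrow> real" where
  "flat_fun k x = (if x \<le> 0 then 0 else inverse x ^ k * exp (- inverse x))"

lemma inverse_power_has_derivative:
  fixes x :: real
  assumes "x \<noteq> 0"
  shows "((\<lambda>x. inverse x ^ k) has_real_derivative (- real k * inverse x ^ (k + 1))) (at x)"
  using DERIV_power[OF DERIV_inverse[OF assms], of k]
  by (cases k) (simp_all add: algebra_simps)

lemma flat_fun_has_derivative:
  "(flat_fun k has_real_derivative (flat_fun (k + 2) x - real k * flat_fun (k + 1) x)) (at x)"
proof -
  consider "x < 0" | "x > 0" | "x = 0" by linarith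
  then show ?thesis
  proof cases
    case 1
    have "((\<lambda>x. 0) has_real_derivative 0) (at x)" by simp
    then have "(flat_fun k has_real_derivative 0) (at x)"
      by (rule has_field_derivative_transform_within_open[where S="{..<0}"]) (use 1 in \<open>auto simp: flat_fun_def\<close>)
    then show ?thesis using 1 by (simp add: flat_fun_def)
  next
    case 2
    have "((\<lambda>x. inverse x ^ k * exp (- inverse x)) has_real_derivative
        (inverse x ^ (k+2) * exp (- inverse x) - real k * (inverse x ^ (k+1) * exp (- inverse x)))) (at x)"
    proof -
      have "((\<lambda>x. exp (- inverse x)) has_real_derivative exp (- inverse x) * (inverse x ^ 2)) (at x)"
        using DERIV_fun_exp[OF DERIV_minus[OF DERIV_inverse[of x]]] 2 by (simp add: power2_eq_square)
      from DERIV_mult[OF inverse_power_has_derivative[of x k] this] show ?thesis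
        using 2 by (simp add: algebra_simps power2_eq_square)
    qed
    then have "(flat_fun k has_real_derivative
        (inverse x ^ (k+2) * exp (- inverse x) - real k * (inverse x ^ (k+1) * exp (- inverse x)))) (at x)"
      by (rule has_field_derivative_transform_within_open[where S="{0<..}"]) (use 2 in \<open>auto simp: flat_fun_def\<close>)
    then show ?thesis using 2 by (simp add: flat_fun_def)
  next
    case 3
    \<comment> \<open>For y > 0 the difference quotient at 0 is y^-(k+1) exp(-1/y); replacing y by
      its inverse turns it into a power divided by an exponential at infinity.\<close>
    have r: "((\<lambda>y. inverse y ^ Suc k * exp (- inverse y)) \<longlongrightarrow> 0) (at_right (0::real))"
    proof -
      have "((\<lambda>y. y ^ Suc k / exp y) \<longlongrightarrow> 0) (at_top :: real filter)"
        by (rule tendsto_power_div_exp_0)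
      then have "((\<lambda>y. inverse y ^ Suc k / exp (inverse y)) \<longlongrightarrow> 0) (at_right (0::real))"
        by (rule filterlim_compose) (rule filterlim_inverse_at_top_right)
      then show ?thesis by (simp add: exp_minus field_simps)
    qed
    have "((\<lambda>y. (flat_fun k y - flat_fun k 0) / (y - 0)) \<longlongrightarrow> 0) (at 0)"
    proof (subst filterlim_at_split, intro conjI)
      show "((\<lambda>y. (flat_fun k y - flat_fun k 0) / (y - 0)) \<longlongrightarrow> 0) (at_left 0)"
        by (rule Lim_transform_eventually[OF tendsto_const])
           (auto simp: eventually_at_left_field flat_fun_def intro!: exI[of _ "-1"])
      show "((\<lambda>y. (flat_fun k y - flat_fun k 0) / (y - 0)) \<longlongrightarrow> 0) (at_right 0)"
        by (rule Lim_transform_eventually[OF r])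
           (auto simp: eventually_at_right_field flat_fun_def field_simps intro!: exI[of _ "1"])
    qed
    then have "(flat_fun k has_real_derivative 0) (at 0)"
      by (simp add: has_field_derivative_iff)
    then show ?thesis using 3 by (simp add: flat_fun_def)
  qed
qed

lemma smooth_on_flat_fun: "smooth_on UNIV (flat_fun k)"
proof -
  have "Ck_on m UNIV (flat_fun k)" for m
  proof (induction m arbitrary: k)
    case 0
    show ?case
      using flat_fun_has_derivative[of k] by (auto intro!: continuous_at_imp_continuous_on DERIV_isCont)
  next
    case (Suc m)
    show ?case
    proof (rule Ck_on_SucI[where f'="\<lambda>x v. (flat_fun (k + 2) x + (- real k) * flat_fun (k + 1) x) * v"])
      show "(flat_fun k has_derivative (\<lambda>v. (flat_fun (k + 2) x + (- real k) * flat_fun (k + 1) x) * v)) (at x)" for x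
        using flat_fun_has_derivative[of k x] by (simp add: has_field_derivative_def)
      show "Ck_on m UNIV (\<lambda>x. (flat_fun (k + 2) x + (- real k) * flat_fun (k + 1) x) * v)" for v
        by (intro Ck_on_bilinear[OF _ bounded_bilinear_mult] Ck_on_add Suc) auto
    qed auto
  qed
  then show ?thesis by (simp add: smooth_on_def)
qed

text \<open>The induction treats all powers at once: the derivative of x^-k is -k x^-(k+1), so the
  family is closed under differentiation up to constants.\<close>

lemma smooth_on_inverse: "smooth_on {0<..} (inverse :: real \<Rightarrow> real)"
proof -
  have "Ck_on m {0<..} (\<lambda>x. inverse x ^ k :: real)" for m k
  proof (induction m arbitrary: k)
    case 0
    show ?case by (auto intro!: continuous_intros)
  next
    case (Suc m)
    show ?case
    proof (rule Ck_on_SucI[where f'="\<lambda>x v. (- real k * inverse x ^ (k + 1)) * v"])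
      show "((\<lambda>x. inverse x ^ k) has_derivative (\<lambda>v. (- real k * inverse x ^ (k + 1)) * v)) (at x)"
        if "x \<in> {0<..}" for x :: real
      proof -
        show ?thesis
          by (rule inverse_power_has_derivative[unfolded has_field_derivative_def]) (use that in simp)
      qed
      show "Ck_on m {0<..} (\<lambda>x. (- real k * inverse x ^ (k + 1)) * v)" for v :: real
        by (intro Ck_on_bilinear[OF _ bounded_bilinear_mult] Suc) auto
    qed auto
  qed
  from this[of _ 1] show ?thesis by (simp add: smooth_on_def)
qed

section \<open>Smooth steps and cutoff functions\<close>

definition smooth_step :: "real \<Rightarrow> real" where
  "smooth_step t = flat_fun 0 t * inverse (flat_fun 0 t + flat_fun 0 (1 - t))"

lemma smooth_step_0: "t \<le> 0 \<Longrightarrow> smooth_step t = 0"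
  by (simp add: smooth_step_def flat_fun_def)

lemma smooth_step_1: "t \<ge> 1 \<Longrightarrow> smooth_step t = 1"
  by (simp add: smooth_step_def flat_fun_def)

text \<open>t and 1 - t are never both nonpositive, so the denominator is positive everywhere and
  can be inverted smoothly.\<close>

lemma smooth_on_step: "smooth_on UNIV smooth_step"
proof -
  have "smooth_on UNIV (\<lambda>t::real. 1 + (- 1) * t)" by (intro smooth_on_add smooth_on_mult) auto
  then have "smooth_on UNIV (\<lambda>t. flat_fun 0 (1 + (- 1) * t))"
    by (intro smooth_on_compose[OF _ _ smooth_on_flat_fun]) auto
  then have "smooth_on UNIV (\<lambda>t. flat_fun 0 t + flat_fun 0 (1 - t))"
    by (intro smooth_on_add smooth_on_flat_fun) auto
  moreover have "flat_fun 0 t + flat_fun 0 (1 - t) > 0" for t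
    by (auto simp: flat_fun_def add_pos_pos)
  ultimately have "smooth_on UNIV (\<lambda>t. inverse (flat_fun 0 t + flat_fun 0 (1 - t)))"
    by (intro smooth_on_compose[OF _ _ smooth_on_inverse]) auto
  then show ?thesis unfolding smooth_step_def[abs_def]
    by (intro smooth_on_mult smooth_on_flat_fun) auto
qed

text \<open>The squared distance is smooth at the centre, unlike the norm. The argument of
  \<open>smooth_step\<close> is at least 1 for |x - c| \<le> r and at most -2 for |x - c| \<ge> 2
  r.\<close>

definition cutoff :: "'e::euclidean_space \<Rightarrow> real \<Rightarrow> 'e \<Rightarrow> real" where
  "cutoff c r x = smooth_step (2 - ((x - c) \<bullet> (x - c)) / r\<^sup>2)"

lemma cutoff_1:
  assumes "r > 0" "x \<in> cball c r" shows "cutoff c r x = 1"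
proof -
  have "norm (x - c) \<le> r" using assms by (simp add: dist_norm norm_minus_commute)
  then have "(norm (x - c))\<^sup>2 \<le> r\<^sup>2" by (simp add: power_mono)
  then have "((x - c) \<bullet> (x - c)) / r\<^sup>2 \<le> 1" using assms by (simp add: dot_square_norm)
  then show ?thesis by (simp add: cutoff_def smooth_step_1)
qed

lemma cutoff_0:
  assumes "r > 0" "x \<notin> cball c (2 * r)" shows "cutoff c r x = 0"
proof -
  have "norm (x - c) \<ge> 2 * r" using assms by (simp add: dist_norm norm_minus_commute)
  then have "(norm (x - c))\<^sup>2 \<ge> (2 * r)\<^sup>2" using assms by (intro power_mono) auto
  then have "((x - c) \<bullet> (x - c)) / r\<^sup>2 \<ge> 4"
    using assms by (simp add: dot_square_norm field_simps)
  then show ?thesis by (simp add: cutoff_def smooth_step_0)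
qed

lemma smooth_on_cutoff: "smooth_on S (cutoff c r)"
proof -
  have "smooth_on UNIV (\<lambda>x. x + (- c))" by (intro smooth_on_add) auto
  then have "smooth_on UNIV (\<lambda>x. (2::real) + (- inverse (r\<^sup>2)) * ((x + (- c)) \<bullet> (x + (- c))))"
    by (intro smooth_on_add smooth_on_mult smooth_on_inner) auto
  then have "smooth_on UNIV (\<lambda>x. smooth_step ((2::real) + (- inverse (r\<^sup>2)) * ((x + (- c)) \<bullet> (x + (- c)))))"
    by (intro smooth_on_compose[OF _ _ smooth_on_step]) auto
  then have "smooth_on UNIV (cutoff c r)"
    by (simp add: cutoff_def[abs_def] divide_inverse mult.commute)
  then show ?thesis using smooth_on_subset by blast
qed

section \<open>Symmetry of second derivatives\<close>

lemma has_real_derivative_along_line: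
  fixes f :: "'a::real_normed_vector \<Rightarrow> real"
  assumes "f differentiable (at (y + s *\<^sub>R u))"
  shows "((\<lambda>s. f (y + s *\<^sub>R u)) has_real_derivative fderiv f (y + s *\<^sub>R u) u) (at s)"
proof -
  have "((\<lambda>s. f (y + s *\<^sub>R u)) has_derivative (\<lambda>h. fderiv f (y + s *\<^sub>R u) (0 + h *\<^sub>R u))) (at s)"
    by (rule has_derivative_compose[where f="\<lambda>s. y + s *\<^sub>R u" and g=f])
       (auto intro!: derivative_eq_intros simp: assms simp flip: frechet_derivative_works)
  moreover have "fderiv f (y + s *\<^sub>R u) (0 + h *\<^sub>R u) = fderiv f (y + s *\<^sub>R u) u * h" for h
    using linear_frechet_derivative[OF assms] by (simp add: linear_cmul)
  ultimately show ?thesis by (simp add: has_field_derivative_def)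
qed

text \<open>The second difference is an increment along u of an increment along v, so the mean value
  theorem applies once in each direction.\<close>

lemma second_difference_mean_value:
  fixes f :: "'a::real_normed_vector \<Rightarrow> real"
  assumes S: "smooth_on S f" and t: "t > 0"
    and sq: "\<And>a b. 0 \<le> a \<Longrightarrow> a \<le> t \<Longrightarrow> 0 \<le> b \<Longrightarrow> b \<le> t \<Longrightarrow> x + a *\<^sub>R u + b *\<^sub>R v \<in> S"
  obtains a b where "0 < a" "a < t" "0 < b" "b < t"
    "f (x + t *\<^sub>R u + t *\<^sub>R v) - f (x + t *\<^sub>R u) - f (x + t *\<^sub>R v) + f x
      = t * t * fderiv (\<lambda>y. fderiv f y u) (x + a *\<^sub>R u + b *\<^sub>R v) v"
proof -
  let ?g = "\<lambda>y. fderiv f y u"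
  let ?p = "\<lambda>s. f ((x + t *\<^sub>R v) + s *\<^sub>R u) - f (x + s *\<^sub>R u)"
  have "\<exists>a. 0 < a \<and> a < t \<and> ?p t - ?p 0 = (t - 0) * (?g ((x + t *\<^sub>R v) + a *\<^sub>R u) - ?g (x + a *\<^sub>R u))"
  proof (rule MVT2[OF t])
    fix s assume s: "0 \<le> s" "s \<le> t"
    have "(x + t *\<^sub>R v) + s *\<^sub>R u \<in> S" using sq[of s t] s t by (simp add: algebra_simps)
    moreover have "x + s *\<^sub>R u \<in> S" using sq[of s 0] s t by simp
    ultimately show "DERIV ?p s :> ?g ((x + t *\<^sub>R v) + s *\<^sub>R u) - ?g (x + s *\<^sub>R u)"
      by (intro DERIV_diff has_real_derivative_along_line smooth_on_differentiable[OF S])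
  qed
  then obtain a where a: "0 < a" "a < t" "?p t - ?p 0 = t * (?g ((x + t *\<^sub>R v) + a *\<^sub>R u) - ?g (x + a *\<^sub>R u))"
    by auto
  let ?q = "\<lambda>s. ?g ((x + a *\<^sub>R u) + s *\<^sub>R v)"
  have "\<exists>b. 0 < b \<and> b < t \<and> ?q t - ?q 0 = (t - 0) * fderiv ?g ((x + a *\<^sub>R u) + b *\<^sub>R v) v"
  proof (rule MVT2[OF t])
    fix s assume s: "0 \<le> s" "s \<le> t"
    have "(x + a *\<^sub>R u) + s *\<^sub>R v \<in> S" using sq[of a s] s a by simp
    then show "DERIV ?q s :> fderiv ?g ((x + a *\<^sub>R u) + s *\<^sub>R v) v"
      by (intro has_real_derivative_along_line smooth_on_differentiable[OF smooth_on_frechet[OF S]])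
  qed
  then obtain b where b: "0 < b" "b < t" "?q t - ?q 0 = t * fderiv ?g ((x + a *\<^sub>R u) + b *\<^sub>R v) v"
    by auto
  have "f (x + t *\<^sub>R u + t *\<^sub>R v) - f (x + t *\<^sub>R u) - f (x + t *\<^sub>R v) + f x = ?p t - ?p 0"
    by (simp add: algebra_simps)
  also have "\<dots> = t * (?q t - ?q 0)" using a(3) by (simp add: algebra_simps)
  also have "\<dots> = t * t * fderiv ?g (x + a *\<^sub>R u + b *\<^sub>R v) v" using b(3) by simp
  finally show ?thesis using that[OF a(1,2) b(1,2)] by simp
qed

text \<open>The second difference does not change when u and v are exchanged. It therefore equals
  t^2 times either mixed derivative, each taken at some point close to x, and continuity carries the
  equality to x.\<close>

lemma second_derivative_symmetric:
  fixes f :: "'a::real_normed_vector \<Rightarrow> real"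
  assumes S: "smooth_on S f" "open S" "x \<in> S"
  shows "fderiv (\<lambda>y. fderiv f y u) x v
       = fderiv (\<lambda>y. fderiv f y v) x u" (is "?h u v x = ?h v u x")
proof (rule ccontr)
  assume ne: "\<not> ?thesis"
  define e where "e = \<bar>?h u v x - ?h v u x\<bar> / 2"
  have e: "e > 0" using ne by (simp add: e_def)
  have cont: "continuous_on S (?h u v)" for u v
    by (rule smooth_on_continuous[OF smooth_on_frechet[OF smooth_on_frechet[OF S(1)]]])
  have near_cont: "\<exists>d>0. \<forall>y\<in>S. dist y x < d \<longrightarrow> dist (?h u v y) (?h u v x) < e" for u v
    using cont[of u v] S(3) e unfolding continuous_on_iff by simp
  obtain d1 where d1: "d1 > 0" "\<And>y. y \<in> S \<Longrightarrow> dist y x < d1 \<Longrightarrow> dist (?h u v y) (?h u v x) < e"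
    using near_cont[of u v] by auto
  obtain d2 where d2: "d2 > 0" "\<And>y. y \<in> S \<Longrightarrow> dist y x < d2 \<Longrightarrow> dist (?h v u y) (?h v u x) < e"
    using near_cont[of v u] by auto
  obtain d3 where d3: "d3 > 0" "ball x d3 \<subseteq> S" using S(2,3) openE by blast
  define d where "d = min d1 (min d2 d3)"
  have d: "d > 0" using d1 d2 d3 by (simp add: d_def)
  \<comment> \<open>Points of the parallelogram have distance at most t (|u| + |v|) < t N = d / 2
    from x; the summand 1 keeps N positive when u and v are 0.\<close>
  define N where "N = norm u + norm v + 1"
  have n0: "N > 0" by (simp add: N_def add_nonneg_pos)
  define t where "t = d / (2 * N)"
  have t: "t > 0" using d n0 by (simp add: t_def)
  have near: "dist (x + a *\<^sub>R u + b *\<^sub>R v) x < d" if "0 \<le> a" "a \<le> t" "0 \<le> b" "b \<le> t" for a b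
  proof -
    have "norm (a *\<^sub>R u + b *\<^sub>R v) \<le> a * norm u + b * norm v"
      using that norm_triangle_ineq[of "a *\<^sub>R u" "b *\<^sub>R v"] by simp
    also have "\<dots> \<le> t * norm u + t * norm v" using that by (intro add_mono mult_right_mono) auto
    also have "\<dots> < t * N" using t by (simp add: algebra_simps N_def)
    also have "\<dots> = d / 2" using n0 by (simp add: t_def)
    finally show ?thesis using d by (simp add: dist_norm add.assoc)
  qed
  have near': "dist (x + b *\<^sub>R v + a *\<^sub>R u) x < d" if "0 \<le> a" "a \<le> t" "0 \<le> b" "b \<le> t" for a b
    using near[OF that] by (simp add: add.assoc add.commute[of "b *\<^sub>R v"])
  have inS: "y \<in> S" if "dist y x < d" for y
    using d3(2) that by (auto simp: d_def dist_commute subset_iff)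
  obtain a b where 1: "0 < a" "a < t" "0 < b" "b < t"
    "f (x + t *\<^sub>R u + t *\<^sub>R v) - f (x + t *\<^sub>R u) - f (x + t *\<^sub>R v) + f x = t * t * ?h u v (x + a *\<^sub>R u + b *\<^sub>R v)"
    by (rule second_difference_mean_value[OF S(1) t, of x u v]) (rule inS, rule near, assumption+)
  obtain a' b' where 2: "0 < a'" "a' < t" "0 < b'" "b' < t"
    "f (x + t *\<^sub>R v + t *\<^sub>R u) - f (x + t *\<^sub>R v) - f (x + t *\<^sub>R u) + f x = t * t * ?h v u (x + a' *\<^sub>R v + b' *\<^sub>R u)"
    by (rule second_difference_mean_value[OF S(1) t, of x v u]) (rule inS, rule near', assumption+)
  have "t * t * ?h u v (x + a *\<^sub>R u + b *\<^sub>R v) = t * t * ?h v u (x + a' *\<^sub>R v + b' *\<^sub>R u)"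
    unfolding 1(5)[symmetric] 2(5)[symmetric] by (simp add: algebra_simps)
  then have eq: "?h u v (x + a *\<^sub>R u + b *\<^sub>R v) = ?h v u (x + a' *\<^sub>R v + b' *\<^sub>R u)" using t by simp
  have *: "dist (x + a *\<^sub>R u + b *\<^sub>R v) x < d" "dist (x + a' *\<^sub>R v + b' *\<^sub>R u) x < d"
    using 1(1-4) 2(1-4) near[of a b] near'[of b' a'] by auto
  have "dist (?h u v (x + a *\<^sub>R u + b *\<^sub>R v)) (?h u v x) < e"
    by (rule d1(2)[OF inS]) (use * in \<open>auto simp: d_def\<close>)
  moreover have "dist (?h v u (x + a' *\<^sub>R v + b' *\<^sub>R u)) (?h v u x) < e"
    by (rule d2(2)[OF inS]) (use * in \<open>auto simp: d_def\<close>)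
  ultimately have "\<bar>?h u v x - ?h v u x\<bar> < 2 * e"
    using eq unfolding dist_real_def by linarith
  then show False by (simp add: e_def)
qed

section \<open>Differentiation under the integral sign and Hadamard's lemma\<close>

lemma has_derivative_parametric_integral:
  fixes F :: "'e::euclidean_space \<Rightarrow> real"
  assumes F: "smooth_on (ball c r) F" and x: "x \<in> ball c r"
  shows "((\<lambda>x. integral {0..1} (\<lambda>t. t ^ m * F (c + t *\<^sub>R (x - c)))) has_derivative
    (\<lambda>v. integral {0..1} (\<lambda>t. t ^ Suc m * fderiv F (c + t *\<^sub>R (x - c)) v))) (at x)"
proof -
  let ?U = "ball c r"
  let ?p = "\<lambda>x t. c + t *\<^sub>R (x - c)"
  have inU: "?p x t \<in> ?U" if "x \<in> ?U" "t \<in> cbox (0::real) 1" for x t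
  proof -
    have "t * norm (x - c) \<le> 1 * norm (x - c)" using that by (intro mult_right_mono) auto
    then show ?thesis using that by (auto simp: dist_norm norm_minus_commute)
  qed
  \<comment> \<open>The Leibniz rule takes the derivative as a continuous family of bounded linear
    maps, so the derivative of the integrand is packaged as one. The chain rule contributes a factor
    t, which raises the exponent from m to \<open>Suc m\<close>.\<close>
  define fx where "fx x t = Blinfun (\<lambda>v. t ^ Suc m * fderiv F (?p x t) v)" for x t
  have fx: "blinfun_apply (fx x t) = (\<lambda>v. t ^ Suc m * fderiv F (?p x t) v)"
    if "x \<in> ?U" "t \<in> cbox (0::real) 1" for x t
    unfolding fx_def
    by (intro bounded_linear_Blinfun_apply bounded_linear_const_mult has_derivative_bounded_linear)
       (rule smooth_on_has_derivative[OF F inU[OF that]])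
  have cp: "continuous_on (?U \<times> cbox (0::real) 1) (\<lambda>z. ?p (fst z) (snd z))"
    by (intro continuous_intros)
  have "((\<lambda>x. integral (cbox 0 1) (\<lambda>t. t ^ m * F (?p x t))) has_derivative integral (cbox 0 1) (fx x)) (at x within ?U)"
  proof (rule leibniz_rule)
    show "((\<lambda>x. t ^ m * F (?p x t)) has_derivative blinfun_apply (fx x t)) (at x within ?U)"
      if "x \<in> ?U" "t \<in> cbox (0::real) 1" for x t
    proof -
      have "((\<lambda>x. F (?p x t)) has_derivative (\<lambda>v. fderiv F (?p x t) (t *\<^sub>R v))) (at x)"
        by (rule has_derivative_compose[where f="\<lambda>x. ?p x t" and g=F])
           (auto intro!: derivative_eq_intros simp: smooth_on_differentiable[OF F inU[OF that]] simp flip: frechet_derivative_works)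
      then have "((\<lambda>x. t ^ m * F (?p x t)) has_derivative (\<lambda>v. t ^ m * fderiv F (?p x t) (t *\<^sub>R v))) (at x within ?U)"
        by (rule has_derivative_mult_right[OF has_derivative_at_withinI])
      moreover have "fderiv F (?p x t) (t *\<^sub>R v) = t * fderiv F (?p x t) v" for v
        using linear_frechet_derivative[OF smooth_on_differentiable[OF F inU[OF that]]] by (simp add: linear_cmul)
      ultimately show ?thesis by (simp add: fx[OF that] ac_simps)
    qed
    show "(\<lambda>t. t ^ m * F (?p x t)) integrable_on cbox 0 1" if "x \<in> ?U" for x
    proof -
      have "continuous_on (cbox 0 1) (\<lambda>t. F (?p x t))"
        by (rule continuous_on_compose2[OF smooth_on_continuous[OF F]])
           (use inU[OF that] in \<open>auto intro!: continuous_intros\<close>)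
      then show ?thesis
        by (intro integrable_continuous continuous_on_mult continuous_on_power continuous_on_id)
    qed
    show "continuous_on (?U \<times> cbox 0 1) (\<lambda>(x, t). fx x t)"
    proof (rule continuous_on_blinfun_componentwise)
      fix b :: 'e assume "b \<in> Basis"
      have "continuous_on (?U \<times> cbox 0 1) (\<lambda>z. snd z ^ Suc m * fderiv F (?p (fst z) (snd z)) b)"
        by (rule continuous_on_mult[OF continuous_on_power[OF continuous_on_snd[OF continuous_on_id]]
              continuous_on_compose2[OF smooth_on_continuous[OF smooth_on_frechet[OF F]] cp]])
           (use inU in auto)
      then show "continuous_on (?U \<times> cbox 0 1) (\<lambda>z. blinfun_apply (case z of (x, t) \<Rightarrow> fx x t) b)"
        by (rule continuous_on_eq) (auto simp: fx)
    qed
  qed (use x in auto)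
  then show ?thesis unfolding at_within_open[OF x open_ball] box_real
  proof (rule has_derivative_eq_rhs, intro ext)
    fix v
    have "continuous_on (cbox 0 1) (fx x)"
    proof (rule continuous_on_blinfun_componentwise)
      fix b :: 'e assume "b \<in> Basis"
      have "continuous_on (cbox 0 1) (\<lambda>t. t ^ Suc m * fderiv F (?p x t) b)"
        by (rule continuous_on_mult[OF continuous_on_power[OF continuous_on_id]
              continuous_on_compose2[OF smooth_on_continuous[OF smooth_on_frechet[OF F]]]])
           (use inU[OF x] in \<open>auto intro!: continuous_intros\<close>)
      then show "continuous_on (cbox 0 1) (\<lambda>t. blinfun_apply (fx x t) b)"
        by (rule continuous_on_eq) (simp add: fx[OF x])
    qed
    then have "blinfun_apply (integral (cbox 0 1) (fx x)) v = integral (cbox 0 1) (\<lambda>t. blinfun_apply (fx x t) v)"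
      by (intro blinfun_apply_integral integrable_continuous)
    also have "\<dots> = integral (cbox 0 1) (\<lambda>t. t ^ Suc m * fderiv F (?p x t) v)"
      by (rule integral_cong) (simp add: fx[OF x])
    finally show "blinfun_apply (integral {0..1} (fx x)) v = integral {0..1} (\<lambda>t. t ^ Suc m * fderiv F (?p x t) v)"
      by simp
  qed
qed

lemma smooth_on_parametric_integral:
  fixes F :: "'e::euclidean_space \<Rightarrow> real"
  assumes F: "smooth_on (ball c r) F"
  shows "smooth_on (ball c r) (\<lambda>x. integral {0..1} (\<lambda>t. t ^ m * F (c + t *\<^sub>R (x - c))))"
proof -
  have "Ck_on k (ball c r) (\<lambda>x. integral {0..1} (\<lambda>t. t ^ m * F (c + t *\<^sub>R (x - c))))" for k
    using F
  proof (induction k arbitrary: m F)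
    case 0
    show ?case unfolding Ck_on.simps
      by (intro continuous_at_imp_continuous_on ballI)
         (rule has_derivative_continuous[OF has_derivative_parametric_integral[OF 0]])
  next
    case (Suc k)
    show ?case
      by (rule Ck_on_SucI[OF open_ball has_derivative_parametric_integral[OF Suc.prems]])
         (assumption, rule Suc.IH, rule smooth_on_frechet, rule Suc.prems)
  qed
  then show ?thesis by (simp add: smooth_on_def)
qed

text \<open>Integrating the derivative of t -> F (c + t (x - c)) over [0, 1] gives the increment of
  F, with \<open>H b\<close> the average of a partial derivative along the segment; at x = c the
  segment is a point. This is what turns derivations into directional derivatives.\<close>

lemma Hadamard:
  fixes F :: "'e::euclidean_space \<Rightarrow> real"
  assumes F: "smooth_on (ball c r) F"
  obtains H where "\<And>b. smooth_on (ball c r) (H b)" "\<And>b. H b c = fderiv F c b"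
    "\<And>x. x \<in> ball c r \<Longrightarrow> F x = F c + (\<Sum>b\<in>Basis. ((x - c) \<bullet> b) * H b x)"
proof
  define H where "H b x = integral {0..1} (\<lambda>t. t ^ 0 * fderiv F (c + t *\<^sub>R (x - c)) b)" for b x
  show "smooth_on (ball c r) (H b)" for b
    unfolding H_def by (rule smooth_on_parametric_integral[OF smooth_on_frechet[OF F]])
  show "H b c = fderiv F c b" for b
    by (simp add: H_def)
  show "F x = F c + (\<Sum>b\<in>Basis. ((x - c) \<bullet> b) * H b x)" if x: "x \<in> ball c r" for x
  proof -
    let ?p = "\<lambda>t. c + t *\<^sub>R (x - c)"
    have inU: "?p t \<in> ball c r" if "t \<in> {0..1}" for t
    proof -
      have "t * norm (x - c) \<le> 1 * norm (x - c)" using that by (intro mult_right_mono) auto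
      then show ?thesis using that x by (auto simp: dist_norm norm_minus_commute)
    qed
    have "((\<lambda>t. fderiv F (?p t) (x - c)) has_integral (F (?p 1) - F (?p 0))) {0..1}"
    proof (rule fundamental_theorem_of_calculus)
      fix t :: real assume "t \<in> {0..1}"
      then show "((\<lambda>t. F (?p t)) has_vector_derivative fderiv F (?p t) (x - c)) (at t within {0..1})"
        by (rule has_vector_derivative_at_within[OF
            has_real_derivative_along_line[unfolded has_real_derivative_iff_has_vector_derivative,
              OF smooth_on_differentiable[OF F inU]]])
    qed simp
    then have "F x - F c = integral {0..1} (\<lambda>t. fderiv F (?p t) (x - c))"
      by (simp add: integral_unique)
    also have "\<dots> = integral {0..1} (\<lambda>t. \<Sum>b\<in>Basis. ((x - c) \<bullet> b) * fderiv F (?p t) b)"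
    proof (rule integral_cong)
      fix t :: real assume "t \<in> {0..1}"
      from frechet_derivative_basis_expansion[OF smooth_on_differentiable[OF F inU[OF this]], of "x - c"]
      show "fderiv F (?p t) (x - c) = (\<Sum>b\<in>Basis. ((x - c) \<bullet> b) * fderiv F (?p t) b)"
        by simp
    qed
    also have "\<dots> = (\<Sum>b\<in>Basis. integral {0..1} (\<lambda>t. ((x - c) \<bullet> b) * fderiv F (?p t) b))"
    proof (rule integral_sum[OF finite_Basis])
      fix b :: 'e
      have "continuous_on {0..1} (\<lambda>t. fderiv F (?p t) b)"
        by (rule continuous_on_compose2[OF smooth_on_continuous[OF smooth_on_frechet[OF F]]])
           (use inU in \<open>auto intro!: continuous_intros\<close>)
      then show "(\<lambda>t. ((x - c) \<bullet> b) * fderiv F (?p t) b) integrable_on {0..1}"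
        by (intro integrable_continuous_real continuous_on_mult_left)
    qed
    also have "\<dots> = (\<Sum>b\<in>Basis. ((x - c) \<bullet> b) * H b x)"
      by (simp add: H_def)
    finally show ?thesis by simp
  qed
qed

section \<open>Smooth functions and tangent vectors\<close>

locale smooth_manifold =
  fixes A :: "('m::t2_space, 'e::euclidean_space) atlas"
  assumes atlas: "smooth_atlas A"
begin

lemma
  assumes "(U, \<phi>) \<in> A"
  shows chart_open: "open U" and chart_image_open: "open (\<phi> ` U)"
    and chart_homeomorphism: "homeomorphism U (\<phi> ` U) \<phi> (inv_into U \<phi>)"
  using atlas assms by (auto simp: smooth_atlas_def)

lemma chart_inv: "(U, \<phi>) \<in> A \<Longrightarrow> q \<in> U \<Longrightarrow> inv_into U \<phi> (\<phi> q) = q"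
  using chart_homeomorphism homeomorphism_apply1 by blast

lemma chart_inv': "x \<in> \<phi> ` U \<Longrightarrow> \<phi> (inv_into U \<phi> x) = x"
  by (rule f_inv_into_f)

lemma chart_inv_mem: "x \<in> \<phi> ` U \<Longrightarrow> inv_into U \<phi> x \<in> U"
  by (rule inv_into_into)

lemma chart_cover: obtains U \<phi> where "(U, \<phi>) \<in> A" "p \<in> U"
proof -
  have "p \<in> (\<Union>(U, \<phi>)\<in>A. U)" using atlas by (simp add: smooth_atlas_def)
  then show ?thesis using that by auto
qed

lemma chart_image_of_open:
  assumes "(U, \<phi>) \<in> A" "open W" shows "open (\<phi> ` (U \<inter> W))"
proof -
  have "\<phi> ` (U \<inter> W) = \<phi> ` U \<inter> inv_into U \<phi> -` W"
    using chart_inv[OF assms(1)] by (auto simp: image_iff)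
  moreover have "continuous_on (\<phi> ` U) (inv_into U \<phi>)"
    using chart_homeomorphism[OF assms(1)] by (simp add: homeomorphism_def)
  ultimately show ?thesis
    using assms chart_image_open by (metis continuous_on_open_vimage Int_commute)
qed

lemma chart_preimage_of_open:
  assumes "(U, \<phi>) \<in> A" "open T" "T \<subseteq> \<phi> ` U" shows "open (inv_into U \<phi> ` T)"
proof -
  have "inv_into U \<phi> ` T = U \<inter> \<phi> -` T"
  proof (intro set_eqI iffI)
    fix q assume "q \<in> inv_into U \<phi> ` T"
    then obtain x where x: "x \<in> T" "x \<in> \<phi> ` U" "q = inv_into U \<phi> x" using assms(3) by blast
    then show "q \<in> U \<inter> \<phi> -` T" using chart_inv'[OF x(2)] chart_inv_mem[OF x(2)] by simp
  next
    fix q assume "q \<in> U \<inter> \<phi> -` T"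
    then show "q \<in> inv_into U \<phi> ` T" using chart_inv[OF assms(1), of q] by (metis IntD1 IntD2 imageI vimageD)
  qed
  moreover have "continuous_on U \<phi>"
    using chart_homeomorphism[OF assms(1)] by (simp add: homeomorphism_def)
  ultimately show ?thesis
    using assms chart_open by (metis continuous_on_open_vimage Int_commute)
qed

lemma smooth_transition:
  "(U, \<phi>) \<in> A \<Longrightarrow> (V, \<psi>) \<in> A \<Longrightarrow> smooth_on (\<phi> ` (U \<inter> V)) (\<lambda>x. \<psi> (inv_into U \<phi> x))"
  using atlas by (force simp: smooth_atlas_def o_def)

text \<open>Continuity is a separate clause of \<open>smooth_map\<close>; for real functions it
  follows from smoothness in the charts, which are homeomorphisms on open sets covering the
  manifold.\<close>

lemma smooth_fun_iff:
  "smooth_fun A f \<longleftrightarrow> (\<forall>(U, \<phi>)\<in>A. smooth_on (\<phi> ` U) (\<lambda>x. f (inv_into U \<phi> x)))"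
proof -
  have "continuous_on UNIV f" if s: "\<forall>(U, \<phi>)\<in>A. smooth_on (\<phi> ` U) (\<lambda>x. f (inv_into U \<phi> x))"
  proof (rule continuous_at_imp_continuous_on, rule ballI)
    fix p
    obtain U \<phi> where U: "(U, \<phi>) \<in> A" "p \<in> U" by (rule chart_cover)
    have "smooth_on (\<phi> ` U) (\<lambda>x. f (inv_into U \<phi> x))" using s U by auto
    moreover have "continuous_on U \<phi>"
      using chart_homeomorphism[OF U(1)] by (simp add: homeomorphism_def)
    ultimately have "continuous_on U (\<lambda>q. f (inv_into U \<phi> (\<phi> q)))"
      by (rule continuous_on_compose2[OF smooth_on_continuous]) simp
    then have "continuous_on U f"
      by (rule continuous_on_eq) (simp add: chart_inv[OF U(1)])
    then show "isCont f p" using chart_open[OF U(1)] U(2) by (simp add: continuous_on_eq_continuous_at)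
  qed
  moreover have "smooth_fun A f \<longleftrightarrow> continuous_on UNIV f \<and> (\<forall>(U, \<phi>)\<in>A. smooth_on (\<phi> ` U) (\<lambda>x. f (inv_into U \<phi> x)))"
    by (simp add: smooth_fun_def smooth_map_def euclidean_atlas_def o_def)
  ultimately show ?thesis by argo
qed

lemma smooth_funD:
  "smooth_fun A f \<Longrightarrow> (U, \<phi>) \<in> A \<Longrightarrow> smooth_on (\<phi> ` U) (\<lambda>x. f (inv_into U \<phi> x))"
  by (auto simp: smooth_fun_iff)

lemma smooth_fun_continuous: "smooth_fun A f \<Longrightarrow> continuous_on UNIV f"
  by (simp add: smooth_fun_def smooth_map_def)

lemma smooth_fun_const [simp]: "smooth_fun A (\<lambda>q. c)"
  by (simp add: smooth_fun_iff split_beta)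

lemma smooth_fun_add: "smooth_fun A f \<Longrightarrow> smooth_fun A g \<Longrightarrow> smooth_fun A (\<lambda>q. f q + g q)"
  unfolding smooth_fun_iff using chart_image_open by (fast intro: smooth_on_add)

lemma smooth_fun_mult: "smooth_fun A f \<Longrightarrow> smooth_fun A g \<Longrightarrow> smooth_fun A (\<lambda>q. f q * g q)"
  unfolding smooth_fun_iff using chart_image_open by (fast intro: smooth_on_mult)

lemma smooth_fun_diff: "smooth_fun A f \<Longrightarrow> smooth_fun A g \<Longrightarrow> smooth_fun A (\<lambda>q. f q - g q)"
  using smooth_fun_add[OF _ smooth_fun_mult[OF smooth_fun_const], of f g "- 1"] by simp

lemma smooth_fun_sum: "(\<And>i. i \<in> I \<Longrightarrow> smooth_fun A (f i)) \<Longrightarrow> smooth_fun A (\<lambda>q. \<Sum>i\<in>I. f i q)"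
  by (induction I rule: infinite_finite_induct) (auto intro!: smooth_fun_add)

text \<open>Two open sets cover the manifold: the part corresponding to T, where the function is F
  in coordinates, and the complement of the part corresponding to K, where it is 0. The latter is
  open because a compact set in a Hausdorff space is closed.\<close>

lemma smooth_fun_extend:
  assumes U: "(U, \<phi>) \<in> A" and T: "open T" "T \<subseteq> \<phi> ` U" and F: "smooth_on T F"
    and K: "compact K" "K \<subseteq> T" "\<And>x. x \<in> T - K \<Longrightarrow> F x = 0"
  shows "smooth_fun A (\<lambda>q. if q \<in> inv_into U \<phi> ` T then F (\<phi> q) else 0)" (is "smooth_fun A ?f")
  unfolding smooth_fun_iff
proof (clarify, rule smooth_on_local)
  fix V \<psi> x assume V: "(V, \<psi>) \<in> A" and x: "x \<in> \<psi> ` V"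
  let ?N = "inv_into U \<phi> ` T" and ?C = "inv_into U \<phi> ` K"
  have N: "open ?N" by (rule chart_preimage_of_open[OF U T])
  have NU: "?N \<subseteq> U" by (rule image_subsetI, rule inv_into_into, rule subsetD[OF T(2)])
  have NT: "\<phi> q \<in> T" if "q \<in> ?N" for q using that T(2) by (auto simp: f_inv_into_f subset_iff)
  have C: "closed ?C"
  proof (rule compact_imp_closed, rule compact_continuous_image[OF _ K(1)])
    show "continuous_on K (inv_into U \<phi>)"
      using chart_homeomorphism[OF U] by (intro continuous_on_subset[OF _ subset_trans[OF K(2) T(2)]])
        (simp add: homeomorphism_def)
  qed
  have xV: "x = \<psi> (inv_into V \<psi> x)" "inv_into V \<psi> x \<in> V"
    using x by (simp_all add: f_inv_into_f inv_into_into)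
  show "\<exists>T. open T \<and> x \<in> T \<and> smooth_on T (\<lambda>x. ?f (inv_into V \<psi> x))"
  proof (cases "inv_into V \<psi> x \<in> ?N")
    case True
    let ?T = "\<psi> ` (V \<inter> ?N)"
    have o: "open ?T" by (rule chart_image_of_open[OF V N])
    have xT: "x \<in> ?T" by (rule image_eqI[where f=\<psi>, OF xV(1)]) (use xV(2) True in blast)
    have i: "inv_into V \<psi> y \<in> ?N" if "y \<in> ?T" for y
      using that chart_inv[OF V] by auto
    have "smooth_on ?T (\<lambda>y. F (\<phi> (inv_into V \<psi> y)))"
    proof (rule smooth_on_compose[OF o _ F])
      show "smooth_on ?T (\<lambda>y. \<phi> (inv_into V \<psi> y))"
        by (rule smooth_on_subset[OF smooth_transition[OF V U]]) (use NU in blast)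
      show "(\<lambda>y. \<phi> (inv_into V \<psi> y)) ` ?T \<subseteq> T" using i NT by blast
    qed
    then have "smooth_on ?T (\<lambda>x. ?f (inv_into V \<psi> x))"
      by (rule smooth_on_cong[OF o, rotated]) (use i in auto)
    then show ?thesis using o xT by blast
  next
    case False
    let ?T = "\<psi> ` (V \<inter> - ?C)"
    have o: "open ?T" by (rule chart_image_of_open[OF V]) (use C in auto)
    have "inv_into V \<psi> x \<notin> ?C" using False K(2) by blast
    then have xT: "x \<in> ?T" by (intro image_eqI[where f=\<psi>, OF xV(1)] IntI xV(2) ComplI) simp
    have i: "?f (inv_into V \<psi> y) = 0" if "y \<in> ?T" for y
    proof (cases "inv_into V \<psi> y \<in> ?N")
      case True
      have c: "inv_into V \<psi> y \<notin> ?C" using that chart_inv[OF V] by auto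
      have "\<phi> (inv_into V \<psi> y) \<notin> K"
      proof
        assume "\<phi> (inv_into V \<psi> y) \<in> K"
        then have "inv_into U \<phi> (\<phi> (inv_into V \<psi> y)) \<in> ?C" by blast
        then show False using c chart_inv[OF U] True NU by auto
      qed
      then show ?thesis using K(3) NT[OF True] by simp
    qed simp
    have "smooth_on ?T (\<lambda>x. ?f (inv_into V \<psi> x))"
      by (rule smooth_on_cong[OF o _ smooth_on_const[where c=0]]) (use i in simp)
    then show ?thesis using o xT by blast
  qed
qed

lemma bump_function:
  assumes "open W" "p \<in> W"
  obtains h where "smooth_fun A h" "h p = 1" "\<And>q. q \<notin> W \<Longrightarrow> h q = 0"
proof -
  obtain U \<phi> where U: "(U, \<phi>) \<in> A" "p \<in> U" by (rule chart_cover)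
  let ?T = "\<phi> ` (U \<inter> W)"
  have o: "open ?T" by (rule chart_image_of_open[OF U(1) assms(1)])
  have "\<phi> p \<in> ?T" using U assms by blast
  then obtain s where s: "s > 0" "cball (\<phi> p) s \<subseteq> ?T" using o open_contains_cball by blast
  define r where "r = s / 2"
  have r: "r > 0" "cball (\<phi> p) (2 * r) \<subseteq> ?T" using s by (auto simp: r_def)
  let ?h = "\<lambda>q. if q \<in> inv_into U \<phi> ` ?T then cutoff (\<phi> p) r (\<phi> q) else 0"
  show ?thesis
  proof
    show "smooth_fun A ?h"
      by (rule smooth_fun_extend[OF U(1) o _ smooth_on_cutoff _ r(2)]) (auto intro: cutoff_0[OF r(1)])
    have "p \<in> inv_into U \<phi> ` ?T"
      using chart_inv[OF U] \<open>\<phi> p \<in> ?T\<close> by (metis imageI)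
    then show "?h p = 1" using r(1) by (simp add: cutoff_1)
    show "?h q = 0" if "q \<notin> W" for q using that chart_inv[OF U(1)] by auto
  qed
qed

section \<open>Locality of tangent vectors and operations on vector fields\<close>

lemma tangent_nonsmooth: "v \<in> tangent_space A p \<Longrightarrow> \<not> smooth_fun A f \<Longrightarrow> v f = 0"
  by (simp add: tangent_space_def)

lemma tangent_add:
  "v \<in> tangent_space A p \<Longrightarrow> smooth_fun A f \<Longrightarrow> smooth_fun A g \<Longrightarrow> v (\<lambda>x. f x + g x) = v f + v g"
  by (simp add: tangent_space_def)

lemma tangent_cmult:
  "v \<in> tangent_space A p \<Longrightarrow> smooth_fun A f \<Longrightarrow> v (\<lambda>x. c * f x) = c * v f"
  by (simp add: tangent_space_def)

lemma tangent_mult: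
  "v \<in> tangent_space A p \<Longrightarrow> smooth_fun A f \<Longrightarrow> smooth_fun A g \<Longrightarrow>
    v (\<lambda>x. f x * g x) = f p * v g + g p * v f"
  by (simp add: tangent_space_def)

text \<open>The Leibniz rule for 1 = 1 * 1 gives v(1) = 2 v(1).\<close>

lemma tangent_const: "v \<in> tangent_space A p \<Longrightarrow> v (\<lambda>x. c) = 0"
  using tangent_mult[of v p "\<lambda>x. 1" "\<lambda>x. 1"] tangent_cmult[of v p "\<lambda>x. 1" c] by simp

lemma tangent_diff:
  "v \<in> tangent_space A p \<Longrightarrow> smooth_fun A f \<Longrightarrow> smooth_fun A g \<Longrightarrow> v (\<lambda>x. f x - g x) = v f - v g"
  using tangent_add[of v p f "\<lambda>x. - 1 * g x"] tangent_cmult[of v p g "- 1"]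
    smooth_fun_mult[OF smooth_fun_const, of g "- 1"] by simp

lemma tangent_sum:
  "v \<in> tangent_space A p \<Longrightarrow> (\<And>i. i \<in> I \<Longrightarrow> smooth_fun A (f i)) \<Longrightarrow>
    v (\<lambda>x. \<Sum>i\<in>I. f i x) = (\<Sum>i\<in>I. v (f i))"
proof (induction I rule: infinite_finite_induct)
  case (insert i F)
  then show ?case using tangent_add[OF insert.prems(1), of "f i" "\<lambda>x. \<Sum>i\<in>F. f i x"] smooth_fun_sum[of F f] by simp
qed (simp_all add: tangent_const)

text \<open>With a bump h vanishing off W, the function h (f - g) is identically 0, while Leibniz at
  p evaluates v on it to v f - v g, since h p = 1 and f p = g p.\<close>

lemma tangent_local:
  assumes v: "v \<in> tangent_space A p" and W: "open W" "p \<in> W"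
    and f: "smooth_fun A f" and g: "smooth_fun A g" and eq: "\<And>q. q \<in> W \<Longrightarrow> f q = g q"
  shows "v f = v g"
proof -
  obtain h where h: "smooth_fun A h" "h p = 1" "\<And>q. q \<notin> W \<Longrightarrow> h q = 0"
    using W by (rule bump_function) blast
  have "(\<lambda>x. h x * (f x - g x)) = (\<lambda>x. 0)" using h(3) eq by (metis diff_self mult_zero_left mult_zero_right)
  then have "0 = v (\<lambda>x. h x * (f x - g x))" using tangent_const[OF v] by simp
  also have "\<dots> = v f - v g"
    using tangent_mult[OF v h(1) smooth_fun_diff[OF f g]] tangent_diff[OF v f g] h(2) eq[OF W(2)] by simp
  finally show ?thesis by simp
qed

lemma lincomb_tangent:
  "v \<in> tangent_space A p \<Longrightarrow> w \<in> tangent_space A p \<Longrightarrow> lincomb a v b w \<in> tangent_space A p"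
  by (auto simp: tangent_space_def lincomb_def algebra_simps)

lemma zero_tangent: "zero_tangent \<in> tangent_space A p"
  by (auto simp: tangent_space_def zero_tangent_def)

lemma vector_field_tangent: "vector_field A X \<Longrightarrow> X p \<in> tangent_space A p"
  by (simp add: vector_field_def)

text \<open>On a function that is not smooth, the derivative is identically 0 by the convention for
  tangent vectors, and constants are smooth.\<close>

lemma vector_field_smooth:
  assumes "vector_field A X" shows "smooth_fun A (\<lambda>p. X p f)"
proof (cases "smooth_fun A f")
  case False
  then have "(\<lambda>p. X p f) = (\<lambda>p. 0)"
    using tangent_nonsmooth[OF vector_field_tangent[OF assms]] by simp
  then show ?thesis by simp
qed (use assms in \<open>simp add: vector_field_def\<close>)

lemma vector_field_lincomb:
  assumes "vector_field A X" "vector_field A Y"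
  shows "vector_field A (\<lambda>p. lincomb a (X p) b (Y p))"
  unfolding vector_field_def
proof (intro conjI allI impI)
  show "lincomb a (X p) b (Y p) \<in> tangent_space A p" for p
    by (intro lincomb_tangent vector_field_tangent assms)
  show "smooth_fun A (\<lambda>p. lincomb a (X p) b (Y p) f)" for f
    unfolding lincomb_def
    by (intro smooth_fun_add smooth_fun_mult vector_field_smooth assms smooth_fun_const)
qed

text \<open>The products of two first derivatives in X(Y(f h)) are symmetric in X and Y and cancel
  in the bracket, which leaves the Leibniz rule.\<close>

lemma vector_field_lie_bracket:
  assumes X: "vector_field A X" and Y: "vector_field A Y"
  shows "vector_field A (lie_bracket X Y)"
  unfolding vector_field_def
proof (intro conjI allI impI)
  note s = vector_field_smooth[OF X] vector_field_smooth[OF Y]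
  note t = vector_field_tangent[OF X] vector_field_tangent[OF Y]
  show "lie_bracket X Y p \<in> tangent_space A p" for p
    unfolding tangent_space_def lie_bracket_def
    using t[of p] s
    by (auto simp: tangent_nonsmooth[OF t(1)] tangent_nonsmooth[OF t(2)] tangent_const
        tangent_add[OF t(1)] tangent_add[OF t(2)] tangent_cmult[OF t(1)] tangent_cmult[OF t(2)]
        tangent_mult[OF t(1)] tangent_mult[OF t(2)] smooth_fun_mult algebra_simps)
  show "smooth_fun A (\<lambda>p. lie_bracket X Y p f)" for f
    unfolding lie_bracket_def
    by (intro smooth_fun_diff vector_field_smooth[OF X] vector_field_smooth[OF Y])
qed

end

section \<open>Coordinates\<close>

lemma has_derivative_imp_frechet:
  "(f has_derivative f') (at x) \<Longrightarrow> fderiv f x v = f' v"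
  by (simp add: frechet_derivativeI)

text \<open>Calculations take place over the ball of radius r, and the closed ball of radius 2 r
  leaves room for a cutoff. Coordinate functions and coordinate fields thereby become global
  objects, as the definition of tangent vectors demands, without changing over the small
  ball.\<close>

locale manifold_chart = smooth_manifold A
  for A :: "('m::t2_space, 'e::euclidean_space) atlas" +
  fixes U :: "'m set" and \<phi> :: "'m \<Rightarrow> 'e" and p :: 'm and r :: real
  assumes chart: "(U, \<phi>) \<in> A" and center: "p \<in> U"
    and radius: "r > 0" "cball (\<phi> p) (2 * r) \<subseteq> \<phi> ` U"
begin

abbreviation "inv\<phi> \<equiv> inv_into U \<phi>"

definition B :: "'e set" where "B = ball (\<phi> p) r"
definition N :: "'m set" where "N = inv\<phi> ` B"
definition bump :: "'e \<Rightarrow> real" where "bump = cutoff (\<phi> p) r"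

definition extend :: "('e \<Rightarrow> real) \<Rightarrow> 'm \<Rightarrow> real" where
  "extend F q = (if q \<in> U then bump (\<phi> q) * F (\<phi> q) else 0)"

definition coord_fun :: "'e \<Rightarrow> 'm \<Rightarrow> real" where
  "coord_fun b = extend (\<lambda>x. x \<bullet> b)"

definition coords :: "'m tangent \<Rightarrow> 'e" where
  "coords v = (\<Sum>b\<in>Basis. v (coord_fun b) *\<^sub>R b)"

definition tangent_of :: "'m \<Rightarrow> 'e \<Rightarrow> 'm tangent" where
  "tangent_of q u = (\<lambda>f. if smooth_fun A f then fderiv (\<lambda>x. f (inv\<phi> x)) (\<phi> q) u else 0)"

definition coord_field :: "'e \<Rightarrow> 'm vfield" where
  "coord_field u q = (\<lambda>f. if q \<in> U then bump (\<phi> q) * tangent_of q u f else 0)"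

text \<open>The formula is smooth on the whole chart image, but it is the coordinate expression of X
  only on \<open>B\<close>: elsewhere the cutoff distorts the coordinate functions.\<close>

definition rep :: "'m vfield \<Rightarrow> 'e \<Rightarrow> 'e" where
  "rep X x = coords (X (inv\<phi> x))"

lemma image_open: "open (\<phi> ` U)" by (rule chart_image_open[OF chart])

lemma B_open: "open B" by (simp add: B_def)

lemma B_subset: "B \<subseteq> \<phi> ` U"
proof -
  have "B \<subseteq> cball (\<phi> p) (2 * r)" using radius(1) by (auto simp: B_def)
  then show ?thesis using radius(2) by blast
qed

lemma center_B: "\<phi> p \<in> B" using radius by (simp add: B_def)

lemma N_open: "open N" unfolding N_def by (rule chart_preimage_of_open[OF chart B_open B_subset])

lemma inv_B [simp]: "x \<in> B \<Longrightarrow> \<phi> (inv\<phi> x) = x"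
  using B_subset by (auto intro: f_inv_into_f)

lemma inv_B_U [simp]: "x \<in> B \<Longrightarrow> inv\<phi> x \<in> U"
  using B_subset inv_into_into[of x \<phi> U] by auto

lemma inv_B_N [simp]: "x \<in> B \<Longrightarrow> inv\<phi> x \<in> N" by (simp add: N_def)

lemma N_U: "q \<in> N \<Longrightarrow> q \<in> U" by (auto simp: N_def)

lemma inv_\<phi>: "q \<in> U \<Longrightarrow> inv\<phi> (\<phi> q) = q" by (rule chart_inv[OF chart])

lemma N_B: "q \<in> N \<Longrightarrow> \<phi> q \<in> B" by (auto simp: N_def)

lemma center_N: "p \<in> N" using center_B inv_\<phi>[OF center] by (metis inv_B_N)

lemma bump_B: "x \<in> B \<Longrightarrow> bump x = 1" using radius(1) by (simp add: bump_def B_def cutoff_1)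

lemma extend_smooth: assumes "smooth_on (\<phi> ` U) F" shows "smooth_fun A (extend F)"
proof -
  have "smooth_fun A (\<lambda>q. if q \<in> inv\<phi> ` \<phi> ` U then bump (\<phi> q) * F (\<phi> q) else 0)"
  proof (rule smooth_fun_extend[OF chart image_open subset_refl _ _ radius(2)])
    show "smooth_on (\<phi> ` U) (\<lambda>x. bump x * F x)"
      unfolding bump_def by (intro smooth_on_mult image_open smooth_on_cutoff assms)
    show "bump x * F x = 0" if "x \<in> \<phi> ` U - cball (\<phi> p) (2 * r)" for x
      using cutoff_0[OF radius(1), of x] that by (simp add: bump_def)
  qed simp
  moreover have "inv\<phi> ` \<phi> ` U = U"
    using chart_homeomorphism[OF chart] by (simp add: homeomorphism_def)
  ultimately show ?thesis by (simp add: extend_def[abs_def])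
qed

lemma extend_N: "q \<in> N \<Longrightarrow> extend F q = F (\<phi> q)"
  using N_U N_B bump_B by (simp add: extend_def)

lemma coord_fun_smooth: "smooth_fun A (coord_fun b)"
  unfolding coord_fun_def by (intro extend_smooth smooth_on_bounded_linear bounded_linear_inner_left)

lemma coord_fun_N: "q \<in> N \<Longrightarrow> coord_fun b q = \<phi> q \<bullet> b"
  by (simp add: coord_fun_def extend_N)

lemma in_chart_smooth: "smooth_fun A f \<Longrightarrow> smooth_on (\<phi> ` U) (\<lambda>x. f (inv\<phi> x))"
  by (rule smooth_funD[OF _ chart])

lemma in_chart_has_derivative:
  "smooth_fun A f \<Longrightarrow> q \<in> U \<Longrightarrow>
    ((\<lambda>x. f (inv\<phi> x)) has_derivative fderiv (\<lambda>x. f (inv\<phi> x)) (\<phi> q)) (at (\<phi> q))"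
  by (rule smooth_on_has_derivative[OF in_chart_smooth]) auto

lemma frechet_coord_fun: "q \<in> N \<Longrightarrow> fderiv (\<lambda>x. coord_fun b (inv\<phi> x)) (\<phi> q) u = u \<bullet> b"
proof -
  assume q: "q \<in> N"
  have "((\<lambda>x. x \<bullet> b) has_derivative (\<lambda>u. u \<bullet> b)) (at (\<phi> q))"
    by (rule bounded_linear_imp_has_derivative[OF bounded_linear_inner_left])
  then have "((\<lambda>x. coord_fun b (inv\<phi> x)) has_derivative (\<lambda>u. u \<bullet> b)) (at (\<phi> q))"
    by (rule has_derivative_transform_within_open[OF _ B_open N_B[OF q]]) (simp add: coord_fun_N)
  then show ?thesis by (rule has_derivative_imp_frechet)
qed

lemma coords_component: "b \<in> Basis \<Longrightarrow> coords v \<bullet> b = v (coord_fun b)"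
  by (simp add: coords_def inner_sum_left inner_Basis if_distrib cong: if_cong)

lemma coords_eqI: "(\<And>b. b \<in> Basis \<Longrightarrow> v (coord_fun b) = x \<bullet> b) \<Longrightarrow> coords v = x"
  by (rule euclidean_eqI) (simp add: coords_component)

text \<open>A derivation sees only the linear part of Hadamard's expansion: in each summand the
  coordinate factor vanishes at q, so Leibniz leaves v of the coordinate function times the value of
  \<open>H b\<close>, a partial derivative of f.\<close>

lemma tangent_expand:
  assumes q: "q \<in> N" and v: "v \<in> tangent_space A q" and f: "smooth_fun A f"
  shows "v f = fderiv (\<lambda>x. f (inv\<phi> x)) (\<phi> q) (coords v)"
proof -
  let ?F = "\<lambda>x. f (inv\<phi> x)" and ?c = "\<phi> q"
  obtain e where e: "e > 0" "ball ?c e \<subseteq> B" using N_B[OF q] B_open openE by blast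
  have F: "smooth_on (ball ?c e) ?F"
    by (rule smooth_on_subset[OF in_chart_smooth[OF f] subset_trans[OF e(2) B_subset]])
  obtain H where H: "\<And>b. smooth_on (ball ?c e) (H b)" "\<And>b. H b ?c = fderiv ?F ?c b"
    "\<And>x. x \<in> ball ?c e \<Longrightarrow> ?F x = ?F ?c + (\<Sum>b\<in>Basis. ((x - ?c) \<bullet> b) * H b x)"
    by (rule Hadamard[OF F]) blast
  \<comment> \<open>Any s with 2 s < e serves: the cutoff is then supported inside the ball on which
    the functions \<open>H b\<close> are smooth.\<close>
  define s where "s = e / 3"
  have s: "s > 0" "2 * s < e" using e by (auto simp: s_def)
  define Ht where "Ht b q' = (if q' \<in> inv\<phi> ` ball ?c e then cutoff ?c s (\<phi> q') * H b (\<phi> q') else 0)" for b q'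
  have Ht: "smooth_fun A (Ht b)" for b
    unfolding Ht_def
  proof (rule smooth_fun_extend[OF chart open_ball subset_trans[OF e(2) B_subset]])
    show "smooth_on (ball ?c e) (\<lambda>x. cutoff ?c s x * H b x)"
      by (intro smooth_on_mult open_ball smooth_on_cutoff H)
    show "cball ?c (2 * s) \<subseteq> ball ?c e" using s by auto
    show "cutoff ?c s x * H b x = 0" if "x \<in> ball ?c e - cball ?c (2 * s)" for x
      using cutoff_0[OF s(1), of x ?c] that by simp
  qed simp
  let ?W = "inv\<phi> ` ball ?c s"
  have se: "ball ?c s \<subseteq> ball ?c e" using s by auto
  have W: "open ?W"
    using chart_preimage_of_open[OF chart open_ball] e(2) B_subset se by blast
  have cs: "?c \<in> ball ?c s" using s by simp
  have qW: "q \<in> ?W" using imageI[OF cs, of inv\<phi>] inv_\<phi>[OF N_U[OF q]] by simp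
  have Ht_W: "Ht b (inv\<phi> x) = H b x" if "x \<in> ball ?c s" for b x
  proof -
    have "x \<in> B" using that se e(2) by blast
    moreover have "inv\<phi> x \<in> inv\<phi> ` ball ?c e" using that se by blast
    moreover have "cutoff ?c s x = 1" by (rule cutoff_1[OF s(1)]) (use that in auto)
    ultimately show ?thesis by (simp add: Ht_def)
  qed
  \<comment> \<open>Hadamard's expansion with globally defined factors. Agreement with f is needed
    only on \<open>?W\<close>, where the cutoff is 1, by locality of v.\<close>
  let ?G = "\<lambda>q'. f q + (\<Sum>b\<in>Basis. (coord_fun b q' - ?c \<bullet> b) * Ht b q')"
  have Gb: "smooth_fun A (\<lambda>q'. (coord_fun b q' - ?c \<bullet> b) * Ht b q')" for b
    by (intro smooth_fun_mult smooth_fun_diff coord_fun_smooth smooth_fun_const Ht)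
  have "v f = v ?G"
  proof (rule tangent_local[OF v W qW f])
    show "smooth_fun A ?G" by (intro smooth_fun_add smooth_fun_sum Gb smooth_fun_const)
    show "f q' = ?G q'" if q': "q' \<in> ?W" for q'
    proof -
      obtain x where x: "x \<in> ball ?c s" "q' = inv\<phi> x" using q' by blast
      have xB: "x \<in> B" using x(1) se e(2) by blast
      have "f q' = ?F x" using x by simp
      also have "\<dots> = ?F ?c + (\<Sum>b\<in>Basis. ((x - ?c) \<bullet> b) * H b x)"
        by (rule H(3)) (use x(1) se in blast)
      also have "\<dots> = ?G q'"
        using x xB Ht_W[OF x(1)] inv_\<phi>[OF N_U[OF q]] by (simp add: coord_fun_N inner_diff_left)
      finally show ?thesis .
    qed
  qed
  also have "\<dots> = (\<Sum>b\<in>Basis. v (\<lambda>q'. (coord_fun b q' - ?c \<bullet> b) * Ht b q'))"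
  proof -
    have "v ?G = v (\<lambda>q'. f q) + v (\<lambda>q'. \<Sum>b\<in>Basis. (coord_fun b q' - ?c \<bullet> b) * Ht b q')"
      by (rule tangent_add[OF v smooth_fun_const smooth_fun_sum[OF Gb]])
    then show ?thesis using tangent_const[OF v] tangent_sum[OF v Gb] by simp
  qed
  also have "\<dots> = (\<Sum>b\<in>Basis. v (coord_fun b) * fderiv ?F ?c b)"
  proof (rule sum.cong[OF refl])
    fix b :: 'e assume "b \<in> Basis"
    have "Ht b q = H b ?c" using Ht_W[OF cs] inv_\<phi>[OF N_U[OF q]] by simp
    then show "v (\<lambda>q'. (coord_fun b q' - ?c \<bullet> b) * Ht b q') = v (coord_fun b) * fderiv ?F ?c b"
      using tangent_mult[OF v smooth_fun_diff[OF coord_fun_smooth smooth_fun_const] Ht]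
        tangent_diff[OF v coord_fun_smooth smooth_fun_const] tangent_const[OF v] H(2)
      by (simp add: coord_fun_N[OF q])
  qed
  also have "\<dots> = fderiv ?F ?c (coords v)"
    using frechet_derivative_basis_expansion[OF smooth_on_differentiable[OF F], of ?c "coords v"] e(1)
    by (simp add: coords_component)
  finally show ?thesis .
qed

lemma tangent_of_tangent: assumes "q \<in> U" shows "tangent_of q u \<in> tangent_space A q"
proof -
  have *: "f (inv\<phi> (\<phi> q)) = f q" for f :: "'m \<Rightarrow> real" using inv_\<phi>[OF assms] by simp
  note d = in_chart_has_derivative[OF _ assms]
  show ?thesis
    unfolding tangent_space_def tangent_of_def
    by (auto simp: smooth_fun_add smooth_fun_mult * has_derivative_imp_frechet[OF has_derivative_add[OF d d]]
        has_derivative_imp_frechet[OF has_derivative_mult[OF d d]]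
        has_derivative_imp_frechet[OF has_derivative_mult_right[OF d]])
qed

lemma coords_tangent_of: assumes "q \<in> N" shows "coords (tangent_of q u) = u"
  by (rule coords_eqI) (simp add: tangent_of_def coord_fun_smooth frechet_coord_fun[OF assms])

lemma tangent_of_coords: assumes "q \<in> N" "v \<in> tangent_space A q" shows "tangent_of q (coords v) = v"
proof
  show "tangent_of q (coords v) f = v f" for f
    using tangent_expand[OF assms] tangent_nonsmooth[OF assms(2)] by (simp add: tangent_of_def)
qed

lemma coords_lincomb: "coords (lincomb a v b w) = a *\<^sub>R coords v + b *\<^sub>R coords w"
  by (rule coords_eqI) (simp add: lincomb_def inner_add_left coords_component)

lemma coords_zero: "coords zero_tangent = 0"
  by (rule coords_eqI) (simp add: zero_tangent_def)

lemma tangent_eqI: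
  "q \<in> N \<Longrightarrow> v \<in> tangent_space A q \<Longrightarrow> w \<in> tangent_space A q \<Longrightarrow> coords v = coords w \<Longrightarrow> v = w"
  using tangent_of_coords by metis

lemma tangent_zeroI: "q \<in> N \<Longrightarrow> v \<in> tangent_space A q \<Longrightarrow> coords v = 0 \<Longrightarrow> v = zero_tangent"
  by (rule tangent_eqI) (auto simp: coords_zero zero_tangent)

lemma tangent_of_lincomb: assumes "q \<in> N"
  shows "tangent_of q (a *\<^sub>R u + b *\<^sub>R w) = lincomb a (tangent_of q u) b (tangent_of q w)"
  by (rule tangent_eqI[OF assms])
     (auto simp: tangent_of_tangent N_U[OF assms] lincomb_tangent coords_lincomb coords_tangent_of[OF assms])

lemma coord_field_N: "q \<in> N \<Longrightarrow> coord_field u q = tangent_of q u"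
  using N_U N_B bump_B by (simp add: coord_field_def)

lemma vector_field_coord_field: "vector_field A (coord_field u)"
  unfolding vector_field_def
proof (intro conjI allI impI)
  show "coord_field u q \<in> tangent_space A q" for q
  proof (cases "q \<in> U")
    case True
    then have "coord_field u q = lincomb (bump (\<phi> q)) (tangent_of q u) 0 zero_tangent"
      by (simp add: coord_field_def lincomb_def zero_tangent_def)
    then show ?thesis using tangent_of_tangent[OF True] zero_tangent lincomb_tangent by metis
  next
    case False
    then have "coord_field u q = zero_tangent" by (simp add: coord_field_def zero_tangent_def)
    then show ?thesis using zero_tangent by simp
  qed
  fix f assume f: "smooth_fun A f"
  have "(\<lambda>q. coord_field u q f) = extend (\<lambda>x. fderiv (\<lambda>x. f (inv\<phi> x)) x u)"
    by (auto simp: coord_field_def extend_def tangent_of_def f)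
  then show "smooth_fun A (\<lambda>q. coord_field u q f)"
    using extend_smooth[OF smooth_on_frechet[OF in_chart_smooth[OF f]]] by simp
qed

lemma rep_smooth: assumes "vector_field A X" shows "smooth_on (\<phi> ` U) (rep X)"
  unfolding rep_def coords_def
  by (intro smooth_on_sum smooth_on_scaleR image_open smooth_on_const
      in_chart_smooth[OF vector_field_smooth[OF assms]])

lemma vector_field_apply:
  assumes "vector_field A X" "x \<in> B" "smooth_fun A f"
  shows "X (inv\<phi> x) f = fderiv (\<lambda>x. f (inv\<phi> x)) x (rep X x)"
  using tangent_expand[OF inv_B_N[OF assms(2)] vector_field_tangent[OF assms(1)] assms(3)] assms(2)
  by (simp add: rep_def)

lemma rep_coord_field: "x \<in> B \<Longrightarrow> rep (coord_field u) x = u"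
  by (simp add: rep_def coord_field_N coords_tangent_of)

lemma rep_has_derivative:
  assumes "vector_field A X" "x \<in> B"
  shows "(rep X has_derivative fderiv (rep X) x) (at x)"
  by (rule smooth_on_has_derivative[OF rep_smooth[OF assms(1)]]) (use assms(2) B_subset in auto)

text \<open>It suffices to compare on coordinate functions. There Y of a coordinate function is a
  component of \<open>rep Y\<close>, so only first derivatives of the representatives occur.\<close>

lemma rep_lie_bracket:
  assumes X: "vector_field A X" and Y: "vector_field A Y" and x: "x \<in> B"
  shows "rep (lie_bracket X Y) x = fderiv (rep Y) x (rep X x) - fderiv (rep X) x (rep Y x)"
proof -
  have *: "X (inv\<phi> x) (\<lambda>q. Y q (coord_fun b)) = fderiv (rep Y) x (rep X x) \<bullet> b"
    if X: "vector_field A X" and Y: "vector_field A Y" and b: "b \<in> Basis" for X Y b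
  proof -
    have "((\<lambda>x. rep Y x \<bullet> b) has_derivative (\<lambda>u. fderiv (rep Y) x u \<bullet> b)) (at x)"
      by (rule bounded_linear.has_derivative[OF bounded_linear_inner_left rep_has_derivative[OF Y x]])
    then have "((\<lambda>x. Y (inv\<phi> x) (coord_fun b)) has_derivative (\<lambda>u. fderiv (rep Y) x u \<bullet> b)) (at x)"
      by (simp add: rep_def coords_component[OF b])
    then show ?thesis
      using vector_field_apply[OF X x vector_field_smooth[OF Y]] has_derivative_imp_frechet by metis
  qed
  show ?thesis
    unfolding rep_def[of "lie_bracket X Y"]
    by (rule coords_eqI) (simp add: lie_bracket_def *[OF X Y] *[OF Y X] inner_diff_left)
qed

end

context smooth_manifold
begin

lemma chart_around:
  obtains U \<phi> r where "manifold_chart A U \<phi> p r"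
proof -
  obtain U \<phi> where U: "(U, \<phi>) \<in> A" "p \<in> U" by (rule chart_cover)
  have "\<phi> p \<in> \<phi> ` U" using U by blast
  then obtain s where s: "s > 0" "cball (\<phi> p) s \<subseteq> \<phi> ` U"
    using chart_image_open[OF U(1)] open_contains_cball by blast
  have "manifold_chart A U \<phi> p (s / 2)"
    by unfold_locales (use U s in auto)
  then show ?thesis by (rule that)
qed

end

section \<open>Forms and metrics in coordinates\<close>

lemma linear_combinationI:
  assumes "\<And>a b u w. f (a *\<^sub>R u + b *\<^sub>R w) = a *\<^sub>R f u + b *\<^sub>R f w"
  shows "linear f"
  using assms[of 1 _ 1] assms[of _ _ 0] by (intro linearI) simp_all

lemma linear_basis_expansion:
  fixes f :: "'e::euclidean_space \<Rightarrow> 'b::real_vector"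
  assumes "linear f" shows "f u = (\<Sum>b\<in>Basis. (u \<bullet> b) *\<^sub>R f b)"
proof -
  have "f u = f (\<Sum>b\<in>Basis. (u \<bullet> b) *\<^sub>R b)" by (simp add: euclidean_representation)
  then show ?thesis using assms by (simp add: linear_sum linear_cmul)
qed

context manifold_chart
begin

definition form_comp :: "'m form \<Rightarrow> 'e \<Rightarrow> 'e \<Rightarrow> real" where
  "form_comp \<alpha> u x = \<alpha> (inv\<phi> x) (coord_field u (inv\<phi> x))"

text \<open>The value of d\<alpha> at the centre on constant coordinate fields u and w, in the
  convention without a factor 1/2: the u-derivative of \<alpha>(w) minus the w-derivative of
  \<alpha>(u).\<close>

definition form_d :: "'m form \<Rightarrow> 'e \<Rightarrow> 'e \<Rightarrow> real" where
  "form_d \<alpha> u w = (\<Sum>b\<in>Basis. (w \<bullet> b) * fderiv (form_comp \<alpha> b) (\<phi> p) u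
     - (u \<bullet> b) * fderiv (form_comp \<alpha> b) (\<phi> p) w)"

lemma covector_linear:
  assumes "\<beta> \<in> cotangent_space A q" "q \<in> N"
  shows "linear (\<lambda>u. \<beta> (tangent_of q u))"
proof -
  have *: "\<beta> (tangent_of q (a *\<^sub>R u + b *\<^sub>R w)) = a * \<beta> (tangent_of q u) + b * \<beta> (tangent_of q w)" for a b u w
    using assms tangent_of_tangent[OF N_U[OF assms(2)]]
    by (simp add: tangent_of_lincomb cotangent_space_def)
  show ?thesis by (rule linear_combinationI) (simp only: * real_scaleR_def)
qed

lemma form_comp_smooth: "one_form A \<alpha> \<Longrightarrow> smooth_on (\<phi> ` U) (form_comp \<alpha> u)"
  unfolding form_comp_def[abs_def]
  by (rule in_chart_smooth) (simp add: one_form_def vector_field_coord_field)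

lemma form_comp_B: "x \<in> B \<Longrightarrow> form_comp \<alpha> u x = \<alpha> (inv\<phi> x) (tangent_of (inv\<phi> x) u)"
  by (simp add: form_comp_def coord_field_N)

lemma form_apply:
  assumes "one_form A \<alpha>" "vector_field A X" "x \<in> B"
  shows "\<alpha> (inv\<phi> x) (X (inv\<phi> x)) = (\<Sum>b\<in>Basis. (rep X x \<bullet> b) * form_comp \<alpha> b x)"
proof -
  have "X (inv\<phi> x) = tangent_of (inv\<phi> x) (rep X x)"
    by (simp add: rep_def tangent_of_coords assms(2,3) vector_field_tangent)
  then have "\<alpha> (inv\<phi> x) (X (inv\<phi> x)) = \<alpha> (inv\<phi> x) (tangent_of (inv\<phi> x) (rep X x))" by simp
  also have "\<dots> = (\<Sum>b\<in>Basis. (rep X x \<bullet> b) *\<^sub>R \<alpha> (inv\<phi> x) (tangent_of (inv\<phi> x) b))"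
    by (rule linear_basis_expansion, rule covector_linear) (use assms in \<open>auto simp: one_form_def\<close>)
  finally show ?thesis by (simp add: form_comp_B assms(3))
qed

lemma inv_center: "inv\<phi> (\<phi> p) = p" by (rule inv_\<phi>[OF center])

lemma rep_center: "rep X (\<phi> p) = coords (X p)" by (simp add: rep_def inv_center)

lemma coord_field_center: "v \<in> tangent_space A p \<Longrightarrow> coord_field (coords v) p = v"
  by (simp add: coord_field_N center_N tangent_of_coords)

text \<open>By the product rule X(\<alpha>(Y)) contains \<alpha> of the derivative of Y along X.
  These terms combine to \<alpha> of the bracket and cancel, so what remains depends only on the
  values of X and Y at p.\<close>

lemma exterior_derivative_formula:
  assumes \<alpha>: "one_form A \<alpha>" and X: "vector_field A X" and Y: "vector_field A Y"
  shows "X p (\<lambda>q. \<alpha> q (Y q)) - Y p (\<lambda>q. \<alpha> q (X q)) - \<alpha> p (lie_bracket X Y p)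
    = form_d \<alpha> (coords (X p)) (coords (Y p))"
proof -
  have *: "X p (\<lambda>q. \<alpha> q (Y q)) =
      (\<Sum>b\<in>Basis. (coords (Y p) \<bullet> b) * fderiv (form_comp \<alpha> b) (\<phi> p) (coords (X p))
        + (fderiv (rep Y) (\<phi> p) (coords (X p)) \<bullet> b) * form_comp \<alpha> b (\<phi> p))"
    if X: "vector_field A X" and Y: "vector_field A Y" for X Y
  proof -
    have s: "smooth_fun A (\<lambda>q. \<alpha> q (Y q))" using \<alpha> Y by (simp add: one_form_def)
    let ?D = "\<lambda>u. \<Sum>b\<in>Basis. (rep Y (\<phi> p) \<bullet> b) * fderiv (form_comp \<alpha> b) (\<phi> p) u
        + (fderiv (rep Y) (\<phi> p) u \<bullet> b) * form_comp \<alpha> b (\<phi> p)"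
    have "((\<lambda>x. \<Sum>b\<in>Basis. (rep Y x \<bullet> b) * form_comp \<alpha> b x) has_derivative ?D) (at (\<phi> p))"
    proof (rule has_derivative_sum, rule has_derivative_mult)
      fix b :: 'e
      show "((\<lambda>x. rep Y x \<bullet> b) has_derivative (\<lambda>u. fderiv (rep Y) (\<phi> p) u \<bullet> b)) (at (\<phi> p))"
        by (rule bounded_linear.has_derivative[OF bounded_linear_inner_left rep_has_derivative[OF Y center_B]])
      show "(form_comp \<alpha> b has_derivative fderiv (form_comp \<alpha> b) (\<phi> p)) (at (\<phi> p))"
        by (rule smooth_on_has_derivative[OF form_comp_smooth[OF \<alpha>]]) (use center in simp)
    qed
    then have "((\<lambda>x. \<alpha> (inv\<phi> x) (Y (inv\<phi> x))) has_derivative ?D) (at (\<phi> p))"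
      by (rule has_derivative_transform_within_open[OF _ B_open center_B]) (simp add: form_apply[OF \<alpha> Y])
    then show ?thesis
      using tangent_expand[OF center_N vector_field_tangent[OF X] s]
      by (simp add: has_derivative_imp_frechet rep_center)
  qed
  have "\<alpha> p (lie_bracket X Y p) = (\<Sum>b\<in>Basis. (rep (lie_bracket X Y) (\<phi> p) \<bullet> b) * form_comp \<alpha> b (\<phi> p))"
    using form_apply[OF \<alpha> vector_field_lie_bracket[OF X Y] center_B] by (simp add: inv_center)
  moreover have "rep (lie_bracket X Y) (\<phi> p) = fderiv (rep Y) (\<phi> p) (coords (X p))
      - fderiv (rep X) (\<phi> p) (coords (Y p))"
    using rep_lie_bracket[OF X Y center_B] by (simp only: rep_center)
  ultimately show ?thesis
    unfolding *[OF X Y] *[OF Y X] form_d_def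
    by (simp add: sum_subtractf sum.distrib algebra_simps inner_diff_left)
qed

text \<open>Coordinate fields with the prescribed values at p provide a candidate for the definite
  description, and by the preceding formula all other extensions give the same number.\<close>

lemma ext_deriv_coords:
  assumes \<alpha>: "one_form A \<alpha>" and v: "v \<in> tangent_space A p" and w: "w \<in> tangent_space A p"
  shows "ext_deriv A \<alpha> p v w = form_d \<alpha> (coords v) (coords w)"
  unfolding ext_deriv_def
proof (rule the_equality)
  show "\<exists>X Y. vector_field A X \<and> vector_field A Y \<and> X p = v \<and> Y p = w \<and>
     form_d \<alpha> (coords v) (coords w) = X p (\<lambda>q. \<alpha> q (Y q)) - Y p (\<lambda>q. \<alpha> q (X q)) - \<alpha> p (lie_bracket X Y p)"
    using exterior_derivative_formula[OF \<alpha> vector_field_coord_field vector_field_coord_field, of "coords v" "coords w"]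
    by (intro exI[of _ "coord_field (coords v)"] exI[of _ "coord_field (coords w)"])
       (simp add: vector_field_coord_field coord_field_center v w)
  show "r = form_d \<alpha> (coords v) (coords w)"
    if "\<exists>X Y. vector_field A X \<and> vector_field A Y \<and> X p = v \<and> Y p = w \<and>
     r = X p (\<lambda>q. \<alpha> q (Y q)) - Y p (\<lambda>q. \<alpha> q (X q)) - \<alpha> p (lie_bracket X Y p)" for r
    using that exterior_derivative_formula[OF \<alpha>] by blast
qed

lemma form_d_antisym: "form_d \<alpha> u w = - form_d \<alpha> w u"
  by (simp add: form_d_def sum_negf[symmetric])

lemma form_d_bilinear:
  assumes "one_form A \<alpha>" shows "bilinear (form_d \<alpha>)"
proof -
  have l: "linear (fderiv (form_comp \<alpha> b) (\<phi> p))" for b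
    by (rule linear_frechet_derivative[OF smooth_on_differentiable[OF form_comp_smooth[OF assms]]])
       (use center in simp)
  have "linear (form_d \<alpha> u)" for u
    by (rule linearI)
       (simp_all add: form_d_def linear_add[OF l] linear_cmul[OF l] inner_add_left algebra_simps
         sum.distrib sum_subtractf sum_distrib_left)
  moreover have "(\<lambda>u. form_d \<alpha> u w) = (\<lambda>u. - form_d \<alpha> w u)" for w
    by (rule ext) (rule form_d_antisym)
  ultimately show ?thesis
    unfolding bilinear_def by (simp add: linear_compose_neg)
qed

section \<open>The metric and the Killing equation in a chart\<close>

definition metric_comp :: "('m \<Rightarrow> 'm tangent \<Rightarrow> 'm tangent \<Rightarrow> real) \<Rightarrow> 'e \<Rightarrow> 'e \<Rightarrow> 'e \<Rightarrow> real" where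
  "metric_comp g u w x = g (inv\<phi> x) (coord_field u (inv\<phi> x)) (coord_field w (inv\<phi> x))"

lemma metric_comp_smooth: "riemannian_metric A g \<Longrightarrow> smooth_on (\<phi> ` U) (metric_comp g u w)"
  unfolding metric_comp_def[abs_def]
  by (rule in_chart_smooth) (simp add: riemannian_metric_def vector_field_coord_field)

lemma metric_comp_B: "x \<in> B \<Longrightarrow> metric_comp g u w x = g (inv\<phi> x) (tangent_of (inv\<phi> x) u) (tangent_of (inv\<phi> x) w)"
  by (simp add: metric_comp_def coord_field_N)

lemma metric_comp_sym:
  assumes "riemannian_metric A g" "x \<in> B" shows "metric_comp g u w x = metric_comp g w u x"
  unfolding metric_comp_B[OF assms(2)]
  using assms(1) tangent_of_tangent[OF inv_B_U[OF assms(2)]] unfolding riemannian_metric_def by blast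

lemma metric_comp_linear:
  assumes g: "riemannian_metric A g" and x: "x \<in> B" shows "linear (\<lambda>u. metric_comp g u w x)"
proof -
  have *: "metric_comp g (a *\<^sub>R u + b *\<^sub>R v) w x = a * metric_comp g u w x + b * metric_comp g v w x" for a b u v
    unfolding metric_comp_B[OF x] tangent_of_lincomb[OF inv_B_N[OF x]]
    using g tangent_of_tangent[OF inv_B_U[OF x]] unfolding riemannian_metric_def by blast
  show ?thesis by (rule linear_combinationI) (simp only: * real_scaleR_def)
qed

lemma metric_comp_pos:
  assumes g: "riemannian_metric A g" and x: "x \<in> B" and "u \<noteq> 0" shows "metric_comp g u u x > 0"
proof -
  have "tangent_of (inv\<phi> x) u \<noteq> zero_tangent"
    using coords_tangent_of[OF inv_B_N[OF x], of u] coords_zero assms(3) by auto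
  then show ?thesis
    unfolding metric_comp_B[OF x]
    using g tangent_of_tangent[OF inv_B_U[OF x]] unfolding riemannian_metric_def by blast
qed

lemma metric_apply:
  assumes "x \<in> B" "v \<in> tangent_space A (inv\<phi> x)" "w \<in> tangent_space A (inv\<phi> x)"
  shows "g (inv\<phi> x) v w = metric_comp g (coords v) (coords w) x"
  unfolding metric_comp_B[OF assms(1)] using assms by (simp add: tangent_of_coords)

text \<open>The equation is tested on coordinate fields, whose representatives are constant near x.
  Their brackets with Z are then -DZ(u) and -DZ(w), and moving these terms to the left makes all
  signs positive.\<close>

lemma killing_in_chart:
  assumes g: "riemannian_metric A g" and K: "killing_field A g Z" and x: "x \<in> B"
  shows "fderiv (metric_comp g u w) x (rep Z x)
    + metric_comp g (fderiv (rep Z) x u) w x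
    + metric_comp g u (fderiv (rep Z) x w) x = 0"
proof -
  have Z: "vector_field A Z" using K by (simp add: killing_field_def)
  have s: "smooth_fun A (\<lambda>q. g q (coord_field u q) (coord_field w q))"
    using g by (simp add: riemannian_metric_def vector_field_coord_field)
  have br: "coords (lie_bracket Z (coord_field u) (inv\<phi> x)) = - fderiv (rep Z) x u" for u
  proof -
    have "((\<lambda>y. u) has_derivative (\<lambda>h. 0)) (at x)" by simp
    then have "(rep (coord_field u) has_derivative (\<lambda>h. 0)) (at x)"
      by (rule has_derivative_transform_within_open[OF _ B_open x]) (simp add: rep_coord_field)
    then show ?thesis
      using rep_lie_bracket[OF Z vector_field_coord_field x, of u]
      by (simp add: rep_coord_field[OF x] has_derivative_imp_frechet rep_def[of "lie_bracket _ _"])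
  qed
  note t = vector_field_tangent[OF vector_field_lie_bracket[OF Z vector_field_coord_field]]
    vector_field_tangent[OF vector_field_coord_field]
  have c: "coords (coord_field u (inv\<phi> x)) = u" for u using rep_coord_field[OF x, of u] by (simp add: rep_def)
  have "fderiv (metric_comp g u w) x (rep Z x)
      = Z (inv\<phi> x) (\<lambda>q. g q (coord_field u q) (coord_field w q))"
    using vector_field_apply[OF Z x s] by (simp add: metric_comp_def[abs_def])
  also have "\<dots> = g (inv\<phi> x) (lie_bracket Z (coord_field u) (inv\<phi> x)) (coord_field w (inv\<phi> x))
      + g (inv\<phi> x) (coord_field u (inv\<phi> x)) (lie_bracket Z (coord_field w) (inv\<phi> x))"
    using K vector_field_coord_field unfolding killing_field_def by blast
  also have "\<dots> = metric_comp g (- fderiv (rep Z) x u) w x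
      + metric_comp g u (- fderiv (rep Z) x w) x"
    by (simp add: metric_apply[OF x t(1) t(2)] metric_apply[OF x t(2) t(1)] br c)
  also have "\<dots> = - metric_comp g (fderiv (rep Z) x u) w x
      - metric_comp g u (fderiv (rep Z) x w) x"
    using linear_neg[OF metric_comp_linear[OF g x]] metric_comp_sym[OF g x, of u] by simp
  finally show ?thesis by simp
qed

end

section \<open>Pointwise contact metric algebra\<close>

text \<open>The structure at one point, in coordinates: a, \<omega> and J stand for \<alpha>,
  d\<alpha> and \<Phi>. The vector R is constrained by \<open>J_square\<close> alone; that it is
  null for \<omega> and that a R > 0 are consequences.\<close>

locale contact_metric_algebra =
  fixes a :: "'e::euclidean_space \<Rightarrow> real" and \<omega> G :: "'e \<Rightarrow> 'e \<Rightarrow> real" and J :: "'e \<Rightarrow> 'e" and R :: 'e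
  assumes linear_a: "linear a" and linear_J: "linear J" and bilinear_\<omega>: "bilinear \<omega>"
    and antisym: "\<omega> u w = - \<omega> w u"
    and G_def: "G u w = \<omega> (J u) w + a u * a w"
    and G_sym: "G u w = G w u" and G_pos: "u \<noteq> 0 \<Longrightarrow> G u u > 0"
    and J_square: "J (J u) = - u + a u *\<^sub>R R"
    and a_nonzero: "\<exists>v. a v \<noteq> 0"
    and nondegenerate: "a v = 0 \<Longrightarrow> v \<noteq> 0 \<Longrightarrow> \<exists>w. a w = 0 \<and> \<omega> v w \<noteq> 0"
begin

lemma \<omega>_simps [simp]:
  "\<omega> (u + v) w = \<omega> u w + \<omega> v w" "\<omega> u (v + w) = \<omega> u v + \<omega> u w"
  "\<omega> (u - v) w = \<omega> u w - \<omega> v w" "\<omega> u (v - w) = \<omega> u v - \<omega> u w"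
  "\<omega> (- u) w = - \<omega> u w" "\<omega> u (- w) = - \<omega> u w"
  "\<omega> (c *\<^sub>R u) w = c * \<omega> u w" "\<omega> u (c *\<^sub>R w) = c * \<omega> u w" "\<omega> u u = 0" "\<omega> 0 w = 0" "\<omega> u 0 = 0"
  using bilinear_\<omega> antisym[of u u]
  by (simp_all add: bilinear_ladd bilinear_radd bilinear_lsub bilinear_rsub bilinear_lneg bilinear_rneg bilinear_lmul bilinear_rmul
      bilinear_lzero bilinear_rzero)

lemma a_simps [simp]:
  "a (u + v) = a u + a v" "a (u - v) = a u - a v" "a (- u) = - a u" "a (c *\<^sub>R u) = c * a u" "a 0 = 0"
  using linear_a by (simp_all add: linear_add linear_diff linear_neg linear_cmul linear_0)

lemma J_simps [simp]:
  "J (u + v) = J u + J v" "J (u - v) = J u - J v" "J (- u) = - J u" "J (c *\<^sub>R u) = c *\<^sub>R J u" "J 0 = 0"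
  using linear_J by (simp_all add: linear_add linear_diff linear_neg linear_cmul linear_0)

text \<open>Symmetry of G on J u and w; the products of values of a are the same on both sides and
  cancel.\<close>

lemma \<omega>_J: "a u * \<omega> R w - \<omega> u w = \<omega> (J w) (J u)"
  using G_sym[of "J u" w] by (simp add: G_def J_square)

text \<open>Taking w = u in the preceding identity leaves a u * \<omega> R u = 0, which settles
  every u outside ker a. A vector w in ker a is the difference of w + e and e, both outside
  it.\<close>

lemma R_null: "\<omega> R w = 0"
proof -
  have *: "\<omega> R u = 0" if "a u \<noteq> 0" for u
    using \<omega>_J[of u u] that by simp
  obtain e where e: "a e \<noteq> 0" using a_nonzero by blast
  show ?thesis
  proof (cases "a w = 0")
    case True
    then have "\<omega> R (w + e) = 0" by (intro *) (simp add: e)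
    then show ?thesis using *[OF e] by simp
  qed (rule *)
qed

text \<open>Positivity makes the linear map with components G u b injective, hence surjective in
  finite dimension.\<close>

lemma riesz: obtains v where "\<And>w. G v w = a w"
proof -
  have lG: "linear (\<lambda>u. G u w)" "linear (\<lambda>w. G u w)" for u w
    by (rule linearI; simp add: G_def algebra_simps)+
  let ?f = "\<lambda>u. \<Sum>b\<in>Basis. G u b *\<^sub>R b"
  have lf: "linear ?f"
    by (intro linear_compose_sum ballI linearI) (simp_all add: linear_add[OF lG(1)] linear_cmul[OF lG(1)] algebra_simps)
  have fb: "?f u \<bullet> b = G u b" if "b \<in> Basis" for u b
    using that by (simp add: inner_sum_left inner_Basis if_distrib cong: if_cong)
  have "u = 0" if u: "?f u = 0" for u
  proof (rule ccontr)
    assume "u \<noteq> 0"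
    have "G u b = 0" if "b \<in> Basis" for b using fb[OF that, of u] u by simp
    then have "G u u = 0" using linear_basis_expansion[OF lG(2), of u u] by simp
    then show False using G_pos[OF \<open>u \<noteq> 0\<close>] by simp
  qed
  then have "inj ?f" using linear_injective_0[OF lf] by blast
  then have "surj ?f" using linear_injective_imp_surjective[OF lf] by simp
  then have "(\<Sum>b\<in>Basis. a b *\<^sub>R b) \<in> range ?f" by simp
  then obtain v where v: "(\<Sum>b\<in>Basis. a b *\<^sub>R b) = ?f v" by (rule rangeE)
  have "G v b = a b" if "b \<in> Basis" for b
    using fb[OF that, of v] that unfolding v[symmetric] by (simp add: inner_sum_left inner_Basis if_distrib cong: if_cong)
  then have "(\<Sum>b\<in>Basis. (w \<bullet> b) *\<^sub>R G v b) = (\<Sum>b\<in>Basis. (w \<bullet> b) *\<^sub>R a b)" for w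
    by simp
  then have "G v w = a w" for w
    unfolding linear_basis_expansion[OF lG(2), of v w] linear_basis_expansion[OF linear_a, of w] .
  then show ?thesis by (rule that)
qed

text \<open>If \<open>R\<close> vanished, \<open>J\<close> would be a complex structure preserving \<open>\<omega>\<close>. The \<open>G\<close>-dual \<open>v\<close> of \<open>a\<close> then
  either spans a \<open>J\<close>-invariant real line or makes \<open>J v \<in> ker a\<close> a null vector of \<open>\<omega>\<close>.\<close>

lemma R_nonzero: "R \<noteq> 0"
proof
  assume R: "R = 0"
  have JJ: "J (J u) = - u" for u using J_square R by simp
  have \<omega>J: "\<omega> (J u) (J w) = \<omega> u w" for u w using \<omega>_J[of w u] R antisym[of u w] by simp
  obtain v where v: "\<And>w. G v w = a w" by (rule riesz) blast
  obtain e where e: "a e \<noteq> 0" using a_nonzero by blast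
  have v0: "v \<noteq> 0" using v[of e] e by (auto simp: G_def)
  have eq: "\<omega> (J v) w = (1 - a v) * a w" for w using v[of w] by (simp add: G_def algebra_simps)
  have Jv: "J v \<noteq> 0" using JJ[of v] v0 by auto
  show False
  proof (cases "a v = 1")
    case True
    \<comment> \<open>Both v and J v are null for \<omega> here, and c makes a vanish on J v - c v.
      So this vector has G-length 0, and v would be a real eigenvector of J with c^2 = -1.\<close>
    define c where "c = a (J v)"
    have "\<omega> v w = 0" for w using \<omega>J[of v w] eq[of "J w"] True by simp
    then have "G (J v - c *\<^sub>R v) (J v - c *\<^sub>R v) = 0"
      using True eq by (simp add: G_def JJ c_def algebra_simps)
    then have "J v = c *\<^sub>R v" using G_pos[of "J v - c *\<^sub>R v"] by force
    then have "J (J v) = (c * c) *\<^sub>R v" by simp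
    then have "(c * c + 1) *\<^sub>R v = 0" using JJ[of v] by (simp add: scaleR_add_left flip: \<open>J (J v) = (c * c) *\<^sub>R v\<close>)
    moreover have "c * c + 1 > 0" by (simp add: add_nonneg_pos)
    ultimately show False using v0 by auto
  next
    case False
    have "a (J v) = 0" using eq[of "J v"] False by simp
    then obtain w where "a w = 0" "\<omega> (J v) w \<noteq> 0" using nondegenerate Jv by blast
    then show False using eq by simp
  qed
qed

text \<open>J commutes with its square, and comparing the R-terms gives a v J R = a (J v) R. Hence J
  R = c R for some c, and \<open>J_square\<close> at the nonzero vector R yields a R = c^2 +
  1.\<close>

lemma a_R_pos: "a R > 0"
proof -
  obtain v where v: "a v \<noteq> 0" using a_nonzero by blast
  have "J (- v + a v *\<^sub>R R) = - J v + a (J v) *\<^sub>R R" using J_square[of v] J_square[of "J v"] by simp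
  then have "a v *\<^sub>R J R = a (J v) *\<^sub>R R" by simp
  then have "J R = (a (J v) / a v) *\<^sub>R R" using v by (simp add: eq_vector_fraction_iff)
  then obtain c where c: "J R = c *\<^sub>R R" by blast
  then have "(c * c) *\<^sub>R R = - R + a R *\<^sub>R R" using J_square[of R] by simp
  then have "(c * c + 1 - a R) *\<^sub>R R = 0" by (simp add: algebra_simps)
  then have "a R = c * c + 1" using R_nonzero by simp
  then show ?thesis by (simp add: add_nonneg_pos)
qed

text \<open>An isotropic subspace \<open>E\<close> of \<open>ker a\<close> is orthogonal to \<open>J E\<close>, so \<open>2 dim E \<le> dim\<close>.\<close>

lemma isotropic_not_injective:
  fixes f :: "'w::euclidean_space \<Rightarrow> 'e"
  assumes f: "linear f" and iso: "\<And>w w'. \<omega> (f w) (f w') = 0"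
    and dim: "DIM('w) = n + 1" "DIM('e) < 2 * n"
  obtains w where "w \<noteq> 0" "f w = 0"
proof (rule ccontr)
  assume no: "\<not> thesis"
  then have "inj f" using linear_injective_0[OF f] that by blast
  then have dW: "dim (range f) = n + 1"
    using dim_image_eq[OF f, of UNIV] dim(1) by simp
  have sW: "subspace (range f)" using f by (simp add: linear_subspace_image)
  define E where "E = {u \<in> range f. a u = 0}"
  have sE: "subspace E"
    using sW by (auto simp: E_def subspace_def)
  \<comment> \<open>Intersecting the (n + 1)-dimensional range with ker a loses at most one
    dimension.\<close>
  have dE: "n \<le> dim E"
  proof (cases "\<exists>e\<in>range f. a e \<noteq> 0")
    case True
    then obtain e where e: "e \<in> range f" "a e \<noteq> 0" by blast
    have "range f \<subseteq> span (insert e E)"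
    proof
      fix u assume u: "u \<in> range f"
      have "u - (a u / a e) *\<^sub>R e \<in> E"
        using u e subspace_diff[OF sW u subspace_scale[OF sW e(1)]]
        by (simp add: E_def)
      then show "u \<in> span (insert e E)"
        unfolding span_insert by (blast intro: span_base)
    qed
    then have "dim (range f) \<le> dim (insert e E)" using dim_subset[of "range f" "span (insert e E)"] by simp
    also have "\<dots> \<le> dim E + 1" by (simp add: dim_insert)
    finally show ?thesis using dW by simp
  next
    case False
    then have "E = range f" by (auto simp: E_def)
    then show ?thesis using dW by simp
  qed
  have JJ: "J (J u) = - u" if "u \<in> E" for u using that J_square[of u] by (simp add: E_def)
  have "inj_on J (span E)"
  proof (rule inj_onI)
    fix u w assume uw: "u \<in> span E" "w \<in> span E" "J u = J w"
    have "span E = E" using sE by (rule span_eq_iff[THEN iffD2])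
    with uw(1,2) have "u \<in> E" "w \<in> E" by auto
    then have "- u = - w" using arg_cong[OF uw(3), of J] unfolding JJ[OF \<open>u \<in> E\<close>] JJ[OF \<open>w \<in> E\<close>] by blast
    then show "u = w" by simp
  qed
  then have dJ: "dim (J ` E) = dim E" by (rule dim_image_eq[OF linear_J])
  have "E \<inter> J ` E \<subseteq> {0}"
  proof
    fix y assume "y \<in> E \<inter> J ` E"
    then obtain u where u: "u \<in> E" "y = J u" "y \<in> E" by blast
    \<comment> \<open>For y = J u with u and y in E, J y = - u and a y = 0, so G y y = - \<omega> u
      y, which isotropy makes 0.\<close>
    have "\<omega> u y = 0" using u iso unfolding E_def by fastforce
    then have "G y y = 0" using u JJ[OF u(1)] by (simp add: G_def E_def)
    then show "y \<in> {0}" using G_pos[of y] by fastforce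
  qed
  then have i: "dim (E \<inter> J ` E) = 0" by (simp add: dim_eq_0)
  have "dim {x + y |x y. x \<in> E \<and> y \<in> J ` E} + dim (E \<inter> J ` E) = dim E + dim (J ` E)"
    by (rule dim_sums_Int[OF sE linear_subspace_image[OF linear_J sE]])
  then have "2 * n \<le> dim {x + y |x y. x \<in> E \<and> y \<in> J ` E}" using i dJ dE by simp
  also have "\<dots> \<le> DIM('e)" by (rule dim_subset_UNIV)
  finally show False using dim(2) by simp
qed

end

section \<open>Rigidity of Killing fields\<close>

lemma second_derivative_symmetric_vec:
  fixes f :: "'a::real_normed_vector \<Rightarrow> 'e::euclidean_space"
  assumes S: "smooth_on S f" "open S" "x \<in> S"
  shows "fderiv (\<lambda>y. fderiv f y u) x v
       = fderiv (\<lambda>y. fderiv f y v) x u"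
proof (rule euclidean_eqI)
  fix b :: 'e assume "b \<in> Basis"
  have sb: "smooth_on S (\<lambda>y. f y \<bullet> b)"
    by (rule smooth_on_linear_compose[OF S(2) bounded_linear_inner_left S(1)])
  have *: "fderiv (\<lambda>y. f y \<bullet> b) y w = fderiv f y w \<bullet> b"
    if "smooth_on S f" "y \<in> S" for f :: "'a \<Rightarrow> 'e" and y w
    by (rule has_derivative_imp_frechet,
        rule bounded_linear.has_derivative[OF bounded_linear_inner_left smooth_on_has_derivative[OF that]])
  have **: "fderiv (\<lambda>y. fderiv (\<lambda>y. f y \<bullet> b) y w) x w'
      = fderiv (\<lambda>y. fderiv f y w) x w' \<bullet> b" for w w'
  proof -
    have "fderiv (\<lambda>y. fderiv (\<lambda>y. f y \<bullet> b) y w) x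
      = fderiv (\<lambda>y. fderiv f y w \<bullet> b) x"
      by (rule frechet_derivative_cong_open[OF S(2,3)]) (rule *[OF S(1)])
    then show ?thesis by (simp only: *[OF smooth_on_frechet[OF S(1)] S(3)])
  qed
  show "fderiv (\<lambda>y. fderiv f y u) x v \<bullet> b
       = fderiv (\<lambda>y. fderiv f y v) x u \<bullet> b"
    using second_derivative_symmetric[OF sb S(2,3), of u v] unfolding ** .
qed

section \<open>Bounds from compactness and the mean value inequality\<close>

lemma finite_family_bounded:
  fixes f :: "'i \<Rightarrow> 'a::metric_space \<Rightarrow> real"
  assumes "finite I" "compact K" "\<And>i. i \<in> I \<Longrightarrow> continuous_on K (f i)"
  obtains C where "C \<ge> 0" "\<And>i x. i \<in> I \<Longrightarrow> x \<in> K \<Longrightarrow> \<bar>f i x\<bar> \<le> C"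
proof -
  have "continuous_on K (\<lambda>x. \<Sum>i\<in>I. \<bar>f i x\<bar>)"
    by (intro continuous_on_sum continuous_on_rabs assms(3))
  then have "bounded ((\<lambda>x. \<Sum>i\<in>I. \<bar>f i x\<bar>) ` K)"
    using compact_continuous_image compact_imp_bounded assms(2) by blast
  then obtain C where C: "\<And>x. x \<in> K \<Longrightarrow> \<bar>\<Sum>i\<in>I. \<bar>f i x\<bar>\<bar> \<le> C"
    unfolding bounded_iff by auto
  show ?thesis
  proof (rule that[of "max C 0"])
    fix i x assume "i \<in> I" "x \<in> K"
    then have "\<bar>f i x\<bar> \<le> (\<Sum>i\<in>I. \<bar>f i x\<bar>)" by (intro member_le_sum assms(1)) auto
    then show "\<bar>f i x\<bar> \<le> max C 0" using C[OF \<open>x \<in> K\<close>] by linarith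
  qed simp
qed

lemma norm_derivative_bound:
  fixes f :: "'e::euclidean_space \<Rightarrow> 'b::real_normed_vector"
  assumes "f differentiable (at x)" "\<And>b. b \<in> Basis \<Longrightarrow> norm (fderiv f x b) \<le> L"
  shows "norm (fderiv f x h) \<le> real DIM('e) * L * norm h"
proof -
  have "norm (fderiv f x h) \<le> (\<Sum>b\<in>Basis. norm ((h \<bullet> b) *\<^sub>R fderiv f x b))"
    unfolding frechet_derivative_basis_expansion[OF assms(1), of h] by (rule norm_sum)
  also have "\<dots> \<le> (\<Sum>b\<in>(Basis::'e set). norm h * L)"
    by (rule sum_mono) (auto intro!: mult_mono assms(2) Basis_le_norm)
  finally show ?thesis by (simp add: mult_ac)
qed

lemma norm_bound_from_derivative:
  fixes f :: "'e::euclidean_space \<Rightarrow> 'b::real_normed_vector"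
  assumes d: "\<And>x. x \<in> cball c \<rho> \<Longrightarrow> f differentiable (at x)" and f0: "f c = 0"
    and L: "\<And>x b. x \<in> cball c \<rho> \<Longrightarrow> b \<in> Basis \<Longrightarrow> norm (fderiv f x b) \<le> L" "L \<ge> 0"
    and x: "x \<in> cball c \<rho>"
  shows "norm (f x) \<le> real DIM('e) * L * \<rho>"
proof -
  have c: "c \<in> cball c \<rho>" using x by (auto intro: order_trans[OF zero_le_dist])
  have "norm (f x - f c) \<le> (real DIM('e) * L) * norm (x - c)"
  proof (rule differentiable_bound[OF convex_cball _ _ x c])
    fix y assume y: "y \<in> cball c \<rho>"
    show "(f has_derivative fderiv f y) (at y within cball c \<rho>)"
      using d[OF y] frechet_derivative_works has_derivative_at_withinI by blast
    show "onorm (fderiv f y) \<le> real DIM('e) * L"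
      by (rule onorm_le) (rule norm_derivative_bound[OF d[OF y] L(1)[OF y]])
  qed
  also have "\<dots> \<le> (real DIM('e) * L) * \<rho>"
    by (rule mult_left_mono) (use x L(2) in \<open>auto simp: dist_norm norm_minus_commute\<close>)
  finally show ?thesis using f0 by simp
qed

text \<open>Only the coefficients are assumed continuous in x; joint continuity in (x, u) comes from
  the basis expansion. The constant is the minimum over K times the unit sphere, and homogeneity of
  degree 2 extends the bound to all u.\<close>

lemma quadratic_form_lower_bound:
  fixes G :: "'e::euclidean_space \<Rightarrow> 'e \<Rightarrow> 'a::metric_space \<Rightarrow> real"
  assumes K: "compact K" and cont: "\<And>u w. continuous_on K (G u w)"
    and lin: "\<And>x w. x \<in> K \<Longrightarrow> linear (\<lambda>u. G u w x)" and lin2: "\<And>x u. x \<in> K \<Longrightarrow> linear (\<lambda>w. G u w x)"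
    and pos: "\<And>x u. x \<in> K \<Longrightarrow> u \<noteq> 0 \<Longrightarrow> G u u x > 0"
  obtains c where "c > 0" "\<And>x u. x \<in> K \<Longrightarrow> G u u x \<ge> c * (norm u)\<^sup>2"
proof (cases "K = {}")
  case True
  then show ?thesis using that[of 1] by simp
next
  case False
  let ?Q = "\<lambda>z. \<Sum>b\<in>Basis. \<Sum>b'\<in>Basis. (snd z \<bullet> b) * ((snd z \<bullet> b') * G b b' (fst z))"
  have Q: "G u u x = ?Q (x, u)" if "x \<in> K" for x u
  proof -
    have "G u u x = (\<Sum>b\<in>Basis. (u \<bullet> b) *\<^sub>R G b u x)" by (rule linear_basis_expansion[OF lin[OF that]])
    also have "\<dots> = (\<Sum>b\<in>Basis. (u \<bullet> b) *\<^sub>R (\<Sum>b'\<in>Basis. (u \<bullet> b') *\<^sub>R G b b' x))"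
      by (subst linear_basis_expansion[OF lin2[OF that]]) (rule refl)
    finally show ?thesis by (simp add: sum_distrib_left)
  qed
  have "continuous_on (K \<times> sphere 0 1) ?Q"
    by (intro continuous_on_sum continuous_on_mult continuous_on_inner continuous_on_const
        continuous_on_snd continuous_on_id continuous_on_compose2[OF cont continuous_on_fst[OF continuous_on_id]]) auto
  moreover have "compact (K \<times> sphere (0::'e) 1)" using K by (simp add: compact_Times)
  moreover have "K \<times> sphere (0::'e) 1 \<noteq> {}" using False by simp
  ultimately obtain z where z: "z \<in> K \<times> sphere 0 1" "\<And>y. y \<in> K \<times> sphere 0 1 \<Longrightarrow> ?Q z \<le> ?Q y"
    using continuous_attains_inf[of "K \<times> sphere 0 1" ?Q] by blast
  have zp: "fst z \<in> K" "snd z \<noteq> 0" using z(1) by auto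
  show ?thesis
  proof (rule that[of "?Q z"])
    show "?Q z > 0" using pos[OF zp] Q[OF zp(1), of "snd z"] by simp
    show "G u u x \<ge> ?Q z * (norm u)\<^sup>2" if x: "x \<in> K" for x u
    proof (cases "u = 0")
      case True
      then show ?thesis using linear_0[OF lin[OF x]] by simp
    next
      case False
      define w where "w = (1 / norm u) *\<^sub>R u"
      have w: "norm w = 1" "u = norm u *\<^sub>R w" using False by (auto simp: w_def)
      have "G u u x = norm u * (norm u * G w w x)"
        by (subst (1 2) w(2)) (simp add: linear_cmul[OF lin[OF x]] linear_cmul[OF lin2[OF x]])
      moreover have "?Q z \<le> G w w x" unfolding Q[OF x] by (rule z(2)) (use x w in simp)
      ultimately show ?thesis using mult_left_mono[of "?Q z" "G w w x" "(norm u)\<^sup>2"]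
        by (simp add: power2_eq_square mult_ac)
    qed
  qed
qed

text \<open>Differentiating the Killing equation expresses the second derivatives of \<open>Z\<close> through its
  1-jet \<open>(Z, DZ)\<close>. If the 1-jet vanishes at \<open>c\<close>, its supremum over a small ball is at most half of
  itself.\<close>

locale killing_on_ball =
  fixes c :: "'e::euclidean_space" and r :: real and Z :: "'e \<Rightarrow> 'e" and G :: "'e \<Rightarrow> 'e \<Rightarrow> 'e \<Rightarrow> real"
  assumes r: "r > 0" and Z: "smooth_on (ball c r) Z" and G: "\<And>u w. smooth_on (ball c r) (G u w)"
    and lin: "\<And>x w. x \<in> ball c r \<Longrightarrow> linear (\<lambda>u. G u w x)"
    and sym: "\<And>x u w. x \<in> ball c r \<Longrightarrow> G u w x = G w u x"
    and pos: "\<And>x u. x \<in> ball c r \<Longrightarrow> u \<noteq> 0 \<Longrightarrow> G u u x > 0"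
    and killing: "\<And>x u w. x \<in> ball c r \<Longrightarrow> fderiv (G u w) x (Z x)
      + G (fderiv Z x u) w x + G u (fderiv Z x w) x = 0"
begin

definition D1 :: "'e \<Rightarrow> 'e \<Rightarrow> 'e" where
  "D1 u x = fderiv Z x u"

definition D2 :: "'e \<Rightarrow> 'e \<Rightarrow> 'e \<Rightarrow> 'e" where
  "D2 v u x = fderiv (D1 u) x v"

definition jet :: "'e \<Rightarrow> real" where
  "jet x = norm (Z x) + (\<Sum>b\<in>Basis. norm (D1 b x))"

lemma lin2: "x \<in> ball c r \<Longrightarrow> linear (\<lambda>w. G u w x)"
  using lin[of x u] sym[of x u] by simp

lemma D1_smooth: "smooth_on (ball c r) (D1 u)"
  unfolding D1_def[abs_def] by (rule smooth_on_frechet[OF Z])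

lemma D2_sym: "x \<in> ball c r \<Longrightarrow> D2 v u x = D2 u v x"
  unfolding D2_def D1_def[abs_def] by (rule second_derivative_symmetric_vec[OF Z open_ball])

lemma jet_bounds: "norm (Z x) \<le> jet x" "b \<in> Basis \<Longrightarrow> norm (D1 b x) \<le> jet x" "jet x \<ge> 0"
proof -
  have s: "(\<Sum>b\<in>Basis. norm (D1 b x)) \<ge> 0" by (rule sum_nonneg) simp
  then show "norm (Z x) \<le> jet x" "jet x \<ge> 0" unfolding jet_def by (auto intro: add_nonneg_nonneg)
  assume "b \<in> Basis"
  then have "norm (D1 b x) \<le> (\<Sum>b\<in>Basis. norm (D1 b x))" by (intro member_le_sum) auto
  then show "norm (D1 b x) \<le> jet x" unfolding jet_def using norm_ge_zero[of "Z x"] by linarith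
qed

text \<open>The expansion replaces the moving vectors in the arguments of G by constant ones. The
  equation becomes a sum of products of scalar functions and can be differentiated term by
  term.\<close>

lemma killing_components:
  assumes x: "x \<in> ball c r"
  shows "(\<Sum>b\<in>Basis. (Z x \<bullet> b) * fderiv (G u w) x b
    + (D1 u x \<bullet> b) * G b w x + (D1 w x \<bullet> b) * G b u x) = 0"
proof -
  have "fderiv (G u w) x (Z x) = (\<Sum>b\<in>Basis. (Z x \<bullet> b) * fderiv (G u w) x b)"
    using frechet_derivative_basis_expansion[OF smooth_on_differentiable[OF G x], of _ _ "Z x"] by simp
  moreover have "G (D1 u x) w x = (\<Sum>b\<in>Basis. (D1 u x \<bullet> b) * G b w x)" for u w
    using linear_basis_expansion[OF lin[OF x, of w], of "D1 u x"] by simp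
  ultimately show ?thesis
    using killing[OF x, of u w] sym[OF x, of u "D1 w x"] by (simp add: D1_def sum.distrib)
qed

lemma killing_differentiated:
  assumes x: "x \<in> ball c r"
  shows "(\<Sum>b\<in>Basis. ((Z x \<bullet> b) * fderiv (\<lambda>y. fderiv (G u w) y b) x v
      + (D1 v x \<bullet> b) * fderiv (G u w) x b)
    + ((D1 u x \<bullet> b) * fderiv (G b w) x v + (D2 v u x \<bullet> b) * G b w x)
    + ((D1 w x \<bullet> b) * fderiv (G b u) x v + (D2 v w x \<bullet> b) * G b u x)) = 0"
proof -
  let ?F = "\<lambda>x. \<Sum>b\<in>Basis. (Z x \<bullet> b) * fderiv (G u w) x b
    + (D1 u x \<bullet> b) * G b w x + (D1 w x \<bullet> b) * G b u x"
  have i: "((\<lambda>x. f x \<bullet> b) has_derivative (\<lambda>v. fderiv f x v \<bullet> b)) (at x)"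
    if "smooth_on (ball c r) f" for f :: "'e \<Rightarrow> 'e" and b
    by (rule bounded_linear.has_derivative[OF bounded_linear_inner_left smooth_on_has_derivative[OF that x]])
  have "(?F has_derivative (\<lambda>v. \<Sum>b\<in>Basis.
      ((Z x \<bullet> b) * fderiv (\<lambda>y. fderiv (G u w) y b) x v
        + (fderiv Z x v \<bullet> b) * fderiv (G u w) x b)
      + ((D1 u x \<bullet> b) * fderiv (G b w) x v + (fderiv (D1 u) x v \<bullet> b) * G b w x)
      + ((D1 w x \<bullet> b) * fderiv (G b u) x v + (fderiv (D1 w) x v \<bullet> b) * G b u x))) (at x)"
    by (rule has_derivative_sum, rule has_derivative_add, rule has_derivative_add)
       (rule has_derivative_mult, rule i, rule Z D1_smooth,
        rule smooth_on_has_derivative[OF _ x], rule G smooth_on_frechet[OF G])+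
  moreover have "(?F has_derivative (\<lambda>v. 0)) (at x)"
    by (rule has_derivative_transform_within_open[OF has_derivative_const open_ball x])
       (simp only: killing_components)
  ultimately show ?thesis
    unfolding D2_def D1_def[of v] by (rule has_derivative_unique[THEN fun_cong])
qed

text \<open>The differentiated Killing equation bounds the symmetrisation of G (D2 v u) w in u and
  w. Since D2 is itself symmetric in its two directions, this determines the whole tensor. The
  smaller closed ball is compact, so all coefficients are bounded.\<close>

lemma second_derivative_bound:
  obtains C where "C \<ge> 0"
    "\<And>x u v. x \<in> cball c (r / 2) \<Longrightarrow> u \<in> Basis \<Longrightarrow> v \<in> Basis \<Longrightarrow> norm (D2 v u x) \<le> C * jet x"
proof -
  let ?K = "cball c (r / 2)"
  have K: "?K \<subseteq> ball c r" using r by auto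
  define N where "N = real DIM('e)"
  have N: "N > 0" by (simp add: N_def)
  obtain C1 where C1: "C1 \<ge> 0"
    "\<And>i x. i \<in> Basis \<times> Basis \<times> Basis \<times> Basis \<Longrightarrow> x \<in> ?K \<Longrightarrow>
      \<bar>(\<lambda>(u, w, b, v) x. fderiv (\<lambda>y. fderiv (G u w) y b) x v) i x\<bar> \<le> C1"
  proof (rule finite_family_bounded[of "Basis \<times> Basis \<times> Basis \<times> Basis" ?K
        "\<lambda>(u, w, b, v) x. fderiv (\<lambda>y. fderiv (G u w) y b) x v"])
    fix i :: "'e \<times> 'e \<times> 'e \<times> 'e"
    show "continuous_on ?K (case i of (u, w, b, v) \<Rightarrow> \<lambda>x. fderiv (\<lambda>y. fderiv (G u w) y b) x v)"
      unfolding split_beta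
      by (rule continuous_on_subset[OF smooth_on_continuous[OF smooth_on_frechet[OF smooth_on_frechet[OF G]]] K])
  qed auto
  obtain C2 where C2: "C2 \<ge> 0"
    "\<And>i x. i \<in> Basis \<times> Basis \<times> Basis \<Longrightarrow> x \<in> ?K \<Longrightarrow>
      \<bar>(\<lambda>(u, w, b) x. fderiv (G u w) x b) i x\<bar> \<le> C2"
  proof (rule finite_family_bounded[of "Basis \<times> Basis \<times> Basis" ?K
        "\<lambda>(u, w, b) x. fderiv (G u w) x b"])
    fix i :: "'e \<times> 'e \<times> 'e"
    show "continuous_on ?K (case i of (u, w, b) \<Rightarrow> \<lambda>x. fderiv (G u w) x b)"
      unfolding split_beta
      by (rule continuous_on_subset[OF smooth_on_continuous[OF smooth_on_frechet[OF G]] K])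
  qed auto
  obtain c0 where c0: "c0 > 0" "\<And>x u. x \<in> ?K \<Longrightarrow> G u u x \<ge> c0 * (norm u)\<^sup>2"
  proof (rule quadratic_form_lower_bound[of ?K G])
    show "continuous_on ?K (G u w)" for u w
      by (rule continuous_on_subset[OF smooth_on_continuous[OF G] K])
    fix x u assume "x \<in> ?K"
    then have x: "x \<in> ball c r" using K by blast
    show "linear (\<lambda>v. G v u x)" by (rule lin[OF x])
    show "linear (\<lambda>w. G u w x)" by (rule lin2[OF x])
    show "u \<noteq> 0 \<Longrightarrow> G u u x > 0" by (rule pos[OF x])
  qed auto
  \<comment> \<open>For each basis vector there is one product of Z with a second derivative of the
    metric, bounded by C1, and there are three products of first derivatives, bounded by C2.\<close>
  define C3 where "C3 = N * (C1 + 3 * C2)"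
  have C3: "C3 \<ge> 0" using N C1 C2 by (simp add: C3_def)
  have E: "\<bar>G (D2 v u x) w x + G (D2 v w x) u x\<bar> \<le> C3 * jet x"
    if x: "x \<in> ?K" and B: "u \<in> Basis" "v \<in> Basis" "w \<in> Basis" for x u v w
  proof -
    have xb: "x \<in> ball c r" using x K by blast
    have G2: "G (D2 v u x) w x = (\<Sum>b\<in>Basis. (D2 v u x \<bullet> b) * G b w x)" for u w
      using linear_basis_expansion[OF lin[OF xb, of w], of "D2 v u x"] by simp
    let ?T = "\<lambda>b. (Z x \<bullet> b) * fderiv (\<lambda>y. fderiv (G u w) y b) x v
      + (D1 v x \<bullet> b) * fderiv (G u w) x b
      + (D1 u x \<bullet> b) * fderiv (G b w) x v
      + (D1 w x \<bullet> b) * fderiv (G b u) x v"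
    have eq: "G (D2 v u x) w x + G (D2 v w x) u x = - (\<Sum>b\<in>Basis. ?T b)"
      using killing_differentiated[OF xb, of u w v] unfolding G2 by (simp add: sum.distrib)
    have "\<bar>G (D2 v u x) w x + G (D2 v w x) u x\<bar> \<le> (\<Sum>b\<in>Basis. \<bar>?T b\<bar>)"
      unfolding eq abs_minus_cancel by (rule sum_abs)
    also have "\<dots> \<le> (\<Sum>b\<in>(Basis::'e set). (C1 + 3 * C2) * jet x)"
    proof (rule sum_mono)
      fix b :: 'e assume b: "b \<in> Basis"
      have ip: "\<bar>y \<bullet> b\<bar> \<le> jet x" if "norm y \<le> jet x" for y
        using Basis_le_norm[OF b, of y] that by linarith
      have m: "\<bar>(y \<bullet> b) * k\<bar> \<le> jet x * C" if "norm y \<le> jet x" "\<bar>k\<bar> \<le> C" for y k C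
        unfolding abs_mult by (rule mult_mono[OF ip[OF that(1)] that(2)]) (auto simp: jet_bounds)
      have "\<bar>?T b\<bar> \<le> jet x * C1 + jet x * C2 + jet x * C2 + jet x * C2"
      proof -
        have 1: "\<bar>(Z x \<bullet> b) * fderiv (\<lambda>y. fderiv (G u w) y b) x v\<bar> \<le> jet x * C1"
          by (rule m) (use C1(2)[of "(u, w, b, v)" x] x B b jet_bounds in auto)
        have 2: "\<bar>(D1 v x \<bullet> b) * fderiv (G u w) x b\<bar> \<le> jet x * C2"
          by (rule m) (use C2(2)[of "(u, w, b)" x] x B b jet_bounds in auto)
        have 3: "\<bar>(D1 u x \<bullet> b) * fderiv (G b w) x v\<bar> \<le> jet x * C2"
          by (rule m) (use C2(2)[of "(b, w, v)" x] x B b jet_bounds in auto)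
        have 4: "\<bar>(D1 w x \<bullet> b) * fderiv (G b u) x v\<bar> \<le> jet x * C2"
          by (rule m) (use C2(2)[of "(b, u, v)" x] x B b jet_bounds in auto)
        show ?thesis using 1 2 3 4 by linarith
      qed
      then show "\<bar>?T b\<bar> \<le> (C1 + 3 * C2) * jet x" by (simp add: algebra_simps)
    qed
    also have "\<dots> = C3 * jet x" by (simp add: C3_def N_def)
    finally show ?thesis .
  qed
  have A: "\<bar>G (D2 v u x) w x\<bar> \<le> 3 / 2 * C3 * jet x"
    if x: "x \<in> ?K" and B: "u \<in> Basis" "v \<in> Basis" "w \<in> Basis" for x u v w
  proof -
    have xb: "x \<in> ball c r" using x K by blast
    \<comment> \<open>The alternating sum familiar from Christoffel symbols: by symmetry of D2 only
      two copies of G (D2 v u) w survive. Three bounds C3, halved, give the factor 3 / 2.\<close>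
    have "2 * G (D2 v u x) w x = (G (D2 v u x) w x + G (D2 v w x) u x)
        + (G (D2 u v x) w x + G (D2 u w x) v x) - (G (D2 w u x) v x + G (D2 w v x) u x)"
      using D2_sym[OF xb, of v w] D2_sym[OF xb, of u w] D2_sym[OF xb, of u v] by simp
    then show ?thesis using E[OF x B] E[OF x B(2,1,3)] E[OF x B(1,3,2)] by linarith
  qed
  show ?thesis
  proof (rule that[of "N * (3 / 2 * C3) / c0"])
    show "N * (3 / 2 * C3) / c0 \<ge> 0" using N C3 c0 by simp
    fix x u v :: 'e assume x: "x \<in> ?K" and B: "u \<in> Basis" "v \<in> Basis"
    have xb: "x \<in> ball c r" using x K by blast
    let ?y = "D2 v u x"
    \<comment> \<open>Pairing \<open>D2 v u\<close> with itself turns the bounds on its pairings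
      with basis vectors into a bound on its norm.\<close>
    have "c0 * (norm ?y)\<^sup>2 \<le> G ?y ?y x" by (rule c0(2)[OF x])
    also have "\<dots> = (\<Sum>w\<in>Basis. (?y \<bullet> w) * G ?y w x)"
      using linear_basis_expansion[OF lin2[OF xb, of ?y], of ?y] by simp
    also have "\<dots> \<le> (\<Sum>w\<in>(Basis::'e set). norm ?y * (3 / 2 * C3 * jet x))"
    proof (rule sum_mono)
      fix w :: 'e assume w: "w \<in> Basis"
      have "(?y \<bullet> w) * G ?y w x \<le> \<bar>?y \<bullet> w\<bar> * \<bar>G ?y w x\<bar>" by (simp flip: abs_mult)
      also have "\<dots> \<le> norm ?y * (3 / 2 * C3 * jet x)"
        by (rule mult_mono[OF Basis_le_norm[OF w] A[OF x B w]]) auto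
      finally show "(?y \<bullet> w) * G ?y w x \<le> norm ?y * (3 / 2 * C3 * jet x)" .
    qed
    also have "\<dots> = norm ?y * (N * (3 / 2 * C3) * jet x)" by (simp add: N_def)
    finally have *: "norm ?y * (c0 * norm ?y) \<le> norm ?y * (N * (3 / 2 * C3) * jet x)"
      by (simp add: power2_eq_square mult_ac)
    show "norm ?y \<le> N * (3 / 2 * C3) / c0 * jet x"
    proof (cases "?y = 0")
      case True
      then show ?thesis using N C3 c0 jet_bounds(3)[of x] by simp
    next
      case False
      then have "c0 * norm ?y \<le> N * (3 / 2 * C3) * jet x" using * by (simp add: mult_le_cancel_left)
      then show ?thesis using c0(1) by (simp add: field_simps)
    qed
  qed
qed

lemma vanishing:
  assumes Z0: "Z c = 0" and D0: "\<And>u. fderiv Z c u = 0"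
  obtains e where "e > 0" "\<And>x. x \<in> ball c e \<Longrightarrow> Z x = 0"
proof -
  obtain C where C: "C \<ge> 0"
    "\<And>x u v. x \<in> cball c (r / 2) \<Longrightarrow> u \<in> Basis \<Longrightarrow> v \<in> Basis \<Longrightarrow> norm (D2 v u x) \<le> C * jet x"
    by (rule second_derivative_bound) (assumption | blast)+
  define N where "N = real DIM('e)"
  have N: "N > 0" by (simp add: N_def)
  \<comment> \<open>By the mean value inequality Z is at most N \<rho>, and each of the N
    derivatives at most N C \<rho>, times the maximal jet. S adds these up, and \<rho> is chosen
    with \<rho> S \<le> 1 / 2.\<close>
  define S where "S = N + N * N * C"
  have S: "S > 0" using N C by (simp add: S_def add_pos_nonneg)
  define \<rho> where "\<rho> = min (r / 2) (1 / (2 * S))"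
  have \<rho>: "\<rho> > 0" "\<rho> \<le> r / 2" "\<rho> * S \<le> 1 / 2"
    using r S by (auto simp: \<rho>_def min_def field_simps)
  let ?K = "cball c \<rho>"
  have K: "?K \<subseteq> cball c (r / 2)" "?K \<subseteq> ball c r" using \<rho> r by auto
  have "continuous_on ?K jet"
    unfolding jet_def[abs_def]
    by (intro continuous_on_add continuous_on_norm continuous_on_sum
        continuous_on_subset[OF smooth_on_continuous[OF Z] K(2)]
        continuous_on_subset[OF smooth_on_continuous[OF D1_smooth] K(2)])
  moreover have "compact ?K" "?K \<noteq> {}" using \<rho>(1) by auto
  ultimately obtain y where y: "y \<in> ?K" "\<And>x. x \<in> ?K \<Longrightarrow> jet x \<le> jet y"
    using continuous_attains_sup[of ?K jet] by blast
  have d: "f differentiable (at x)" if "smooth_on (ball c r) f" "x \<in> ?K" for f :: "'e \<Rightarrow> 'e" and x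
    by (rule smooth_on_differentiable[OF that(1)]) (use that(2) K in blast)
  have 1: "norm (Z y) \<le> N * jet y * \<rho>"
    unfolding N_def
  proof (rule norm_bound_from_derivative[OF d[OF Z] Z0 _ _ y(1)])
    fix x b :: 'e assume "x \<in> ?K" "b \<in> Basis"
    then show "norm (fderiv Z x b) \<le> jet y"
      using jet_bounds(2)[of b x] y(2)[of x] by (simp add: D1_def)
  qed (auto simp: jet_bounds)
  have 2: "norm (D1 u y) \<le> N * (C * jet y) * \<rho>" if u: "u \<in> Basis" for u
    unfolding N_def
  proof (rule norm_bound_from_derivative[OF d[OF D1_smooth] _ _ _ y(1)])
    show "D1 u c = 0" by (simp add: D1_def D0)
    fix x b :: 'e assume xb: "x \<in> ?K" "b \<in> Basis"
    have "norm (D2 b u x) \<le> C * jet x" by (rule C(2)) (use xb K u in auto)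
    also have "\<dots> \<le> C * jet y" by (rule mult_left_mono[OF y(2)[OF xb(1)] C(1)])
    finally show "norm (fderiv (D1 u) x b) \<le> C * jet y" by (simp add: D2_def)
  qed (auto simp: jet_bounds C)
  have "jet y \<le> N * jet y * \<rho> + (\<Sum>b\<in>(Basis::'e set). N * (C * jet y) * \<rho>)"
  proof -
    have "(\<Sum>b\<in>Basis. norm (D1 b y)) \<le> (\<Sum>b\<in>(Basis::'e set). N * (C * jet y) * \<rho>)"
      by (rule sum_mono) (rule 2)
    with 1 show ?thesis using jet_def[of y] by linarith
  qed
  also have "\<dots> = jet y * (\<rho> * S)" by (simp add: S_def N_def algebra_simps)
  also have "\<dots> \<le> jet y * (1 / 2)" by (rule mult_left_mono[OF \<rho>(3)]) (rule jet_bounds)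
  finally have "jet y \<le> 0" by simp
  then have "Z x = 0" if "x \<in> ball c \<rho>" for x
  proof -
    have "x \<in> ?K" using that by simp
    then have "norm (Z x) \<le> 0" using y(2)[of x] jet_bounds(1)[of x] \<open>jet y \<le> 0\<close> by linarith
    then show ?thesis by simp
  qed
  then show ?thesis using that \<rho>(1) by blast
qed

end

section \<open>From a vanishing 1-jet to a vanishing Killing field\<close>

context manifold_chart
begin

lemma killing_vanishes_near_center:
  assumes g: "riemannian_metric A g" and K: "killing_field A g Z"
    and Z0: "Z p = zero_tangent" and D0: "\<And>u. fderiv (rep Z) (\<phi> p) u = 0"
  obtains W where "open W" "p \<in> W" "\<And>q. q \<in> W \<Longrightarrow> Z q = zero_tangent"
proof -
  have vf: "vector_field A Z" using K by (simp add: killing_field_def)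
  interpret killing_on_ball "\<phi> p" r "rep Z" "metric_comp g"
  proof (rule killing_on_ball.intro)
    show "smooth_on (ball (\<phi> p) r) (rep Z)"
      using smooth_on_subset[OF rep_smooth[OF vf] B_subset] by (simp add: B_def)
    show "smooth_on (ball (\<phi> p) r) (metric_comp g u w)" for u w
      using smooth_on_subset[OF metric_comp_smooth[OF g] B_subset] by (simp add: B_def)
    fix x u w assume "x \<in> ball (\<phi> p) r"
    then have x: "x \<in> B" by (simp add: B_def)
    show "linear (\<lambda>u. metric_comp g u w x)" by (rule metric_comp_linear[OF g x])
    show "metric_comp g u w x = metric_comp g w u x" by (rule metric_comp_sym[OF g x])
    show "u \<noteq> 0 \<Longrightarrow> metric_comp g u u x > 0" by (rule metric_comp_pos[OF g x])
    show "fderiv (metric_comp g u w) x (rep Z x)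
      + metric_comp g (fderiv (rep Z) x u) w x
      + metric_comp g u (fderiv (rep Z) x w) x = 0"
      by (rule killing_in_chart[OF g K x])
  qed (rule radius(1))
  have "rep Z (\<phi> p) = 0" by (simp add: rep_center Z0 coords_zero)
  then obtain e where e: "e > 0" "\<And>x. x \<in> ball (\<phi> p) e \<Longrightarrow> rep Z x = 0"
    using vanishing D0 by blast
  let ?T = "ball (\<phi> p) e \<inter> B"
  show ?thesis
  proof (rule that[of "inv\<phi> ` ?T"])
    show "open (inv\<phi> ` ?T)"
      by (rule chart_preimage_of_open[OF chart]) (use B_subset B_open in auto)
    have "\<phi> p \<in> ?T" using e(1) center_B by simp
    then show "p \<in> inv\<phi> ` ?T" using inv_center by (metis imageI)
    fix q assume "q \<in> inv\<phi> ` ?T"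
    then obtain x where x: "x \<in> ball (\<phi> p) e" "x \<in> B" "q = inv\<phi> x" by blast
    then have "coords (Z q) = 0" using e(2)[OF x(1)] by (simp add: rep_def)
    then show "Z q = zero_tangent"
      using x(2,3) tangent_zeroI[OF _ vector_field_tangent[OF vf]] by simp
  qed
qed

text \<open>On the open set S the representative vanishes together with its derivative; both are
  continuous, so both vanish at limit points of S.\<close>

lemma jet_vanishes_at_limit:
  assumes Z: "vector_field A Z" and S: "\<And>q. q \<in> S \<Longrightarrow> Z q = zero_tangent" "open S" and p: "p \<in> closure S"
  shows "Z p = zero_tangent" "fderiv (rep Z) (\<phi> p) u = 0"
proof -
  have van: "f (\<phi> p) = 0" if f: "continuous_on B f" and fS: "\<And>x. x \<in> B \<Longrightarrow> inv\<phi> x \<in> S \<Longrightarrow> f x = 0" for f :: "'e \<Rightarrow> 'e"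
  proof (rule ccontr)
    assume ne: "f (\<phi> p) \<noteq> 0"
    let ?T = "f -` (- {0}) \<inter> B"
    have T: "open ?T" using f B_open by (simp add: continuous_on_open_vimage open_Compl)
    have "\<phi> p \<in> ?T" using ne center_B by simp
    then have "p \<in> inv\<phi> ` ?T" using inv_center by (metis imageI)
    moreover have "open (inv\<phi> ` ?T)"
      by (rule chart_preimage_of_open[OF chart T]) (use B_subset in auto)
    ultimately obtain q where "q \<in> inv\<phi> ` ?T" "q \<in> S"
      using p by (meson IntE closure_iff_nhds_not_empty ex_in_conv subset_refl)
    then show False using fS by auto
  qed
  have repS: "rep Z x = 0" if "inv\<phi> x \<in> S" for x
    using S(1)[OF that] by (simp add: rep_def coords_zero)
  have sB: "smooth_on B (rep Z)" by (rule smooth_on_subset[OF rep_smooth[OF Z] B_subset])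
  have "rep Z (\<phi> p) = 0" by (rule van[OF smooth_on_continuous[OF sB] repS])
  then show "Z p = zero_tangent"
    by (intro tangent_zeroI[OF center_N vector_field_tangent[OF Z]]) (simp add: rep_center)
  show "fderiv (rep Z) (\<phi> p) u = 0"
  proof (rule van[OF smooth_on_continuous[OF smooth_on_frechet[OF sB]]])
    fix x assume x: "x \<in> B" "inv\<phi> x \<in> S"
    let ?T = "\<phi> ` (U \<inter> (N \<inter> S))"
    have T: "open ?T" by (rule chart_image_of_open[OF chart open_Int[OF N_open S(2)]])
    have xT: "x \<in> ?T" using x by (intro image_eqI[where f=\<phi> and x="inv\<phi> x"]) auto
    have "((\<lambda>y. 0) has_derivative (\<lambda>h. 0)) (at x)" by simp
    then have "(rep Z has_derivative (\<lambda>h. 0)) (at x)"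
    proof (rule has_derivative_transform_within_open[OF _ T xT])
      fix y assume "y \<in> ?T"
      then show "0 = rep Z y" using repS[of y] by (auto simp: inv_\<phi>)
    qed
    then show "fderiv (rep Z) x u = 0" by (rule has_derivative_imp_frechet)
  qed
qed

end

context smooth_manifold
begin

text \<open>The interior of the zero set contains p. It is also closed: at a limit point the whole
  1-jet vanishes, and rigidity then makes the field vanish nearby.\<close>

lemma killing_vanishes_globally:
  assumes conn: "connected (UNIV :: 'm set)" and g: "riemannian_metric A g" and K: "killing_field A g Z"
    and chart: "manifold_chart A U \<phi> p r" and Z0: "Z p = zero_tangent"
    and D0: "\<And>u. fderiv (manifold_chart.rep U \<phi> p r Z) (\<phi> p) u = 0"
  shows "Z q = zero_tangent"
proof -
  have Z: "vector_field A Z" using K by (simp add: killing_field_def)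
  define S where "S = \<Union>{W. open W \<and> (\<forall>q\<in>W. Z q = zero_tangent)}"
  have S: "open S" "\<And>q. q \<in> S \<Longrightarrow> Z q = zero_tangent" by (auto simp: S_def)
  have inS: "q \<in> S" if "open W" "q \<in> W" "\<And>q. q \<in> W \<Longrightarrow> Z q = zero_tangent" for q W
    unfolding S_def using that by blast
  have "p \<in> S"
    by (rule manifold_chart.killing_vanishes_near_center[OF chart g K Z0 D0]) (auto intro: inS)
  have "closure S \<subseteq> S"
  proof
    fix q assume q: "q \<in> closure S"
    obtain V \<psi> s where c: "manifold_chart A V \<psi> q s" by (rule chart_around)
    note j = manifold_chart.jet_vanishes_at_limit[OF c Z S(2,1) q]
    show "q \<in> S"
      by (rule manifold_chart.killing_vanishes_near_center[OF c g K j]) (auto intro: inS)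
  qed
  then have "closed S" using closure_subset_eq by blast
  then have "S = UNIV" using conn S(1) \<open>p \<in> S\<close> connected_clopen[of "UNIV :: 'm set"] by auto
  then show ?thesis using S(2) by blast
qed

end

text \<open>The Reeb field enters only through \<open>\<Phi>\<^sup>2 = - id + \<alpha> \<otimes> R\<close>, so the
  definite description behind it is never unfolded.\<close>

locale contact_metric_chart = manifold_chart A U \<phi> p r
  for A :: "('m::t2_space, 'e::euclidean_space) atlas" and U \<phi> p r +
  fixes \<alpha> :: "'m form" and \<Phi> :: "'m \<Rightarrow> 'm tangent \<Rightarrow> 'm tangent"
    and g :: "'m \<Rightarrow> 'm tangent \<Rightarrow> 'm tangent \<Rightarrow> real"
  assumes cms: "contact_metric_structure A \<alpha> \<Phi> g"
    and reeb_tangent: "reeb_field A \<alpha> p \<in> tangent_space A p"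
begin

lemma one_form: "one_form A \<alpha>"
  using cms by (simp add: contact_metric_structure_def contact_form_def)

definition a :: "'e \<Rightarrow> real" where "a u = \<alpha> p (tangent_of p u)"
definition J :: "'e \<Rightarrow> 'e" where "J u = coords (\<Phi> p (tangent_of p u))"
definition G :: "'e \<Rightarrow> 'e \<Rightarrow> real" where "G u w = g p (tangent_of p u) (tangent_of p w)"

lemma tangent: "tangent_of p u \<in> tangent_space A p"
  by (rule tangent_of_tangent[OF center])

lemma a_coords: "v \<in> tangent_space A p \<Longrightarrow> a (coords v) = \<alpha> p v"
  by (simp add: a_def tangent_of_coords center_N)

sublocale contact_metric_algebra a "form_d \<alpha>" G J "coords (reeb_field A \<alpha> p)"
proof (rule contact_metric_algebra.intro)
  have \<Phi>: "\<Phi> p v \<in> tangent_space A p" if "v \<in> tangent_space A p" for v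
    using cms that by (simp add: contact_metric_structure_def tangent_endomorphism_def)
  have \<Phi>_lin: "\<Phi> p (lincomb c v d w) = lincomb c (\<Phi> p v) d (\<Phi> p w)"
    if "v \<in> tangent_space A p" "w \<in> tangent_space A p" for c d v w
    using cms that by (simp add: contact_metric_structure_def tangent_endomorphism_def)
  have g: "riemannian_metric A g" using cms by (simp add: contact_metric_structure_def)
  have Jt: "tangent_of p (J u) = \<Phi> p (tangent_of p u)" for u
    unfolding J_def by (rule tangent_of_coords[OF center_N \<Phi>[OF tangent]])
  show "linear a"
    unfolding a_def[abs_def]
    by (rule covector_linear[OF _ center_N]) (use one_form in \<open>simp add: one_form_def\<close>)
  show "linear J"
  proof -
    have *: "J (c *\<^sub>R u + d *\<^sub>R w) = c *\<^sub>R J u + d *\<^sub>R J w" for c d u w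
      unfolding J_def tangent_of_lincomb[OF center_N] \<Phi>_lin[OF tangent tangent] coords_lincomb ..
    show ?thesis by (rule linear_combinationI) (simp only: * real_scaleR_def)
  qed
  show "bilinear (form_d \<alpha>)" by (rule form_d_bilinear[OF one_form])
  show "form_d \<alpha> u w = - form_d \<alpha> w u" for u w by (rule form_d_antisym)
  have ext: "ext_deriv A \<alpha> p (tangent_of p u) (tangent_of p w) = form_d \<alpha> u w" for u w
    using ext_deriv_coords[OF one_form tangent tangent] by (simp add: coords_tangent_of center_N)
  show "G u w = form_d \<alpha> (J u) w + a u * a w" for u w
    unfolding G_def a_def ext[symmetric] Jt
    using cms tangent unfolding contact_metric_structure_def by blast
  show "G u w = G w u" for u w
    using g tangent unfolding G_def riemannian_metric_def by blast
  show "u \<noteq> 0 \<Longrightarrow> G u u > 0" for u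
    using metric_comp_pos[OF g center_B, of u] metric_comp_B[OF center_B, of g u u]
    by (simp add: G_def inv_center)
  show "J (J u) = - u + a u *\<^sub>R coords (reeb_field A \<alpha> p)" for u
  proof -
    have "\<Phi> p (\<Phi> p (tangent_of p u)) = lincomb (- 1) (tangent_of p u) (a u) (reeb_field A \<alpha> p)"
      using cms tangent unfolding contact_metric_structure_def a_def by blast
    then have "J (J u) = coords (lincomb (- 1) (tangent_of p u) (a u) (reeb_field A \<alpha> p))"
      unfolding J_def[of "J u"] Jt by simp
    then show ?thesis by (simp add: coords_lincomb coords_tangent_of center_N)
  qed
  have cf: "contact_form A \<alpha>" using cms by (simp add: contact_metric_structure_def)
  obtain v where v: "v \<in> tangent_space A p" "\<alpha> p v \<noteq> 0" using cf unfolding contact_form_def by blast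
  then show "\<exists>v. a v \<noteq> 0" by (intro exI[of _ "coords v"]) (simp add: a_coords)
  fix u assume u: "a u = 0" "u \<noteq> 0"
  have "tangent_of p u \<noteq> zero_tangent"
    using coords_tangent_of[OF center_N, of u] coords_zero u(2) by auto
  moreover have "tangent_of p u \<in> kernel_at A \<alpha> p" using u(1) tangent by (simp add: kernel_at_def a_def)
  ultimately obtain w where w: "w \<in> kernel_at A \<alpha> p" "ext_deriv A \<alpha> p (tangent_of p u) w \<noteq> 0"
    using cf unfolding contact_form_def by blast
  have wt: "w \<in> tangent_space A p" "\<alpha> p w = 0" using w(1) by (auto simp: kernel_at_def)
  have "form_d \<alpha> u (coords w) \<noteq> 0"
    using w(2) unfolding ext_deriv_coords[OF one_form tangent wt(1)] by (simp add: coords_tangent_of center_N)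
  then show "\<exists>w. a w = 0 \<and> form_d \<alpha> u w \<noteq> 0" using a_coords[OF wt(1)] wt(2) by auto
qed

lemma \<alpha>_reeb_pos: "\<alpha> p (reeb_field A \<alpha> p) > 0"
  using a_R_pos a_coords[OF reeb_tangent] by simp

end

section \<open>Torus actions\<close>

lemma torus_exp_in_torus: "torus_exp X \<in> torus"
  by (simp add: torus_exp_def torus_def)

lemma torus_exp_add: "torus_exp (X + Y) = torus_exp X * torus_exp Y"
  by (simp add: torus_exp_def vec_eq_iff cis_mult algebra_simps)

lemma torus_exp_0: "torus_exp 0 = 1"
  by (simp add: torus_exp_def vec_eq_iff)

locale torus_action = smooth_manifold A
  for A :: "('m::t2_space, 'e::euclidean_space) atlas" +
  fixes \<rho> :: "complex ^ 'n \<Rightarrow> 'm \<Rightarrow> 'm"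
  assumes bij_\<rho>: "z \<in> torus \<Longrightarrow> bij (\<rho> z)"
    and \<rho>_mult: "z \<in> torus \<Longrightarrow> w \<in> torus \<Longrightarrow> \<rho> (z * w) = \<rho> z \<circ> \<rho> w"
    and \<rho>_smooth: "smooth_map (product_atlas euclidean_atlas A) A (\<lambda>(X, p). \<rho> (torus_exp X) p)"
begin

abbreviation "induced \<equiv> induced_field A \<rho>"

text \<open>The action lifted to the Lie algebra, where products become sums and one can
  differentiate; this is also where its smoothness is assumed.\<close>

definition \<theta> :: "real ^ 'n \<Rightarrow> 'm \<Rightarrow> 'm" where
  "\<theta> X q = \<rho> (torus_exp X) q"

text \<open>\<open>\<rho> 1\<close> is idempotent and bijective.\<close>

lemma \<rho>_1: "\<rho> 1 q = q"
proof -
  have 1: "1 \<in> (torus :: (complex ^ 'n) set)" by (simp add: torus_def)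
  have "\<rho> 1 (\<rho> 1 q) = \<rho> 1 q" using \<rho>_mult[OF 1 1] by (metis comp_apply mult_1)
  then show ?thesis using bij_\<rho>[OF 1] by (metis bij_pointE)
qed

lemma \<theta>_0 [simp]: "\<theta> 0 q = q"
  by (simp add: \<theta>_def torus_exp_0 \<rho>_1)

lemma \<theta>_add: "\<theta> (X + Y) q = \<theta> X (\<theta> Y q)"
  by (simp add: \<theta>_def torus_exp_add \<rho>_mult torus_exp_in_torus)

lemma \<theta>_minus [simp]: "\<theta> X (\<theta> (- X) q) = q"
  using \<theta>_add[of X "- X" q] by simp

lemma \<theta>_continuous: "continuous_on UNIV (\<lambda>z. \<theta> (fst z) (snd z))"
  using \<rho>_smooth by (simp add: smooth_map_def \<theta>_def split_beta)

text \<open>Near a given pair the action is read through a chart around the image point, and f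
  through the same chart. Smoothness is joint in the Lie algebra element and the point, so mixed
  derivatives are available later.\<close>

lemma action_smooth:
  assumes U: "(U, \<phi>) \<in> A" and f: "smooth_fun A f"
  shows "smooth_on (UNIV \<times> \<phi> ` U) (\<lambda>z. f (\<theta> (fst z) (inv_into U \<phi> (snd z))))"
proof (rule smooth_on_local)
  fix z assume z: "z \<in> (UNIV :: (real ^ 'n) set) \<times> \<phi> ` U"
  let ?h = "\<lambda>z. \<theta> (fst z) (inv_into U \<phi> (snd z))"
  let ?D = "(UNIV :: (real ^ 'n) set) \<times> \<phi> ` U"
  obtain V \<psi> where V: "(V, \<psi>) \<in> A" "?h z \<in> V" by (rule chart_cover)
  have D: "open ?D" by (intro open_Times chart_image_open[OF U] open_UNIV)
  have "continuous_on ?D (\<lambda>z. (fst z, inv_into U \<phi> (snd z)))"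
  proof (intro continuous_on_Pair continuous_on_fst continuous_on_id)
    have "continuous_on (\<phi> ` U) (inv_into U \<phi>)"
      using chart_homeomorphism[OF U] by (simp add: homeomorphism_def)
    then show "continuous_on ?D (\<lambda>z. inv_into U \<phi> (snd z))"
      by (rule continuous_on_compose2[OF _ continuous_on_snd[OF continuous_on_id]]) auto
  qed
  then have ch: "continuous_on ?D ?h"
    using continuous_on_compose2[OF \<theta>_continuous, of ?D "\<lambda>z. (fst z, inv_into U \<phi> (snd z))"] by simp
  let ?S = "?h -` V \<inter> ?D"
  have S: "open ?S" using ch D chart_open[OF V(1)] continuous_on_open_vimage by blast
  have inj: "inj_on (map_prod id \<phi>) ((UNIV :: (real ^ 'n) set) \<times> U)"
    using chart_inv[OF U] by (intro inj_onI) (metis (no_types, lifting) SigmaE fst_map_prod id_apply prod.collapse prod.inject snd_map_prod map_prod_simp)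
  have inv: "inv_into (UNIV \<times> U) (map_prod id \<phi>) y = (fst y, inv_into U \<phi> (snd y))" if "y \<in> ?D" for y
  proof (rule inv_into_f_eq[OF inj])
    show "(fst y, inv_into U \<phi> (snd y)) \<in> UNIV \<times> U" using that by (auto simp: chart_inv[OF U])
    show "map_prod id \<phi> (fst y, inv_into U \<phi> (snd y)) = y" using that by (auto simp: f_inv_into_f)
  qed
  have "(UNIV \<times> U, map_prod id \<phi>) \<in> product_atlas euclidean_atlas A"
    unfolding product_atlas_def euclidean_atlas_def using U by blast
  then have "smooth_on (map_prod id \<phi> ` ((UNIV \<times> U) \<inter> (\<lambda>(X, p). \<rho> (torus_exp X) p) -` V))
      (\<psi> \<circ> (\<lambda>(X, p). \<rho> (torus_exp X) p) \<circ> inv_into (UNIV \<times> U) (map_prod id \<phi>))"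
    using \<rho>_smooth V(1) unfolding smooth_map_def by fastforce
  moreover have "?S \<subseteq> map_prod id \<phi> ` ((UNIV \<times> U) \<inter> (\<lambda>(X, p). \<rho> (torus_exp X) p) -` V)"
  proof
    fix y assume y: "y \<in> ?S"
    show "y \<in> map_prod id \<phi> ` ((UNIV \<times> U) \<inter> (\<lambda>(X, p). \<rho> (torus_exp X) p) -` V)"
      by (rule image_eqI[of _ _ "(fst y, inv_into U \<phi> (snd y))"])
         (use y in \<open>auto simp: \<theta>_def chart_inv[OF U]\<close>)
  qed
  ultimately have "smooth_on ?S (\<psi> \<circ> (\<lambda>(X, p). \<rho> (torus_exp X) p) \<circ> inv_into (UNIV \<times> U) (map_prod id \<phi>))"
    by (rule smooth_on_subset)
  then have "smooth_on ?S (\<lambda>y. \<psi> (?h y))"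
    by (rule smooth_on_cong[OF S, rotated]) (simp add: inv \<theta>_def)
  then have "smooth_on ?S (\<lambda>y. f (inv_into V \<psi> (\<psi> (?h y))))"
    by (rule smooth_on_compose[OF S _ smooth_funD[OF f V(1)]]) auto
  then have "smooth_on ?S (\<lambda>y. f (?h y))"
    by (rule smooth_on_cong[OF S, rotated]) (simp add: chart_inv[OF V(1)])
  moreover have "z \<in> ?S" using z V(2) by simp
  ultimately show "\<exists>T. open T \<and> z \<in> T \<and> smooth_on T (\<lambda>z. f (?h z))" using S by blast
qed

lemma smooth_on_slice:
  assumes "smooth_on (UNIV \<times> T) F" "open T"
  shows "smooth_on T (\<lambda>x. F (X :: real ^ 'n, x :: 'e))"
proof (rule smooth_on_compose[OF assms(2) _ assms(1)])
  have "smooth_on T (\<lambda>x :: 'e. (0 :: real ^ 'n, x))"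
    by (intro smooth_on_bounded_linear bounded_linear_Pair bounded_linear_zero bounded_linear_ident)
  then have "smooth_on T (\<lambda>x :: 'e. (X, 0) + (0 :: real ^ 'n, x))"
    by (intro smooth_on_add assms(2) smooth_on_const)
  then show "smooth_on T (\<lambda>x. (X, x))" by simp
qed auto

lemma smooth_fun_\<theta>: assumes f: "smooth_fun A f" shows "smooth_fun A (\<lambda>q. f (\<theta> X q))"
  unfolding smooth_fun_iff
proof clarify
  fix U \<phi> assume U: "(U, \<phi>) \<in> A"
  show "smooth_on (\<phi> ` U) (\<lambda>x. f (\<theta> X (inv_into U \<phi> x)))"
    using smooth_on_slice[OF action_smooth[OF U f] chart_image_open[OF U], of X] by simp
qed

lemma orbit_derivative_chart:
  assumes U: "(U, \<phi>) \<in> A" and f: "smooth_fun A f" and q: "q \<in> U"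
  shows "((\<lambda>t. f (\<theta> (t *\<^sub>R X) q)) has_real_derivative
    fderiv (\<lambda>z. f (\<theta> (fst z) (inv_into U \<phi> (snd z)))) (0, \<phi> q) (X, 0)) (at 0)"
proof -
  have "(\<lambda>z. f (\<theta> (fst z) (inv_into U \<phi> (snd z)))) differentiable (at ((0, \<phi> q) + 0 *\<^sub>R (X, 0)))"
    by (rule smooth_on_differentiable[OF action_smooth[OF U f]]) (use q in auto)
  from has_real_derivative_along_line[OF this] show ?thesis
    by (simp add: chart_inv[OF U q])
qed

lemma induced_chart:
  assumes "(U, \<phi>) \<in> A" "smooth_fun A f" "q \<in> U"
  shows "induced X q f = fderiv (\<lambda>z. f (\<theta> (fst z) (inv_into U \<phi> (snd z)))) (0, \<phi> q) (X, 0)"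
  using DERIV_imp_deriv[OF orbit_derivative_chart[OF assms, of X]] assms(2)
  by (simp add: induced_field_def \<theta>_def)

lemma orbit_derivative_0:
  assumes f: "smooth_fun A f"
  shows "((\<lambda>t. f (\<theta> (t *\<^sub>R X) q)) has_real_derivative induced X q f) (at 0)"
proof -
  obtain U \<phi> where U: "(U, \<phi>) \<in> A" "q \<in> U" by (rule chart_cover)
  show ?thesis using orbit_derivative_chart[OF U(1) f U(2), of X] induced_chart[OF U(1) f U(2), of X] by simp
qed

lemma orbit_derivative:
  assumes f: "smooth_fun A f"
  shows "((\<lambda>t. f (\<theta> (t *\<^sub>R X) q)) has_real_derivative induced X (\<theta> (s *\<^sub>R X) q) f) (at s)"
proof -
  have "((\<lambda>t. f (\<theta> ((s + t) *\<^sub>R X) q)) has_real_derivative induced X (\<theta> (s *\<^sub>R X) q) f) (at 0)"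
    using orbit_derivative_0[OF f, of X "\<theta> (s *\<^sub>R X) q"]
    by (simp add: scaleR_add_left add.commute[of "s *\<^sub>R X"] \<theta>_add)
  then show ?thesis
    using DERIV_at_within_shift[of "\<lambda>t. f (\<theta> (t *\<^sub>R X) q)" _ s 0 UNIV] by simp
qed

lemma induced_eqI:
  assumes "smooth_fun A f" "((\<lambda>t. f (\<theta> (t *\<^sub>R X) q)) has_real_derivative D) (at 0)"
  shows "induced X q f = D"
  using DERIV_unique[OF orbit_derivative_0[OF assms(1)] assms(2)] .

lemma induced_nonsmooth: "\<not> smooth_fun A f \<Longrightarrow> induced X q f = 0"
  by (simp add: induced_field_def)

lemma induced_tangent: "induced X q \<in> tangent_space A q"
  unfolding tangent_space_def
proof (intro CollectI conjI allI impI)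
  note d = orbit_derivative_0
  fix f assume f: "smooth_fun A f"
  show "induced X q (\<lambda>x. c * f x) = c * induced X q f" for c
    by (rule induced_eqI[OF smooth_fun_mult[OF smooth_fun_const f] DERIV_cmult[OF d[OF f]]])
  fix g assume g: "smooth_fun A g"
  show "induced X q (\<lambda>x. f x + g x) = induced X q f + induced X q g"
    by (rule induced_eqI[OF smooth_fun_add[OF f g] DERIV_add[OF d[OF f] d[OF g]]])
  show "induced X q (\<lambda>x. f x * g x) = f q * induced X q g + g q * induced X q f"
    using DERIV_mult[OF d[OF f, of X q] d[OF g, of X q]]
    by (intro induced_eqI[OF smooth_fun_mult[OF f g]]) (simp add: algebra_simps)
qed (rule induced_nonsmooth)

text \<open>The orbit derivative is the Frechet derivative of the jointly smooth action applied to
  (X, 0), and additivity in X is that of the Frechet derivative; derivatives along the separate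
  lines t X alone would not provide it.\<close>

lemma induced_linear: "induced (a *\<^sub>R X + b *\<^sub>R Y) q = lincomb a (induced X q) b (induced Y q)"
proof
  fix f
  show "induced (a *\<^sub>R X + b *\<^sub>R Y) q f = lincomb a (induced X q) b (induced Y q) f"
  proof (cases "smooth_fun A f")
    case True
    obtain U \<phi> where U: "(U, \<phi>) \<in> A" "q \<in> U" by (rule chart_cover)
    let ?F = "\<lambda>z. f (\<theta> (fst z) (inv_into U \<phi> (snd z)))"
    have l: "linear (fderiv ?F (0, \<phi> q))"
      by (rule linear_frechet_derivative[OF smooth_on_differentiable[OF action_smooth[OF U(1) True]]])
         (use U(2) in auto)
    have e: "(a *\<^sub>R X + b *\<^sub>R Y, 0 :: 'e) = a *\<^sub>R (X, 0) + b *\<^sub>R (Y, 0)" by simp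
    show ?thesis
      unfolding lincomb_def induced_chart[OF U(1) True U(2)] e linear_add[OF l] linear_cmul[OF l] by simp
  qed (simp add: lincomb_def induced_nonsmooth)
qed

lemma induced_smooth: assumes f: "smooth_fun A f" shows "smooth_fun A (\<lambda>q. induced X q f)"
  unfolding smooth_fun_iff
proof clarify
  fix U \<phi> assume U: "(U, \<phi>) \<in> A"
  let ?F = "\<lambda>z. f (\<theta> (fst z) (inv_into U \<phi> (snd z)))"
  have "smooth_on (\<phi> ` U) (\<lambda>x. fderiv ?F (0, x) (X, 0))"
    by (rule smooth_on_slice[OF smooth_on_frechet[OF action_smooth[OF U f]] chart_image_open[OF U]])
  then show "smooth_on (\<phi> ` U) (\<lambda>x. induced X (inv_into U \<phi> x) f)"
    by (rule smooth_on_cong[OF chart_image_open[OF U], rotated])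
       (simp add: induced_chart[OF U f chart_inv_mem] f_inv_into_f)
qed

lemma vector_field_induced: "vector_field A (induced X)"
  by (simp add: vector_field_def induced_tangent induced_smooth)

lemma pushforward_\<theta>: "pushforward A (\<theta> X) v f = (if smooth_fun A f then v (\<lambda>q. f (\<theta> X q)) else 0)"
  by (simp add: pushforward_def o_def)

lemma pushforward_tangent:
  assumes v: "v \<in> tangent_space A q" shows "pushforward A (\<theta> X) v \<in> tangent_space A (\<theta> X q)"
  unfolding tangent_space_def
  by (auto simp: pushforward_\<theta> smooth_fun_add smooth_fun_mult tangent_add[OF v] tangent_cmult[OF v]
      tangent_mult[OF v] smooth_fun_\<theta>)

text \<open>The torus is abelian, so translating by Y and moving along X commute.\<close>

lemma pushforward_induced: "pushforward A (\<theta> Y) (induced X q) = induced X (\<theta> Y q)"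
proof
  fix f
  show "pushforward A (\<theta> Y) (induced X q) f = induced X (\<theta> Y q) f"
  proof (cases "smooth_fun A f")
    case True
    have "induced X q (\<lambda>q. f (\<theta> Y q)) = induced X (\<theta> Y q) f"
      using orbit_derivative_0[OF True, of X "\<theta> Y q"]
      by (intro induced_eqI[OF smooth_fun_\<theta>[OF True]]) (simp flip: \<theta>_add add: add.commute)
    then show ?thesis using True by (simp add: pushforward_\<theta>)
  qed (simp add: pushforward_\<theta> induced_nonsmooth)
qed

end

section \<open>Lie derivatives along the torus action\<close>

locale torus_action_chart = torus_action A \<rho> + manifold_chart A U \<phi> p r
  for A :: "('m::t2_space, 'e::euclidean_space) atlas" and \<rho> :: "complex ^ 'n \<Rightarrow> 'm \<Rightarrow> 'm" and U \<phi> p r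
begin

lemma orbit_in_N: obtains T where "open T" "0 \<in> T" "\<And>t. t \<in> T \<Longrightarrow> \<theta> (- (t *\<^sub>R X)) p \<in> N"
proof -
  have "continuous_on UNIV (\<lambda>t. \<theta> (- (t *\<^sub>R X)) p)"
    using continuous_on_compose2[OF \<theta>_continuous, of UNIV "\<lambda>t::real. (- (t *\<^sub>R X), p)"]
    by (simp add: continuous_intros)
  then have "open ((\<lambda>t. \<theta> (- (t *\<^sub>R X)) p) -` N)" using N_open by (simp add: open_vimage)
  then show ?thesis using that[of "(\<lambda>t. \<theta> (- (t *\<^sub>R X)) p) -` N"] center_N by simp
qed

lemma orbit_coordinates_derivative:
  "((\<lambda>t. \<phi> (\<theta> (- (t *\<^sub>R X)) p)) has_vector_derivative - coords (induced X p)) (at 0)"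
proof -
  obtain T where T: "open T" "0 \<in> T" "\<And>t. t \<in> T \<Longrightarrow> \<theta> (- (t *\<^sub>R X)) p \<in> N"
    by (rule orbit_in_N[of X]) blast
  have "((\<lambda>t. coord_fun b (\<theta> (t *\<^sub>R (- X)) p)) has_vector_derivative - induced X p (coord_fun b)) (at 0)" for b
    using orbit_derivative_0[OF coord_fun_smooth, of b "- X" p] induced_linear[of "- 1" X 0 X p]
    by (simp add: has_real_derivative_iff_has_vector_derivative lincomb_def)
  then have "((\<lambda>t. \<Sum>b\<in>Basis. coord_fun b (\<theta> (t *\<^sub>R (- X)) p) *\<^sub>R b) has_vector_derivative
      (\<Sum>b\<in>Basis. (- induced X p (coord_fun b)) *\<^sub>R b)) (at 0)"
    by (intro has_vector_derivative_sum bounded_linear.has_vector_derivative[OF bounded_linear_scaleR_left])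
  then have "((\<lambda>t. \<Sum>b\<in>Basis. coord_fun b (\<theta> (t *\<^sub>R (- X)) p) *\<^sub>R b) has_vector_derivative
      - coords (induced X p)) (at 0)"
    by (simp add: coords_def sum_negf)
  then show ?thesis
  proof (rule has_vector_derivative_transform_within_open[OF _ T(1,2)])
    fix t assume "t \<in> T"
    from coord_fun_N[OF T(3)[OF this]]
    show "(\<Sum>b\<in>Basis. coord_fun b (\<theta> (t *\<^sub>R (- X)) p) *\<^sub>R b) = \<phi> (\<theta> (- (t *\<^sub>R X)) p)"
      by (simp add: euclidean_representation)
  qed
qed

end

context torus_action_chart
begin

text \<open>The curve is the push-forward to p of the value of Y at the point flowed backwards,
  applied to f. With F (V, x) = f (\<theta> V x) it is a sum of products Y_b F_b along a curve of
  velocity (X, - \<zeta>): the X-part contributes Y(X f) and the part along - \<zeta> contributes -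
  X(Y f).\<close>

lemma flow_derivative_center:
  assumes Y: "vector_field A Y" and f: "smooth_fun A f"
  shows "((\<lambda>t. Y (\<theta> (- (t *\<^sub>R X)) p) (\<lambda>q. f (\<theta> (t *\<^sub>R X) q))) has_real_derivative
    - lie_bracket (induced X) Y p f) (at 0)"
proof -
  define F where "F z = f (\<theta> (fst z) (inv\<phi> (snd z)))" for z :: "(real ^ 'n) \<times> 'e"
  define Fb where "Fb b z = fderiv F z (0, b)" for b z
  let ?D = "(UNIV :: (real ^ 'n) set) \<times> \<phi> ` U"
  let ?x0 = "\<phi> p" let ?z0 = "(0 :: real ^ 'n, \<phi> p)"
  define \<zeta> where "\<zeta> = coords (induced X p)"
  let ?y = "rep Y ?x0"
  have D: "open ?D" by (intro open_Times image_open open_UNIV)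
  have z0: "?z0 \<in> ?D" using center by simp
  have F: "smooth_on ?D F" unfolding F_def[abs_def] by (rule action_smooth[OF chart f])
  have Fbs: "smooth_on ?D (Fb b)" for b unfolding Fb_def[abs_def] by (rule smooth_on_frechet[OF F])
  obtain T where T: "open T" "0 \<in> T" "\<And>t. t \<in> T \<Longrightarrow> \<theta> (- (t *\<^sub>R X)) p \<in> N"
    by (rule orbit_in_N[of X]) blast
  let ?q = "\<lambda>t. \<theta> (- (t *\<^sub>R X)) p"
  have slice: "fderiv (\<lambda>x. F (V, x)) x v = (\<Sum>b\<in>Basis. (v \<bullet> b) * Fb b (V, x))"
    if x: "x \<in> \<phi> ` U" for x v V
  proof -
    have "((\<lambda>x. F (V, x)) has_derivative (\<lambda>v. fderiv F (V, x) (0, v))) (at x)"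
      by (rule has_derivative_compose[where f="\<lambda>x. (V, x)" and g=F])
         (use x in \<open>auto intro!: derivative_eq_intros smooth_on_has_derivative[OF F]\<close>)
    then have "fderiv (\<lambda>x. F (V, x)) x v = fderiv F (V, x) (0, v)"
      by (rule has_derivative_imp_frechet)
    moreover have "linear (\<lambda>v. fderiv F (V, x) (0, v))"
    proof -
      have l: "linear (fderiv F (V, x))"
        by (rule linear_frechet_derivative[OF smooth_on_differentiable[OF F]]) (use x in simp)
      have "linear (\<lambda>v :: 'e. (0 :: real ^ 'n, v))" by (rule linearI) simp_all
      from linear_compose[OF this l] show ?thesis by (simp add: o_def)
    qed
    ultimately show ?thesis using linear_basis_expansion[of "\<lambda>v. fderiv F (V, x) (0, v)" v]
      by (simp add: Fb_def)
  qed
  have val: "Y (?q t) (\<lambda>q. f (\<theta> (t *\<^sub>R X) q)) = (\<Sum>b\<in>Basis. (rep Y (\<phi> (?q t)) \<bullet> b) * Fb b (t *\<^sub>R X, \<phi> (?q t)))"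
    if t: "t \<in> T" for t
  proof -
    have i: "inv\<phi> (\<phi> (?q t)) = ?q t" by (rule inv_\<phi>[OF N_U[OF T(3)[OF t]]])
    have "Y (?q t) (\<lambda>q. f (\<theta> (t *\<^sub>R X) q)) = fderiv (\<lambda>x. F (t *\<^sub>R X, x)) (\<phi> (?q t)) (rep Y (\<phi> (?q t)))"
      using vector_field_apply[OF Y N_B[OF T(3)[OF t]] smooth_fun_\<theta>[OF f, of "t *\<^sub>R X"]] by (simp add: i F_def)
    also have "\<dots> = (\<Sum>b\<in>Basis. (rep Y (\<phi> (?q t)) \<bullet> b) * Fb b (t *\<^sub>R X, \<phi> (?q t)))"
      by (rule slice) (use N_U[OF T(3)[OF t]] in blast)
    finally show ?thesis .
  qed
  let ?S = "\<lambda>h. \<Sum>b\<in>Basis. (rep Y (\<phi> (?q 0)) \<bullet> b) * fderiv (Fb b) ?z0 (h *\<^sub>R X, h *\<^sub>R (- \<zeta>))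
        + (fderiv (rep Y) ?x0 (h *\<^sub>R (- \<zeta>)) \<bullet> b) * Fb b (0 *\<^sub>R X, \<phi> (?q 0))"
  let ?W = "\<Sum>b\<in>Basis. (?y \<bullet> b) * fderiv (Fb b) ?z0 (X, - \<zeta>)
        - (fderiv (rep Y) ?x0 \<zeta> \<bullet> b) * Fb b ?z0"
  let ?T = "\<lambda>v. \<Sum>b\<in>Basis. (?y \<bullet> b) * fderiv (Fb b) ?z0 (0, v)
        + (fderiv (rep Y) ?x0 v \<bullet> b) * Fb b ?z0"
  have dq: "((\<lambda>t. \<phi> (?q t)) has_derivative (\<lambda>h. h *\<^sub>R (- \<zeta>))) (at 0)"
    using orbit_coordinates_derivative[of X] by (simp add: has_vector_derivative_def \<zeta>_def)
  have dz: "((\<lambda>t. (t *\<^sub>R X, \<phi> (?q t))) has_derivative (\<lambda>h. (h *\<^sub>R X, h *\<^sub>R (- \<zeta>)))) (at 0)"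
    by (rule has_derivative_Pair[OF _ dq]) (auto intro!: derivative_eq_intros)
  have dY: "((\<lambda>t. rep Y (\<phi> (?q t)) \<bullet> b) has_derivative (\<lambda>h. fderiv (rep Y) ?x0 (h *\<^sub>R (- \<zeta>)) \<bullet> b)) (at 0)" for b
    by (rule bounded_linear.has_derivative[OF bounded_linear_inner_left], rule has_derivative_compose[OF dq])
       (simp add: rep_has_derivative[OF Y center_B])
  have dF: "((\<lambda>t. Fb b (t *\<^sub>R X, \<phi> (?q t))) has_derivative (\<lambda>h. fderiv (Fb b) ?z0 (h *\<^sub>R X, h *\<^sub>R (- \<zeta>)))) (at 0)" for b
    by (rule has_derivative_compose[OF dz]) (simp add: smooth_on_has_derivative[OF Fbs z0])
  have lFb: "linear (fderiv (Fb b) ?z0)" for b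
    by (rule linear_frechet_derivative[OF smooth_on_differentiable[OF Fbs z0]])
  have lY: "linear (fderiv (rep Y) ?x0)"
    using rep_has_derivative[OF Y center_B] by (rule has_derivative_linear)
  have "((\<lambda>t. \<Sum>b\<in>Basis. (rep Y (\<phi> (?q t)) \<bullet> b) * Fb b (t *\<^sub>R X, \<phi> (?q t))) has_derivative
      ?S) (at 0)"
    by (rule has_derivative_sum, rule has_derivative_mult[OF dY dF])
  then have "((\<lambda>t. Y (?q t) (\<lambda>q. f (\<theta> (t *\<^sub>R X) q))) has_derivative
      ?S) (at 0)"
    by (rule has_derivative_transform_within_open[OF _ T(1,2)]) (simp add: val)
  then have d1: "((\<lambda>t. Y (?q t) (\<lambda>q. f (\<theta> (t *\<^sub>R X) q))) has_real_derivative
      ?W) (at 0)"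
    unfolding has_field_derivative_def
  proof (rule has_derivative_eq_rhs, intro ext)
    fix h
    have e: "(h *\<^sub>R X, h *\<^sub>R (- \<zeta>)) = h *\<^sub>R (X, - \<zeta>)" by simp
    have 1: "fderiv (Fb b) ?z0 (h *\<^sub>R X, h *\<^sub>R (- \<zeta>)) = h * fderiv (Fb b) ?z0 (X, - \<zeta>)" for b
      unfolding e linear_cmul[OF lFb] by simp
    have 2: "fderiv (rep Y) ?x0 (h *\<^sub>R (- \<zeta>)) = - h *\<^sub>R fderiv (rep Y) ?x0 \<zeta>"
      using linear_cmul[OF lY, of "- h" \<zeta>] by simp
    show "?S h
      = ?W * h"
      unfolding 1 2 sum_distrib_right by (rule sum.cong) (simp_all add: algebra_simps)
  qed
  have XY: "induced X p (\<lambda>q. Y q f) =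
      (\<Sum>b\<in>Basis. (?y \<bullet> b) * fderiv (Fb b) ?z0 (0, \<zeta>)
        + (fderiv (rep Y) ?x0 \<zeta> \<bullet> b) * Fb b ?z0)"
  proof -
    have "((\<lambda>x. \<Sum>b\<in>Basis. (rep Y x \<bullet> b) * Fb b (0, x)) has_derivative
      ?T) (at ?x0)"
    proof (rule has_derivative_sum, rule has_derivative_mult)
      fix b :: 'e
      show "((\<lambda>x. rep Y x \<bullet> b) has_derivative (\<lambda>v. fderiv (rep Y) ?x0 v \<bullet> b)) (at ?x0)"
        by (rule bounded_linear.has_derivative[OF bounded_linear_inner_left rep_has_derivative[OF Y center_B]])
      have "((\<lambda>x. (0 :: real ^ 'n, x)) has_derivative (\<lambda>v. (0, v))) (at ?x0)"
        by (auto intro!: derivative_eq_intros)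
      then show "((\<lambda>x. Fb b (0, x)) has_derivative (\<lambda>v. fderiv (Fb b) ?z0 (0, v))) (at ?x0)"
        by (rule has_derivative_compose) (rule smooth_on_has_derivative[OF Fbs z0])
    qed
    then have "((\<lambda>x. Y (inv\<phi> x) f) has_derivative
      ?T) (at ?x0)"
    proof (rule has_derivative_transform_within_open[OF _ B_open center_B])
      fix x assume x: "x \<in> B"
      have "(\<lambda>x. F (0, x)) = (\<lambda>x. f (inv\<phi> x))" by (simp add: F_def)
      moreover have "x \<in> \<phi> ` U" using x B_subset by blast
      ultimately show "(\<Sum>b\<in>Basis. (rep Y x \<bullet> b) * Fb b (0, x)) = Y (inv\<phi> x) f"
        using slice[of x 0 "rep Y x"] vector_field_apply[OF Y x f] by simp
    qed
    then show ?thesis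
      using tangent_expand[OF center_N induced_tangent vector_field_smooth[OF Y]]
      by (simp add: has_derivative_imp_frechet \<zeta>_def)
  qed
  \<comment> \<open>Here F is differentiated first in the group direction and then along Y; the
    derivative of the curve has the opposite order, and symmetry of second derivatives matches the
    two.\<close>
  have YX: "Y p (\<lambda>q. induced X q f) = (\<Sum>b\<in>Basis. (?y \<bullet> b) * fderiv (Fb b) ?z0 (X, 0))"
  proof -
    let ?FX = "\<lambda>z. fderiv F z (X, 0)"
    have FX: "smooth_on ?D ?FX" by (rule smooth_on_frechet[OF F])
    have "((\<lambda>x. (0 :: real ^ 'n, x)) has_derivative (\<lambda>v. (0, v))) (at ?x0)"
      by (auto intro!: derivative_eq_intros)
    then have "((\<lambda>x. ?FX (0, x)) has_derivative (\<lambda>v. fderiv ?FX ?z0 (0, v))) (at ?x0)"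
      by (rule has_derivative_compose[where g="?FX"]) (rule smooth_on_has_derivative[OF FX z0])
    then have "((\<lambda>x. induced X (inv\<phi> x) f) has_derivative (\<lambda>v. fderiv ?FX ?z0 (0, v))) (at ?x0)"
    proof (rule has_derivative_transform_within_open[OF _ B_open center_B])
      fix x assume x: "x \<in> B"
      show "?FX (0, x) = induced X (inv\<phi> x) f"
        using induced_chart[OF chart f inv_B_U[OF x], of X] x by (simp add: F_def[abs_def])
    qed
    then have "Y p (\<lambda>q. induced X q f) = fderiv ?FX ?z0 (0, ?y)"
      using tangent_expand[OF center_N vector_field_tangent[OF Y] induced_smooth[OF f]]
      by (simp add: has_derivative_imp_frechet rep_center)
    also have "\<dots> = (\<Sum>b\<in>Basis. (?y \<bullet> b) * fderiv ?FX ?z0 (0, b))"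
    proof -
      have l: "linear (fderiv ?FX ?z0)"
        by (rule linear_frechet_derivative[OF smooth_on_differentiable[OF FX z0]])
      have "linear (\<lambda>v :: 'e. (0 :: real ^ 'n, v))" by (rule linearI) simp_all
      from linear_compose[OF this l] have "linear (\<lambda>v. fderiv ?FX ?z0 (0, v))" by (simp add: o_def)
      from linear_basis_expansion[OF this, of ?y] show ?thesis by simp
    qed
    also have "\<dots> = (\<Sum>b\<in>Basis. (?y \<bullet> b) * fderiv (Fb b) ?z0 (X, 0))"
      unfolding Fb_def[abs_def] second_derivative_symmetric[OF F D z0, of "(X, 0)"] ..
    finally show ?thesis .
  qed
  have split: "fderiv (Fb b) ?z0 (X, - \<zeta>)
      = fderiv (Fb b) ?z0 (X, 0) - fderiv (Fb b) ?z0 (0, \<zeta>)" for b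
    using linear_diff[OF lFb, of b "(X, 0)" "(0, \<zeta>)"] by simp
  have "?W = - lie_bracket (induced X) Y p f"
    unfolding lie_bracket_def XY YX split by (simp add: sum_subtractf sum.distrib algebra_simps)
  with d1 show ?thesis by simp
qed

end

context torus_action
begin

lemma flow_derivative:
  assumes "vector_field A Y" "smooth_fun A f"
  shows "((\<lambda>t. Y (\<theta> (- (t *\<^sub>R X)) p) (\<lambda>q. f (\<theta> (t *\<^sub>R X) q))) has_real_derivative
    - lie_bracket (induced X) Y p f) (at 0)"
proof -
  obtain U \<phi> r where "manifold_chart A U \<phi> p r" by (rule chart_around)
  then interpret manifold_chart A U \<phi> p r .
  interpret torus_action_chart A \<rho> U \<phi> p r ..
  show ?thesis by (rule flow_derivative_center[OF assms])
qed

text \<open>For an invariant field the curve in \<open>flow_derivative\<close> is constant.\<close>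

lemma invariant_field_commutes:
  assumes Y: "vector_field A Y" and inv: "\<And>X q. pushforward A (\<theta> X) (Y q) = Y (\<theta> X q)"
  shows "lie_bracket (induced X) Y p = zero_tangent"
proof
  fix f
  show "lie_bracket (induced X) Y p f = zero_tangent f"
  proof (cases "smooth_fun A f")
    case True
    have "Y (\<theta> (- (t *\<^sub>R X)) p) (\<lambda>q. f (\<theta> (t *\<^sub>R X) q)) = Y p f" for t
      using inv[of "t *\<^sub>R X" "\<theta> (- (t *\<^sub>R X)) p", THEN fun_cong, of f] True by (simp add: pushforward_\<theta>)
    then have "((\<lambda>t. Y p f) has_real_derivative - lie_bracket (induced X) Y p f) (at 0)"
      using flow_derivative[OF Y True, of X p] by simp
    then have "- lie_bracket (induced X) Y p f = 0" by (rule DERIV_unique[OF _ DERIV_const])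
    then show ?thesis by (simp add: zero_tangent_def)
  next
    case False
    then show ?thesis
      using tangent_nonsmooth[OF vector_field_tangent[OF vector_field_lie_bracket[OF vector_field_induced Y]]]
      by (simp add: zero_tangent_def)
  qed
qed

lemma induced_commute: "lie_bracket (induced X) (induced Y) p = zero_tangent"
  by (rule invariant_field_commutes[OF vector_field_induced pushforward_induced])

end

context torus_action_chart
begin

text \<open>By invariance, g on Y and W at the point flowed backwards equals g at p on the
  pushed-forward vectors. These stay in one tangent space, so the product rule for a single bilinear
  form applies and \<open>flow_derivative\<close> supplies the brackets. All signs are reversed
  because the orbit runs backwards.\<close>

lemma killing_center:
  assumes g: "riemannian_metric A g" and inv: "invariant_metric A \<rho> g"
    and Y: "vector_field A Y" and W: "vector_field A W"
  shows "induced X p (\<lambda>q. g q (Y q) (W q)) =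
    g p (lie_bracket (induced X) Y p) (W p) + g p (Y p) (lie_bracket (induced X) W p)"
proof -
  let ?q = "\<lambda>t. \<theta> (- (t *\<^sub>R X)) p"
  let ?y = "\<lambda>Y t. coords (pushforward A (\<theta> (t *\<^sub>R X)) (Y (?q t)))"
  let ?G = "\<lambda>u w. metric_comp g u w (\<phi> p)"
  have bil: "bounded_bilinear ?G"
  proof -
    have "linear (\<lambda>w. ?G u w)" for u
      using metric_comp_linear[OF g center_B, of u] metric_comp_sym[OF g center_B, of u] by simp
    then have "bilinear ?G" unfolding bilinear_def using metric_comp_linear[OF g center_B] by blast
    then show ?thesis by (simp add: bilinear_conv_bounded_bilinear)
  qed
  have gG: "g p v w = ?G (coords v) (coords w)" if "v \<in> tangent_space A p" "w \<in> tangent_space A p" for v w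
    using metric_apply[OF center_B, of v w g] that by (simp add: inv_center)
  have dy: "(?y Y has_vector_derivative - coords (lie_bracket (induced X) Y p)) (at 0)"
    if Y: "vector_field A Y" for Y
  proof -
    have "((\<lambda>t. Y (?q t) (\<lambda>q. coord_fun b (\<theta> (t *\<^sub>R X) q))) has_vector_derivative
        - lie_bracket (induced X) Y p (coord_fun b)) (at 0)" for b
      using flow_derivative[OF Y coord_fun_smooth[of b], of X p] by (simp add: has_real_derivative_iff_has_vector_derivative)
    then have "((\<lambda>t. \<Sum>b\<in>Basis. Y (?q t) (\<lambda>q. coord_fun b (\<theta> (t *\<^sub>R X) q)) *\<^sub>R b) has_vector_derivative
        (\<Sum>b\<in>Basis. (- lie_bracket (induced X) Y p (coord_fun b)) *\<^sub>R b)) (at 0)"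
      by (intro has_vector_derivative_sum bounded_linear.has_vector_derivative[OF bounded_linear_scaleR_left])
    then show ?thesis by (simp add: coords_def sum_negf pushforward_\<theta> coord_fun_smooth)
  qed
  have y0: "coords (pushforward A (\<theta> 0) v) = coords v" for v by (simp add: coords_def pushforward_\<theta> coord_fun_smooth)
  have "((\<lambda>t. ?G (?y Y t) (?y W t)) has_vector_derivative
      (?G (?y Y 0) (- coords (lie_bracket (induced X) W p)) + ?G (- coords (lie_bracket (induced X) Y p)) (?y W 0))) (at 0)"
    by (rule bounded_bilinear.has_vector_derivative[OF bil dy[OF Y] dy[OF W]])
  moreover have "?G (?y Y t) (?y W t) = g (?q t) (Y (?q t)) (W (?q t))" for t
  proof -
    have "pushforward A (\<theta> (t *\<^sub>R X)) (Z (?q t)) \<in> tangent_space A p" if "vector_field A Z" for Z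
      using pushforward_tangent[OF vector_field_tangent[OF that, of "?q t"], of "t *\<^sub>R X"] by simp
    then have "?G (?y Y t) (?y W t) = g p (pushforward A (\<theta> (t *\<^sub>R X)) (Y (?q t))) (pushforward A (\<theta> (t *\<^sub>R X)) (W (?q t)))"
      using gG Y W by simp
    also have "\<dots> = g (?q t) (Y (?q t)) (W (?q t))"
    proof -
      have "\<theta> (t *\<^sub>R X) = \<rho> (torus_exp (t *\<^sub>R X))" by (simp add: \<theta>_def[abs_def])
      then show ?thesis
        using inv torus_exp_in_torus[of "t *\<^sub>R X"] vector_field_tangent[OF Y] vector_field_tangent[OF W] \<theta>_minus[of "t *\<^sub>R X" p]
        unfolding invariant_metric_def by metis
    qed
    finally show ?thesis .
  qed
  ultimately have "((\<lambda>t. g (?q t) (Y (?q t)) (W (?q t))) has_real_derivative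
      (?G (coords (Y p)) (- coords (lie_bracket (induced X) W p)) + ?G (- coords (lie_bracket (induced X) Y p)) (coords (W p)))) (at 0)"
    by (simp add: y0 has_real_derivative_iff_has_vector_derivative)
  moreover have "((\<lambda>t. g (?q t) (Y (?q t)) (W (?q t))) has_real_derivative - induced X p (\<lambda>q. g q (Y q) (W q))) (at 0)"
  proof -
    have "smooth_fun A (\<lambda>q. g q (Y q) (W q))" using g Y W by (simp add: riemannian_metric_def)
    from orbit_derivative_0[OF this, of "- X" p] show ?thesis
      using induced_linear[of "- 1" X 0 X p] by (simp add: lincomb_def)
  qed
  ultimately have "- induced X p (\<lambda>q. g q (Y q) (W q)) =
      ?G (coords (Y p)) (- coords (lie_bracket (induced X) W p)) + ?G (- coords (lie_bracket (induced X) Y p)) (coords (W p))"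
    using DERIV_unique by blast
  then show ?thesis
    using gG[OF vector_field_tangent[OF Y] vector_field_tangent[OF vector_field_lie_bracket[OF vector_field_induced W]]]
      gG[OF vector_field_tangent[OF vector_field_lie_bracket[OF vector_field_induced Y]] vector_field_tangent[OF W]]
    by (simp add: bounded_bilinear.minus_left[OF bil] bounded_bilinear.minus_right[OF bil])
qed

end

context torus_action
begin

lemma induced_killing:
  assumes g: "riemannian_metric A g" and inv: "invariant_metric A \<rho> g"
  shows "killing_field A g (induced X)"
  unfolding killing_field_def
proof (intro conjI allI impI)
  fix Y W p assume *: "vector_field A Y" "vector_field A W"
  obtain U \<phi> r where "manifold_chart A U \<phi> p r" by (rule chart_around)
  then interpret manifold_chart A U \<phi> p r .
  interpret torus_action_chart A \<rho> U \<phi> p r ..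
  show "induced X p (\<lambda>q. g q (Y q) (W q)) =
    g p (lie_bracket (induced X) Y p) (W p) + g p (Y p) (lie_bracket (induced X) W p)"
    by (rule killing_center[OF g inv *])
qed (rule vector_field_induced)

end

section \<open>Toric K-contact manifolds\<close>

context smooth_manifold
begin

lemma lie_bracket_antisym: "lie_bracket X Y p = lincomb (- 1) (lie_bracket Y X p) 0 zero_tangent"
  by (simp add: lie_bracket_def lincomb_def)

lemma lie_bracket_lincomb:
  assumes X: "vector_field A X" and Y: "vector_field A Y" and W: "vector_field A W"
  shows "lie_bracket (\<lambda>q. lincomb a (X q) b (Y q)) W p = lincomb a (lie_bracket X W p) b (lie_bracket Y W p)"
proof
  fix f
  note s = vector_field_smooth[OF X, of f] vector_field_smooth[OF Y, of f]
  note t = vector_field_tangent[OF W, of p]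
  have "W p (\<lambda>q. a * X q f + b * Y q f) = a * W p (\<lambda>q. X q f) + b * W p (\<lambda>q. Y q f)"
    unfolding tangent_add[OF t smooth_fun_mult[OF smooth_fun_const s(1)] smooth_fun_mult[OF smooth_fun_const s(2)]]
      tangent_cmult[OF t s(1)] tangent_cmult[OF t s(2)] ..
  then show "lie_bracket (\<lambda>q. lincomb a (X q) b (Y q)) W p f = lincomb a (lie_bracket X W p) b (lie_bracket Y W p) f"
    by (simp add: lie_bracket_def lincomb_def algebra_simps)
qed

lemma killing_field_lincomb:
  assumes g: "riemannian_metric A g" and K: "killing_field A g K" "killing_field A g L"
  shows "killing_field A g (\<lambda>q. lincomb a (K q) b (L q))"
proof -
  have v: "vector_field A K" "vector_field A L" using K by (auto simp: killing_field_def)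
  have left: "g p (lincomb a u b v) w = a * g p u w + b * g p v w"
    if "u \<in> tangent_space A p" "v \<in> tangent_space A p" "w \<in> tangent_space A p" for p u v w
    using g that unfolding riemannian_metric_def by blast
  have gsym: "g p v w = g p w v" if "v \<in> tangent_space A p" "w \<in> tangent_space A p" for p v w
    using g that unfolding riemannian_metric_def by blast
  have right: "g p w (lincomb a u b v) = a * g p w u + b * g p w v"
    if "u \<in> tangent_space A p" "v \<in> tangent_space A p" "w \<in> tangent_space A p" for p u v w
    using that left[OF that] gsym lincomb_tangent by simp
  show ?thesis
    unfolding killing_field_def
  proof (intro conjI allI impI vector_field_lincomb v)
    fix X Y p assume X: "vector_field A X" and Y: "vector_field A Y"
    note t = vector_field_tangent
    have k: "K p (\<lambda>q. g q (X q) (Y q)) = g p (lie_bracket K X p) (Y p) + g p (X p) (lie_bracket K Y p)"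
      "L p (\<lambda>q. g q (X q) (Y q)) = g p (lie_bracket L X p) (Y p) + g p (X p) (lie_bracket L Y p)"
      using K X Y unfolding killing_field_def by blast+
    show "lincomb a (K p) b (L p) (\<lambda>q. g q (X q) (Y q)) =
        g p (lie_bracket (\<lambda>q. lincomb a (K q) b (L q)) X p) (Y p) +
        g p (X p) (lie_bracket (\<lambda>q. lincomb a (K q) b (L q)) Y p)"
      unfolding lie_bracket_lincomb[OF v X] lie_bracket_lincomb[OF v Y]
        left[OF t[OF vector_field_lie_bracket[OF v(1) X]] t[OF vector_field_lie_bracket[OF v(2) X]] t[OF Y]]
        right[OF t[OF vector_field_lie_bracket[OF v(1) Y]] t[OF vector_field_lie_bracket[OF v(2) Y]] t[OF X]]
      by (simp add: lincomb_def k algebra_simps)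
  qed
qed

end

lemma torus_exp_line_trivial:
  assumes "\<And>t. torus_exp (t *\<^sub>R X) = 1" shows "X = 0"
proof (rule ccontr)
  assume "X \<noteq> 0"
  then obtain i where i: "X $ i \<noteq> 0" by (auto simp: vec_eq_iff)
  \<comment> \<open>The parameter 1 / (2 X_i) moves the i-th coordinate by half a turn.\<close>
  have "torus_exp ((1 / (2 * X $ i)) *\<^sub>R X) $ i = cis pi"
    using i by (simp add: torus_exp_def)
  then have "cis pi = 1" using assms by simp
  then show False by simp
qed

locale toric_K_contact_manifold = torus_action A \<rho>
  for A :: "('m::t2_space, 'e::euclidean_space) atlas" and \<rho> :: "complex ^ 'n \<Rightarrow> 'm \<Rightarrow> 'm" +
  fixes \<alpha> :: "'m form" and \<Phi> :: "'m \<Rightarrow> 'm tangent \<Rightarrow> 'm tangent"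
    and g :: "'m \<Rightarrow> 'm tangent \<Rightarrow> 'm tangent \<Rightarrow> real"
  assumes cms: "contact_metric_structure A \<alpha> \<Phi> g"
    and reeb_killing: "killing_field A g (reeb_field A \<alpha>)"
    and inv_\<alpha>: "invariant_form A \<rho> \<alpha>" and inv_\<Phi>: "invariant_endomorphism A \<rho> \<Phi>"
    and inv_g: "invariant_metric A \<rho> g"
    and inj_\<rho>: "inj_on \<rho> torus"
    and dimension: "2 * CARD('n) = DIM('e) + 1"
    and conn: "connected (UNIV :: 'm set)"
begin

abbreviation "R \<equiv> reeb_field A \<alpha>"

definition toric_field :: "(real ^ 'n) \<times> real \<Rightarrow> 'm vfield" where
  "toric_field w q = lincomb 1 (induced (fst w) q) (snd w) (R q)"

text \<open>The kernel of evaluation of the n + 1 parametrised fields at q; its dimension is least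
  exactly where they span a space of largest dimension.\<close>

definition stabilizer :: "'m \<Rightarrow> ((real ^ 'n) \<times> real) set" where
  "stabilizer q = {w. toric_field w q = zero_tangent}"

lemma metric: "riemannian_metric A g"
  using cms by (simp add: contact_metric_structure_def)

lemma one_form: "one_form A \<alpha>"
  using cms by (simp add: contact_metric_structure_def contact_form_def)

lemma vector_field_R: "vector_field A R"
  using reeb_killing by (simp add: killing_field_def)

lemma \<theta>_\<rho>: "\<theta> X = \<rho> (torus_exp X)"
  by (simp add: \<theta>_def[abs_def])

lemma \<alpha>_R_pos: "\<alpha> q (R q) > 0"
proof -
  obtain U \<phi> r where "manifold_chart A U \<phi> q r" by (rule chart_around)
  then interpret manifold_chart A U \<phi> q r .
  interpret contact_metric_chart A U \<phi> q r \<alpha> \<Phi> g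
    by unfold_locales (rule cms, rule vector_field_tangent[OF vector_field_R])
  show ?thesis by (rule \<alpha>_reeb_pos)
qed

text \<open>Invariance of \<open>\<alpha>\<close> and \<open>\<Phi>\<close> passes to \<open>R\<close> through \<open>\<Phi>\<^sup>2 v = - v + \<alpha>(v) R\<close> at any \<open>v\<close> with
  \<open>\<alpha>(v) \<noteq> 0\<close>.\<close>

lemma R_invariant: "pushforward A (\<theta> X) (R q) = R (\<theta> X q)"
proof
  fix f
  let ?F = "pushforward A (\<theta> X)"
  have \<Phi>_t: "\<Phi> q v \<in> tangent_space A q" if "v \<in> tangent_space A q" for v q
    using cms that by (simp add: contact_metric_structure_def tangent_endomorphism_def)
  have sq: "\<Phi> q (\<Phi> q v) = lincomb (- 1) v (\<alpha> q v) (R q)" if "v \<in> tangent_space A q" for v q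
    using cms that unfolding contact_metric_structure_def by blast
  have push\<Phi>: "\<Phi> (\<theta> X q) (?F v) = ?F (\<Phi> q v)" if "v \<in> tangent_space A q" for v
    using inv_\<Phi> torus_exp_in_torus that unfolding invariant_endomorphism_def \<theta>_\<rho> by blast
  have push\<alpha>: "\<alpha> (\<theta> X q) (?F v) = \<alpha> q v" if "v \<in> tangent_space A q" for v
    using inv_\<alpha> torus_exp_in_torus that unfolding invariant_form_def \<theta>_\<rho> by blast
  obtain v where v: "v \<in> tangent_space A q" "\<alpha> q v \<noteq> 0"
    using cms unfolding contact_metric_structure_def contact_form_def by blast
  have "?F (lincomb (- 1) v (\<alpha> q v) (R q)) = ?F (\<Phi> q (\<Phi> q v))" using sq[OF v(1)] by simp
  also have "\<dots> = \<Phi> (\<theta> X q) (\<Phi> (\<theta> X q) (?F v))"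
    using push\<Phi>[OF v(1)] push\<Phi>[OF \<Phi>_t[OF v(1)]] by simp
  also have "\<dots> = lincomb (- 1) (?F v) (\<alpha> q v) (R (\<theta> X q))"
    using sq[OF pushforward_tangent[OF v(1)]] push\<alpha>[OF v(1)] by simp
  finally have "?F (lincomb (- 1) v (\<alpha> q v) (R q)) f = lincomb (- 1) (?F v) (\<alpha> q v) (R (\<theta> X q)) f" by simp
  then show "?F (R q) f = R (\<theta> X q) f"
    using v(2) tangent_nonsmooth[OF vector_field_tangent[OF vector_field_R]]
    by (auto simp: pushforward_\<theta> lincomb_def split: if_splits)
qed

lemma toric_field_killing: "killing_field A g (toric_field w)"
  unfolding toric_field_def[abs_def]
  by (rule killing_field_lincomb[OF metric induced_killing[OF metric inv_g] reeb_killing])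

lemma vector_field_toric_field: "vector_field A (toric_field w)"
  using toric_field_killing by (simp add: killing_field_def)

lemma toric_field_commute: "lie_bracket (toric_field w) (toric_field w') p = zero_tangent"
proof -
  have z: "lincomb a zero_tangent b zero_tangent = (zero_tangent :: 'm tangent)" for a b
    by (simp add: lincomb_def zero_tangent_def)
  have RX: "lie_bracket R (induced X) p = zero_tangent" for X
    unfolding lie_bracket_antisym[of R] invariant_field_commutes[OF vector_field_R R_invariant] z ..
  have RR: "lie_bracket R R p = zero_tangent"
    by (simp add: lie_bracket_def zero_tangent_def)
  have 1: "lie_bracket (toric_field w) (induced X) p = zero_tangent" for w X
    unfolding toric_field_def[abs_def] lie_bracket_lincomb[OF vector_field_induced vector_field_R vector_field_induced]
      induced_commute RX z ..
  have 2: "lie_bracket (toric_field w) R p = zero_tangent" for w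
    unfolding toric_field_def[abs_def] lie_bracket_lincomb[OF vector_field_induced vector_field_R vector_field_R]
      invariant_field_commutes[OF vector_field_R R_invariant] RR z ..
  have 3: "lie_bracket (induced X) (toric_field w) p = zero_tangent" "lie_bracket R (toric_field w) p = zero_tangent" for X w
    unfolding lie_bracket_antisym[of _ "toric_field w"] 1 2 z by (rule refl)+
  show ?thesis
    unfolding toric_field_def[of w, abs_def] lie_bracket_lincomb[OF vector_field_induced vector_field_R vector_field_toric_field] 3 z ..
qed

lemma toric_field_linear: "toric_field (a *\<^sub>R w + b *\<^sub>R w') q = lincomb a (toric_field w q) b (toric_field w' q)"
  unfolding toric_field_def fst_add snd_add fst_scaleR snd_scaleR induced_linear
  by (simp add: lincomb_def algebra_simps)

text \<open>The function is a component of the moment map of \<alpha> and is constant on orbits: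
  \<alpha> is invariant, and so are the induced fields of an abelian group.\<close>

lemma \<alpha>_induced_invariant: "induced X p (\<lambda>q. \<alpha> q (induced Y q)) = 0"
proof (rule induced_eqI)
  show "smooth_fun A (\<lambda>q. \<alpha> q (induced Y q))"
    using one_form vector_field_induced by (simp add: one_form_def)
  have "\<alpha> (\<theta> Z p) (pushforward A (\<theta> Z) (induced Y p)) = \<alpha> p (induced Y p)" for Z
    using inv_\<alpha> torus_exp_in_torus induced_tangent unfolding invariant_form_def \<theta>_\<rho> by blast
  then have "\<alpha> (\<theta> Z p) (induced Y (\<theta> Z p)) = \<alpha> p (induced Y p)" for Z
    by (simp add: pushforward_induced)
  then show "((\<lambda>t. \<alpha> (\<theta> (t *\<^sub>R X) p) (induced Y (\<theta> (t *\<^sub>R X) p))) has_real_derivative 0) (at 0)" by simp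
qed

text \<open>Smooth functions are constant along the orbits of X and bump functions separate points,
  so the whole line through X acts trivially; injectivity of \<rho> brings this back to the
  torus.\<close>

lemma effective: assumes "\<And>q. induced X q = zero_tangent" shows "X = 0"
proof (rule torus_exp_line_trivial, rule inj_onD[OF inj_\<rho>])
  fix t
  show "\<rho> (torus_exp (t *\<^sub>R X)) = \<rho> 1"
  proof
    fix q
    have const: "f (\<theta> (t *\<^sub>R X) q) = f q" if f: "smooth_fun A f" for f
    proof -
      have "\<forall>s. ((\<lambda>s. f (\<theta> (s *\<^sub>R X) q)) has_real_derivative 0) (at s)"
        using orbit_derivative[OF f, of X q] assms by (simp add: zero_tangent_def)
      from DERIV_isconst_all[OF this, of t 0] show ?thesis by simp
    qed
    have "\<theta> (t *\<^sub>R X) q = q"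
    proof (rule ccontr)
      assume "\<theta> (t *\<^sub>R X) q \<noteq> q"
      then obtain h where h: "smooth_fun A h" "h q = 1" "\<And>x. x \<notin> - {\<theta> (t *\<^sub>R X) q} \<Longrightarrow> h x = 0"
        using bump_function[of "- {\<theta> (t *\<^sub>R X) q}" q] by auto
      then show False using const[OF h(1)] by simp
    qed
    then show "\<rho> (torus_exp (t *\<^sub>R X)) q = \<rho> 1 q" by (simp add: \<rho>_1 \<theta>_def)
  qed
qed (simp_all add: torus_exp_in_torus, simp add: torus_def)

end

section \<open>Derivatives at a point of maximal rank\<close>

lemma vector_derivative_quotient_tendsto:
  fixes f :: "real \<Rightarrow> 'a::real_normed_vector"
  assumes "(f has_derivative (\<lambda>h. h *\<^sub>R y)) (at 0)" "f 0 = 0"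
  shows "((\<lambda>t. f t /\<^sub>R t) \<longlongrightarrow> y) (at 0)"
proof -
  have "((\<lambda>h. norm (f (0 + h) - f 0 - h *\<^sub>R y) / norm h) \<longlongrightarrow> 0) (at 0)"
    using assms(1) by (simp only: has_derivative_at)
  then have "((\<lambda>h. norm (f h /\<^sub>R h - y)) \<longlongrightarrow> 0) (at 0)"
  proof (rule Lim_transform_eventually)
    have "norm (f (0 + h) - f 0 - h *\<^sub>R y) / norm h = norm (f h /\<^sub>R h - y)" if "h \<noteq> 0" for h :: real
    proof -
      have "f h /\<^sub>R h - y = (f h - h *\<^sub>R y) /\<^sub>R h" using that by (simp add: scaleR_diff_right)
      then show ?thesis by (simp add: assms(2) divide_inverse_commute)
    qed
    then show "\<forall>\<^sub>F h in at 0. norm (f (0 + h) - f 0 - h *\<^sub>R y) / norm h = norm (f h /\<^sub>R h - y)"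
      by (auto simp: eventually_at_filter)
  qed
  then show ?thesis by (rule LIM_zero_cancel[OF tendsto_norm_zero_cancel])
qed

text \<open>Where the rank of \<open>w \<mapsto> \<zeta> w x\<close> is maximal, derivatives of sections vanishing at the point stay
  inside the range.\<close>

lemma maximal_rank_derivative:
  fixes \<zeta> :: "'w::euclidean_space \<Rightarrow> 'e::real_normed_vector \<Rightarrow> 'f::euclidean_space"
  assumes lin: "\<And>x. linear (\<lambda>w. \<zeta> w x)" and cont: "\<And>w. isCont (\<zeta> w) x0"
    and S: "open S" "x0 \<in> S" and min: "\<And>x. x \<in> S \<Longrightarrow> dim {w. \<zeta> w x0 = 0} \<le> dim {w. \<zeta> w x = 0}"
    and w0: "\<zeta> w0 x0 = 0" and L: "(\<zeta> w0 has_derivative L) (at x0)"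
    and l: "linear (l :: 'f \<Rightarrow> real)" "\<And>w. l (\<zeta> w x0) = 0"
  shows "l (L u) = 0"
proof -
  define K where "K x = {w. \<zeta> w x = 0}" for x
  have sK: "subspace (K x)" for x
    using linear_subspace_kernel[OF lin[of x]] by (simp add: K_def)
  \<comment> \<open>A complement of the kernel at x0. Evaluation at x0 is bounded below on it by
    some m > 0, and near x0 the bound m / 2 persists.\<close>
  define C where "C = {c. \<forall>k\<in>K x0. orthogonal k c}"
  have sC: "subspace C"
    unfolding C_def subspace_def by (auto simp: orthogonal_def inner_add_right)
  have dC: "dim C + dim (K x0) = DIM('w)"
    using dim_subspace_orthogonal_to_vectors[OF sK subspace_UNIV subset_UNIV, of x0] by (simp add: C_def)
  have "\<exists>m>0. \<forall>c\<in>C. m * norm c \<le> norm (\<zeta> c x0)"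
  proof (rule injective_imp_isometric[OF closed_subspace[OF sC] sC])
    show "bounded_linear (\<lambda>w. \<zeta> w x0)" using lin by (simp add: linear_conv_bounded_linear)
    show "\<forall>c\<in>C. \<zeta> c x0 = 0 \<longrightarrow> c = 0"
      by (auto simp: C_def K_def orthogonal_def)
  qed
  then obtain m where m: "m > 0" "\<And>c. c \<in> C \<Longrightarrow> m * norm c \<le> norm (\<zeta> c x0)" by blast
  define \<eta> where "\<eta> x = (\<Sum>b\<in>Basis. norm (\<zeta> b x - \<zeta> b x0))" for x
  have \<eta>: "norm (\<zeta> w x - \<zeta> w x0) \<le> norm w * \<eta> x" for w x
  proof -
    have "\<zeta> w x - \<zeta> w x0 = (\<Sum>b\<in>Basis. (w \<bullet> b) *\<^sub>R (\<zeta> b x - \<zeta> b x0))"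
      using linear_basis_expansion[OF lin[of x], of w] linear_basis_expansion[OF lin[of x0], of w]
      by (simp add: sum_subtractf scaleR_diff_right)
    also have "norm \<dots> \<le> (\<Sum>b\<in>Basis. norm ((w \<bullet> b) *\<^sub>R (\<zeta> b x - \<zeta> b x0)))" by (rule norm_sum)
    also have "\<dots> \<le> (\<Sum>b\<in>Basis. norm w * norm (\<zeta> b x - \<zeta> b x0))"
      by (rule sum_mono) (simp add: Basis_le_norm mult_right_mono)
    finally show ?thesis by (simp add: \<eta>_def sum_distrib_left)
  qed
  have \<eta>_cont: "isCont \<eta> x0"
    unfolding \<eta>_def[abs_def] by (intro continuous_intros cont)
  obtain \<Gamma> where \<Gamma>: "\<Gamma> > 0" "\<And>z. norm (l z) \<le> norm z * \<Gamma>"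
    using bounded_linear.pos_bounded[of l] l(1) by (auto simp: linear_conv_bounded_linear)
  \<comment> \<open>Near x0 the space C meets the kernel at x trivially, and minimality of the
    kernel at x0 makes the two fill everything. At x one may thus replace w0 by some c in C of norm
    at most (2 / m) |\<zeta> w0 x|. As l kills the range at x0, only the difference of the two
    evaluations of c contributes, which costs a factor \<open>\<eta>\<close>.\<close>
  have bound: "\<bar>l (\<zeta> w0 x)\<bar> \<le> (\<Gamma> * (2 / m)) * \<eta> x * norm (\<zeta> w0 x)" if x: "x \<in> S" "\<eta> x < m / 2" for x
  proof -
    have lower: "m / 2 * norm c \<le> norm (\<zeta> c x)" if "c \<in> C" for c
    proof -
      have "norm (\<zeta> c x0) \<le> norm (\<zeta> c x) + norm (\<zeta> c x - \<zeta> c x0)"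
        using norm_triangle_ineq4[of "\<zeta> c x" "\<zeta> c x - \<zeta> c x0"] by simp
      moreover have "norm c * \<eta> x \<le> norm c * (m / 2)" using x(2) by (intro mult_left_mono) auto
      ultimately show ?thesis using m(2)[OF that] \<eta>[of c x] by (simp add: algebra_simps)
    qed
    have "C \<inter> K x \<subseteq> {0}"
    proof
      fix c assume "c \<in> C \<inter> K x"
      then have "m / 2 * norm c \<le> 0" using lower[of c] by (simp add: K_def)
      then show "c \<in> {0}" using m(1) by (simp add: mult_le_0_iff)
    qed
    then have i: "dim (C \<inter> K x) = 0" by (simp add: dim_eq_0)
    have "dim {a + b |a b. a \<in> C \<and> b \<in> K x} + dim (C \<inter> K x) = dim C + dim (K x)"
      by (rule dim_sums_Int[OF sC sK])
    then have "dim {a + b |a b. a \<in> C \<and> b \<in> K x} \<ge> DIM('w)"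
      using i dC min[OF x(1)] unfolding K_def[symmetric] by linarith
    then have "dim {a + b |a b. a \<in> C \<and> b \<in> K x} = DIM('w)"
      using dim_subset_UNIV le_antisym by blast
    then have "{a + b |a b. a \<in> C \<and> b \<in> K x} = UNIV"
      using subspace_sums[OF sC sK] by (simp add: dim_eq_full span_eq_iff[THEN iffD2])
    then have "w0 \<in> {a + b |a b. a \<in> C \<and> b \<in> K x}" by simp
    then obtain c k where c: "c \<in> C" "k \<in> K x" "w0 = c + k" by blast
    have e: "\<zeta> w0 x = \<zeta> c x" using c(2) linear_add[OF lin[of x], of c k] by (simp add: c(3) K_def)
    have "norm c \<le> 2 / m * norm (\<zeta> w0 x)" using lower[OF c(1)] m(1) by (simp add: e field_simps)
    moreover have \<eta>0: "\<eta> x \<ge> 0" unfolding \<eta>_def by (rule sum_nonneg) simp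
    ultimately have n: "norm c * \<eta> x \<le> (2 / m * norm (\<zeta> w0 x)) * \<eta> x" by (rule mult_right_mono)
    have "l (\<zeta> w0 x) = l (\<zeta> c x - \<zeta> c x0)" using l by (simp add: e linear_diff)
    then have "\<bar>l (\<zeta> w0 x)\<bar> \<le> norm (\<zeta> c x - \<zeta> c x0) * \<Gamma>" using \<Gamma>(2) by simp
    also have "\<dots> \<le> ((2 / m * norm (\<zeta> w0 x)) * \<eta> x) * \<Gamma>"
      using \<eta>[of c x] n \<Gamma>(1) by (intro mult_right_mono) auto
    finally show ?thesis by (simp add: mult_ac)
  qed
  have xt: "((\<lambda>t. x0 + t *\<^sub>R u) \<longlongrightarrow> x0) (at 0)"
    by (auto intro!: tendsto_eq_intros)
  have \<eta>t: "((\<lambda>t. \<eta> (x0 + t *\<^sub>R u)) \<longlongrightarrow> 0) (at 0)"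
    using isCont_tendsto_compose[OF \<eta>_cont xt] by (simp add: \<eta>_def)
  have "((\<lambda>t. \<zeta> w0 (x0 + t *\<^sub>R u)) has_derivative (\<lambda>h. L (h *\<^sub>R u))) (at 0)"
    by (rule has_derivative_compose[where f="\<lambda>t. x0 + t *\<^sub>R u" and g="\<zeta> w0"])
       (auto intro!: derivative_eq_intros simp: L)
  then have "((\<lambda>t. \<zeta> w0 (x0 + t *\<^sub>R u)) has_derivative (\<lambda>h. h *\<^sub>R L u)) (at 0)"
    using linear_cmul[OF has_derivative_linear[OF L]] by simp
  then have ft: "((\<lambda>t. \<zeta> w0 (x0 + t *\<^sub>R u) /\<^sub>R t) \<longlongrightarrow> L u) (at 0)"
    by (rule vector_derivative_quotient_tendsto) (simp add: w0)
  \<comment> \<open>The bound is divided by t: the quotient of \<zeta> w0 converges to L u, while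
    the additional factor \<open>\<eta>\<close> tends to 0.\<close>
  have "\<bar>l (L u)\<bar> \<le> (\<Gamma> * (2 / m)) * 0 * norm (L u)"
  proof (rule tendsto_le[OF at_neq_bot])
    show "((\<lambda>t. \<bar>l (\<zeta> w0 (x0 + t *\<^sub>R u) /\<^sub>R t)\<bar>) \<longlongrightarrow> \<bar>l (L u)\<bar>) (at 0)"
      by (intro tendsto_rabs bounded_linear.tendsto[OF _ ft]) (use l(1) in \<open>simp add: linear_conv_bounded_linear\<close>)
    show "((\<lambda>t. (\<Gamma> * (2 / m)) * \<eta> (x0 + t *\<^sub>R u) * norm (\<zeta> w0 (x0 + t *\<^sub>R u) /\<^sub>R t))
        \<longlongrightarrow> (\<Gamma> * (2 / m)) * 0 * norm (L u)) (at 0)"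
      by (intro tendsto_mult tendsto_const \<eta>t tendsto_norm ft)
    have "\<forall>\<^sub>F t in at 0. x0 + t *\<^sub>R u \<in> S" by (rule topological_tendstoD[OF xt S])
    moreover have "\<forall>\<^sub>F t in at 0. \<eta> (x0 + t *\<^sub>R u) < m / 2"
      by (rule order_tendstoD(2)[OF \<eta>t]) (use m(1) in simp)
    ultimately show "\<forall>\<^sub>F t in at 0. \<bar>l (\<zeta> w0 (x0 + t *\<^sub>R u) /\<^sub>R t)\<bar>
        \<le> (\<Gamma> * (2 / m)) * \<eta> (x0 + t *\<^sub>R u) * norm (\<zeta> w0 (x0 + t *\<^sub>R u) /\<^sub>R t)"
    proof eventually_elim
      case (elim t)
      have "\<bar>l (\<zeta> w0 (x0 + t *\<^sub>R u) /\<^sub>R t)\<bar> = \<bar>inverse t\<bar> * \<bar>l (\<zeta> w0 (x0 + t *\<^sub>R u))\<bar>"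
        using linear_cmul[OF l(1)] by (simp add: abs_mult)
      also have "\<dots> \<le> \<bar>inverse t\<bar> * ((\<Gamma> * (2 / m)) * \<eta> (x0 + t *\<^sub>R u) * norm (\<zeta> w0 (x0 + t *\<^sub>R u)))"
        by (rule mult_left_mono[OF bound[OF elim]]) simp
      finally show ?case by (simp add: mult_ac)
    qed
  qed
  then show ?thesis by simp
qed

section \<open>The Reeb field lies in the Lie algebra of the torus\<close>

context toric_K_contact_manifold
begin

lemma toric_field_vanishes_if_minimal:
  assumes min: "\<And>q. dim (stabilizer p) \<le> dim (stabilizer q)" and w0: "w0 \<in> stabilizer p"
  shows "toric_field w0 q = zero_tangent"
proof -
  obtain U \<phi> r where c: "manifold_chart A U \<phi> p r" by (rule chart_around)
  then interpret manifold_chart A U \<phi> p r .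
  define \<zeta> where "\<zeta> w x = rep (toric_field w) x" for w x
  let ?x0 = "\<phi> p"
  let ?L = "fderiv (\<zeta> w0) ?x0"
  let ?G = "\<lambda>u w. metric_comp g u w ?x0"
  have \<zeta>_eq: "\<zeta> w = rep (toric_field w)" for w by (simp add: \<zeta>_def[abs_def])
  have lin: "linear (\<lambda>w. \<zeta> w x)" for x
  proof -
    have *: "\<zeta> (a *\<^sub>R w + b *\<^sub>R w') x = a *\<^sub>R \<zeta> w x + b *\<^sub>R \<zeta> w' x" for a b w w'
      by (simp add: \<zeta>_def rep_def toric_field_linear coords_lincomb)
    show ?thesis by (rule linear_combinationI) (simp only: * real_scaleR_def)
  qed
  have der: "(\<zeta> w has_derivative fderiv (\<zeta> w) ?x0) (at ?x0)" for w
    unfolding \<zeta>_eq by (rule rep_has_derivative[OF vector_field_toric_field center_B])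
  have stab: "stabilizer (inv\<phi> x) = {w. \<zeta> w x = 0}" if x: "x \<in> B" for x
    using tangent_zeroI[OF inv_B_N[OF x] vector_field_tangent[OF vector_field_toric_field]] coords_zero
    by (auto simp: stabilizer_def \<zeta>_def rep_def)
  have z0: "\<zeta> w0 ?x0 = 0" using w0 stab[OF center_B] by (simp add: inv_center)
  \<comment> \<open>In the vanishing bracket the other field is differentiated in the direction of
    the field of w0, which is 0 at p; what is left is L on the other field.\<close>
  have LO: "?L (\<zeta> w ?x0) = 0" for w
  proof -
    have "rep (lie_bracket (toric_field w0) (toric_field w)) ?x0 = 0"
      by (simp add: rep_def toric_field_commute coords_zero)
    then have "fderiv (\<zeta> w) ?x0 (\<zeta> w0 ?x0) = ?L (\<zeta> w ?x0)"
      unfolding rep_lie_bracket[OF vector_field_toric_field vector_field_toric_field center_B] \<zeta>_eq by simp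
    then show ?thesis using z0 linear_0[OF has_derivative_linear[OF der[of w]]] by simp
  qed
  \<comment> \<open>The term that differentiates the metric along the field drops out, since the
    field vanishes at p.\<close>
  have skew: "?G (?L u) v + ?G u (?L v) = 0" for u v
  proof -
    have "linear (fderiv (metric_comp g u v) ?x0)"
      by (rule linear_frechet_derivative[OF smooth_on_differentiable[OF metric_comp_smooth[OF metric]]])
         (use center in simp)
    then have "fderiv (metric_comp g u v) ?x0 (rep (toric_field w0) ?x0) = 0"
      using z0 by (simp add: \<zeta>_def linear_0)
    then show ?thesis using killing_in_chart[OF metric toric_field_killing center_B, of u v w0] unfolding \<zeta>_eq by simp
  qed
  have lG: "linear (\<lambda>z. ?G z v)" for v by (rule metric_comp_linear[OF metric center_B])
  have L0: "?L u = 0" for u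
  proof (rule ccontr)
    assume ne: "?L u \<noteq> 0"
    \<comment> \<open>The functional z -> G z (L u) kills the span at p, by skew-symmetry and
      because L does. Maximal rank then makes it kill L u too, which replaces the statement that L
      takes values in the span.\<close>
    have "?G (?L u) (?L u) = 0"
    proof (rule maximal_rank_derivative[where l="\<lambda>z. ?G z (?L u)" and S=B and \<zeta>=\<zeta>,
          OF lin _ B_open center_B _ z0 der lG])
      show "isCont (\<zeta> w) ?x0" for w by (rule has_derivative_continuous[OF der])
      show "dim {w. \<zeta> w ?x0 = 0} \<le> dim {w. \<zeta> w x = 0}" if "x \<in> B" for x
        using min[of "inv\<phi> x"] stab[OF that] stab[OF center_B] by (simp add: inv_center)
      show "?G (\<zeta> w ?x0) (?L u) = 0" for w
        using skew[of "\<zeta> w ?x0" u] LO[of w] linear_0[OF lG] by simp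
    qed
    then show False using metric_comp_pos[OF metric center_B ne] by simp
  qed
  show ?thesis
    by (rule killing_vanishes_globally[OF conn metric toric_field_killing c])
       (use w0 L0 in \<open>auto simp: stabilizer_def \<zeta>_eq\<close>)
qed

lemma stabilizer_nontrivial: "\<exists>w. w \<noteq> 0 \<and> w \<in> stabilizer p"
proof -
  obtain U \<phi> r where "manifold_chart A U \<phi> p r" by (rule chart_around)
  then interpret manifold_chart A U \<phi> p r .
  interpret contact_metric_chart A U \<phi> p r \<alpha> \<Phi> g
    by unfold_locales (rule cms, rule vector_field_tangent[OF vector_field_R])
  \<comment> \<open>In X(\<alpha>(Y)) - Y(\<alpha>(X)) - \<alpha>([X, Y]) the first two terms vanish
    by invariance and the third because the induced fields commute.\<close>
  have iso: "form_d \<alpha> (coords (induced X p)) (coords (induced Y p)) = 0" for X Y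
  proof -
    have "\<alpha> p zero_tangent = 0"
      unfolding a_coords[OF zero_tangent, symmetric] by (simp add: coords_zero)
    then show ?thesis
      unfolding exterior_derivative_formula[OF one_form vector_field_induced vector_field_induced, symmetric]
      by (simp add: \<alpha>_induced_invariant induced_commute)
  qed
  have R0: "form_d \<alpha> u (coords (R p)) = 0" for u
    using R_null[of u] antisym[of u "coords (R p)"] by simp
  have c: "coords (toric_field w p) = coords (induced (fst w) p) + snd w *\<^sub>R coords (R p)" for w
    by (simp add: toric_field_def coords_lincomb)
  have "linear (\<lambda>w. coords (toric_field w p))"
  proof -
    have *: "coords (toric_field (a *\<^sub>R w + b *\<^sub>R w') p) = a *\<^sub>R coords (toric_field w p) + b *\<^sub>R coords (toric_field w' p)" for a b w w'
      by (simp add: toric_field_linear coords_lincomb)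
    show ?thesis by (rule linear_combinationI) (simp only: * real_scaleR_def)
  qed
  moreover have "form_d \<alpha> (coords (toric_field w p)) (coords (toric_field w' p)) = 0" for w w'
    by (simp add: c iso R0 R_null)
  moreover have "DIM((real ^ 'n) \<times> real) = CARD('n) + 1" by simp
  moreover have "DIM('e) < 2 * CARD('n)" using dimension by simp
  ultimately obtain w where "w \<noteq> 0" "coords (toric_field w p) = 0"
    by (rule isotropic_not_injective)
  then show ?thesis
    using tangent_zeroI[OF center_N vector_field_tangent[OF vector_field_toric_field]]
    by (intro exI[of _ w]) (simp add: stabilizer_def)
qed

lemma reeb_field_induced: obtains \<eta> where "\<And>q. R q = induced \<eta> q"
proof -
  \<comment> \<open>The dimensions are natural numbers, so a least one is attained.\<close>
  obtain p where min: "\<And>q. dim (stabilizer p) \<le> dim (stabilizer q)"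
    using ex_has_least_nat[of "\<lambda>_. True" undefined "\<lambda>q. dim (stabilizer q)"] by auto
  obtain w where w: "w \<noteq> 0" "w \<in> stabilizer p" using stabilizer_nontrivial by blast
  have f: "induced (fst w) q h + snd w * R q h = 0" for q h
    using toric_field_vanishes_if_minimal[OF min w(2), of q, THEN fun_cong, of h]
    by (simp add: toric_field_def lincomb_def zero_tangent_def)
  \<comment> \<open>Otherwise a nonzero element of the Lie algebra would induce the zero field,
    against faithfulness of the action.\<close>
  have nz: "snd w \<noteq> 0"
  proof
    assume s: "snd w = 0"
    have "fst w = 0"
      by (rule effective) (use f s in \<open>auto simp: zero_tangent_def\<close>)
    then show False using w(1) s by (simp add: prod_eq_iff)
  qed
  have "R q = induced ((- 1 / snd w) *\<^sub>R fst w) q" for q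
  proof
    fix h
    have e: "induced ((- 1 / snd w) *\<^sub>R fst w) q h = (- 1 / snd w) * induced (fst w) q h"
      using induced_linear[of "- 1 / snd w" "fst w" 0 0 q] by (simp add: lincomb_def)
    show "R q h = induced ((- 1 / snd w) *\<^sub>R fst w) q h"
      unfolding e using f[of q h] nz by (simp add: field_simps add_eq_0_iff)
  qed
  then show ?thesis by (rule that)
qed

end

section \<open>The moment map and the sign of the Reeb component\<close>

context torus_action
begin

text \<open>\<beta> of the induced field is linear in X, so its representing vector has the defining
  property, and an inner product admits no second such vector. This justifies the definite
  description.\<close>

lemma universal_moment_map_inner:
  assumes "\<beta> \<in> cotangent_space A p"
  shows "universal_moment_map A \<rho> (p, \<beta>) \<bullet> X = \<beta> (induced X p)"
proof -
  have *: "\<beta> (induced (a *\<^sub>R X + b *\<^sub>R Y) p) = a * \<beta> (induced X p) + b * \<beta> (induced Y p)" for a b X Y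
    using assms induced_tangent unfolding induced_linear cotangent_space_def by blast
  have l: "linear (\<lambda>X. \<beta> (induced X p))"
  proof (rule linearI)
    show "\<beta> (induced (X + Y) p) = \<beta> (induced X p) + \<beta> (induced Y p)" for X Y using *[of 1 X 1 Y] by simp
    show "\<beta> (induced (a *\<^sub>R X) p) = a *\<^sub>R \<beta> (induced X p)" for a X using *[of a X 0 X] by simp
  qed
  let ?\<mu> = "\<Sum>b\<in>Basis. \<beta> (induced b p) *\<^sub>R b"
  have \<mu>: "\<forall>X. ?\<mu> \<bullet> X = \<beta> (induced X p)"
  proof
    fix X
    show "?\<mu> \<bullet> X = \<beta> (induced X p)"
      unfolding linear_basis_expansion[OF l, of X]
      unfolding inner_sum_left by (rule sum.cong) (simp_all add: inner_commute mult.commute)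
  qed
  have "(THE \<mu>. \<forall>X. \<mu> \<bullet> X = \<beta> (induced X p)) = ?\<mu>"
  proof (rule the_equality)
    show "\<forall>X. ?\<mu> \<bullet> X = \<beta> (induced X p)" by (rule \<mu>)
    show "\<nu> = ?\<mu>" if "\<forall>X. \<nu> \<bullet> X = \<beta> (induced X p)" for \<nu>
      by (rule iffD1[OF vector_eq_rdot]) (simp add: that \<mu>)
  qed
  then show ?thesis using \<mu> unfolding universal_moment_map_def by simp
qed

end

text \<open>Since the conormals do not span, some nonzero v is orthogonal to all of them, and every
  defining inequality is an equality at v and at - v.\<close>

lemma weakly_convex_good_cone_contains_line:
  assumes "weakly_convex_good_cone C"
  obtains v where "v \<noteq> 0" "v \<in> C" "- v \<in> C"
proof -
  obtain H where H: "C = polyhedral_cone H" "span H \<noteq> UNIV"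
    using assms unfolding weakly_convex_good_cone_def good_cone_def by blast
  obtain v where v: "v \<noteq> 0" "\<And>x. x \<in> span H \<Longrightarrow> v \<bullet> x = 0"
    using span_not_UNIV_orthogonal[OF H(2)] by blast
  show ?thesis
    by (rule that[OF v(1)]) (use v(2) in \<open>simp_all add: H(1) polyhedral_cone_def span_base\<close>)
qed

theorem theorem1p2:
  fixes A :: "('m::{t2_space,second_countable_topology}, 'e::euclidean_space) atlas"
    and \<xi> :: "'m \<Rightarrow> 'm tangent set"
    and P :: "('m \<times> 'm covector) set"
    and \<rho> :: "complex ^ 'n \<Rightarrow> 'm \<Rightarrow> 'm"
    and \<alpha> :: "'m form"
    and \<Phi> :: "'m \<Rightarrow> 'm tangent \<Rightarrow> 'm tangent"
    and g :: "'m \<Rightarrow> 'm tangent \<Rightarrow> 'm tangent \<Rightarrow> real"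
  assumes "compact (UNIV :: 'm set)" and "connected (UNIV :: 'm set)"
    and "contact_toric A \<xi> P \<rho>"
    and "weakly_convex_good_cone (moment_cone A P \<rho>)"
    and "contact_form_for A \<xi> \<alpha>" and "invariant_form A \<rho> \<alpha>"
    and "riemannian_metric A g" and "invariant_metric A \<rho> g"
    and "tangent_endomorphism A \<Phi>" and "invariant_endomorphism A \<rho> \<Phi>"
    and "contact_metric_structure A \<alpha> \<Phi> g"
  shows "\<not> toric_K_contact A \<xi> P \<rho> \<alpha> \<Phi> g"
proof
  assume K: "toric_K_contact A \<xi> P \<rho> \<alpha> \<Phi> g"
  interpret toric_K_contact_manifold A \<rho> \<alpha> \<Phi> g
  proof
    show "smooth_atlas A" using assms(3) by (simp add: contact_toric_def cooriented_contact_def)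
    show "bij (\<rho> z)" if "z \<in> torus" for z
      using assms(3) that by (simp add: contact_toric_def contactomorphism_def)
    show "\<rho> (z * w) = \<rho> z \<circ> \<rho> w" if "z \<in> torus" "w \<in> torus" for z w
      using assms(3) that by (simp add: contact_toric_def)
    show "smooth_map (product_atlas euclidean_atlas A) A (\<lambda>(X, p). \<rho> (torus_exp X) p)"
      "inj_on \<rho> torus" "2 * CARD('n) = DIM('e) + 1"
      using assms(3) by (auto simp: contact_toric_def)
    show "killing_field A g (reeb_field A \<alpha>)"
      using K by (simp add: toric_K_contact_def K_contact_structure_def)
  qed (rule assms)+
  obtain \<eta> where \<eta>: "\<And>q. R q = induced \<eta> q" by (rule reeb_field_induced) blast
  obtain \<alpha>\<^sub>0 where \<alpha>\<^sub>0: "contact_form_for A \<xi> \<alpha>\<^sub>0"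
    "P = {(p, \<beta>) \<in> annihilator A \<xi>. \<exists>c>0. \<forall>v. \<beta> v = c * \<alpha>\<^sub>0 p v}"
    using assms(3) by (auto simp: contact_toric_def cooriented_contact_def)
  \<comment> \<open>The form \<open>\<alpha>\<^sub>0\<close> gives the chosen coorientation and
    \<alpha> may have the opposite sign. Both have kernel \<xi>, so h has no zeros; on a connected
    manifold its sign is constant, whichever it is.\<close>
  define h where "h q = \<alpha>\<^sub>0 q (R q)" for q
  have "one_form A \<alpha>\<^sub>0" using \<alpha>\<^sub>0(1) by (simp add: contact_form_for_def contact_form_def)
  then have "smooth_fun A h" using vector_field_R by (simp add: one_form_def h_def[abs_def])
  then have "connected (range h)"
    using connected_continuous_image[OF smooth_fun_continuous conn] by blast
  have h0: "h q \<noteq> 0" for q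
  proof
    assume "h q = 0"
    then have "R q \<in> kernel_at A \<alpha>\<^sub>0 q"
      using vector_field_tangent[OF vector_field_R] by (simp add: kernel_at_def h_def)
    then have "R q \<in> kernel_at A \<alpha> q" using \<alpha>\<^sub>0(1) assms(5) by (simp add: contact_form_for_def)
    then show False using \<alpha>_R_pos[of q] by (simp add: kernel_at_def)
  qed
  obtain v where v: "v \<noteq> 0" "v \<in> moment_cone A P \<rho>" "- v \<in> moment_cone A P \<rho>"
    by (rule weakly_convex_good_cone_contains_line[OF assms(4)])
  \<comment> \<open>Points of P are covectors c \<open>\<alpha>\<^sub>0\<close> with c > 0, and
    \<eta> induces R. The apex is excluded, as it was adjoined to the image of the moment
    map.\<close>
  have sgn: "\<exists>p c. c > 0 \<and> x \<bullet> \<eta> = c * h p" if "x \<in> moment_cone A P \<rho>" "x \<noteq> 0" for x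
  proof -
    have "x \<in> universal_moment_map A \<rho> ` P" using that by (simp add: moment_cone_def)
    then obtain p \<beta> where p: "(p, \<beta>) \<in> P" "x = universal_moment_map A \<rho> (p, \<beta>)" by auto
    obtain c where c: "c > 0" "\<And>v. \<beta> v = c * \<alpha>\<^sub>0 p v" "\<beta> \<in> cotangent_space A p"
      using p(1) \<alpha>\<^sub>0(2) by (auto simp: annihilator_def)
    have "x \<bullet> \<eta> = c * h p"
      using universal_moment_map_inner[OF c(3), of \<eta>] by (simp add: p(2) c(2) h_def \<eta>)
    then show ?thesis using c(1) by blast
  qed
  obtain p c where p: "c > 0" "v \<bullet> \<eta> = c * h p" using sgn[OF v(2,1)] by blast
  obtain p' c' where p': "c' > 0" "(- v) \<bullet> \<eta> = c' * h p'" using sgn[OF v(3)] v(1) by auto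
  have opp: "c * h p = - (c' * h p')" using p(2) p'(2) by simp
  \<comment> \<open>The two directions of the line force opposite signs of h at p and p', so its
    connected range would contain 0.\<close>
  have "c * h p < 0 \<longleftrightarrow> c' * h p' > 0" using opp by linarith
  then have "h p < 0 \<longleftrightarrow> h p' > 0" using p(1) p'(1) by (simp add: mult_less_0_iff zero_less_mult_iff)
  then have "h p < 0 \<and> h p' > 0 \<or> h p' < 0 \<and> h p > 0" using h0[of p] h0[of p'] by (auto simp: neq_iff)
  then have "0 \<in> range h"
    using connected_contains_Icc[OF \<open>connected (range h)\<close>, of "h p" "h p'"]
      connected_contains_Icc[OF \<open>connected (range h)\<close>, of "h p'" "h p"] by (auto simp: subset_iff)
  then show False using h0 by auto
qed

end
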